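(* Let $d\ge 3$, let $k\ge 0$ be an integer, and let $\bar{R}$ be a finite commutative ring with $1$ generated (as a unital ring) by $k$ elements. Then every element of $K_2(\bar{R})=K_2(\bar R;d)$ is a product of at most $k+2$ Steinberg symbols $\{a,b\}$ with $a,b\in\bar{R}^*$.
   Context: For a commutative ring $\bar R$ with $1$ and $d\geq 3$, the Steinberg group $\mathrm{St}_d(\bar R)$ is the group generated by elements $x_{i,j}(r)$, for distinct $i,j\in\{1,\dots,d\}$ and $r\in\bar R$, subject to the relations (with $[a,b]=aba^{-1}b^{-1}$), for all $u,v\in\bar R$: (1) $x_{i,j}(u)x_{i,j}(v)=x_{i,j}(u+v)$; (2) $[x_{i,j}(u),x_{j,k}(v)]=x_{i,k}(uv)$ for distinct $i,j,k$; (3) $[x_{i,j}(u),x_{k,l}(v)]=1$ whenever $j\neq k$ and $i\neq l$. There is a homomorphism $\phi:\mathrm{St}_d(\bar R)\to \mathrm{SL}_d(\bar R)$, $x_{i,j}(u)\mapsto \mathrm{Id}+u\,e_{i,j}$, where $e_{i,j}$ is the matrix unit, and $K_2(\bar R;d):=\ker\phi$, also written $K_2(\bar R)$. For a unit $u\in\bar R^*$ and $i\neq j$ set $w_{i,j}(u)=x_{i,j}(u)x_{j,i}(-u^{-1})x_{i,j}(u)$ and $h_{i,j}(u)=w_{i,j}(u)w_{i,j}(-1)$. For units $u,v\in \bar R^*$ the Steinberg symbol is $\{u,v\}=h_{i,j}(uv)h_{i,j}(u)^{-1}h_{i,j}(v)^{-1}$; it lies in $K_2(\bar R;d)$ and is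 independent of the choice of $i\ne j$. *)

theory Defs
  imports "HOL-Algebra.Algebra" "HOL-Combinatorics.Permutations"
begin

text \<open>A letter \<open>(x, True)\<close> stands for the generator \<open>x\<close>, and \<open>(x, False)\<close> for its inverse.
  A relation is a pair of words that are to become equal.\<close>

type_synonym 'g word = "('g \<times> bool) list"

definition inv_word :: "'g word \<Rightarrow> 'g word" where
  "inv_word w = rev (map (\<lambda>(x, b). (x, \<not> b)) w)"

definition comm_word :: "'g word \<Rightarrow> 'g word \<Rightarrow> 'g word" where
  "comm_word a b = a @ b @ inv_word a @ inv_word b"

definition words :: "'g set \<Rightarrow> 'g word set" where
  "words S = lists (S \<times> UNIV)"

inductive_set pres_eq :: "'g set \<Rightarrow> ('g word \<times> 'g word) set \<Rightarrow> ('g word \<times> 'g word) set"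
  for S :: "'g set" and E :: "('g word \<times> 'g word) set" where
  pres_refl: "w \<in> words S \<Longrightarrow> (w, w) \<in> pres_eq S E"
| pres_sym: "(v, w) \<in> pres_eq S E \<Longrightarrow> (w, v) \<in> pres_eq S E"
| pres_trans: "(u, v) \<in> pres_eq S E \<Longrightarrow> (v, w) \<in> pres_eq S E \<Longrightarrow> (u, w) \<in> pres_eq S E"
| pres_cancel: "u \<in> words S \<Longrightarrow> v \<in> words S \<Longrightarrow> x \<in> S
    \<Longrightarrow> (u @ [(x, b), (x, \<not> b)] @ v, u @ v) \<in> pres_eq S E"
| pres_relation: "u \<in> words S \<Longrightarrow> v \<in> words S \<Longrightarrow> (l, r) \<in> E \<Longrightarrow> l \<in> words S \<Longrightarrow> r \<in> words S
    \<Longrightarrow> (u @ l @ v, u @ r @ v) \<in> pres_eq S E"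

definition presented_group ::
  "'g set \<Rightarrow> ('g word \<times> 'g word) set \<Rightarrow> 'g word set monoid" where
  "presented_group S E = \<lparr>
     carrier = words S // pres_eq S E,
     monoid.mult = (\<lambda>A B. \<Union>u\<in>A. \<Union>v\<in>B. pres_eq S E `` {u @ v}),
     monoid.one = pres_eq S E `` {[]} \<rparr>"

lemma words_simps [simp]:
  "[] \<in> words S"
  "(l # w) \<in> words S \<longleftrightarrow> fst l \<in> S \<and> w \<in> words S"
  "(v @ w) \<in> words S \<longleftrightarrow> v \<in> words S \<and> w \<in> words S"
  "inv_word w \<in> words S \<longleftrightarrow> w \<in> words S"
  by (auto simp: words_def inv_word_def mem_Times_iff in_lists_conv_set split: prod.splits)

lemma pres_eq_words: "(v, w) \<in> pres_eq S E \<Longrightarrow> v \<in> words S \<and> w \<in> words S"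
  by (induction rule: pres_eq.induct) auto

lemma equiv_pres_eq: "equiv (words S) (pres_eq S E)"
  by (rule equivI) (auto simp: refl_on_def sym_def trans_def
      dest: pres_eq_words intro: pres_refl pres_sym pres_trans)

lemma pres_eq_app_left: "(v, w) \<in> pres_eq S E \<Longrightarrow> a \<in> words S \<Longrightarrow> (a @ v, a @ w) \<in> pres_eq S E"
proof (induction rule: pres_eq.induct)
  case (pres_cancel u v x b)
  then show ?case using pres_eq.pres_cancel[of "a @ u" S v x b E] by simp
next
  case (pres_relation u v l r)
  then show ?case using pres_eq.pres_relation[of "a @ u" S v l r E] by simp
qed (auto intro: pres_refl pres_sym pres_trans)

lemma pres_eq_app_right: "(v, w) \<in> pres_eq S E \<Longrightarrow> a \<in> words S \<Longrightarrow> (v @ a, w @ a) \<in> pres_eq S E"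
proof (induction rule: pres_eq.induct)
  case (pres_cancel u v x b)
  then show ?case using pres_eq.pres_cancel[of u S "v @ a" x b E] by simp
next
  case (pres_relation u v l r)
  then show ?case using pres_eq.pres_relation[of u S "v @ a" l r E] by simp
qed (auto intro: pres_refl pres_sym pres_trans)

lemma pres_eq_app:
  "(v, w) \<in> pres_eq S E \<Longrightarrow> (v', w') \<in> pres_eq S E \<Longrightarrow> (v @ v', w @ w') \<in> pres_eq S E"
  by (meson pres_trans pres_eq_app_left pres_eq_app_right pres_eq_words)

lemma presented_mult:
  assumes "u \<in> words S" "v \<in> words S"
  shows "monoid.mult (presented_group S E) (pres_eq S E `` {u}) (pres_eq S E `` {v})
    = pres_eq S E `` {u @ v}"
proof -
  let ?K = "pres_eq S E `` {u @ v}"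
  have K: "pres_eq S E `` {u' @ v'} = ?K"
    if "u' \<in> pres_eq S E `` {u}" "v' \<in> pres_eq S E `` {v}" for u' v'
    using that equiv_class_eq[OF equiv_pres_eq pres_eq_app] by fastforce
  have ne: "pres_eq S E `` {u} \<noteq> {}" "pres_eq S E `` {v} \<noteq> {}"
    using pres_refl[OF assms(1)] pres_refl[OF assms(2)] by auto
  have "(\<Union>u'\<in>pres_eq S E `` {u}. \<Union>v'\<in>pres_eq S E `` {v}. pres_eq S E `` {u' @ v'})
      = (\<Union>u'\<in>pres_eq S E `` {u}. \<Union>v'\<in>pres_eq S E `` {v}. ?K)"
    by (intro SUP_cong[OF refl] K)
  also have "\<dots> = ?K"
    using ne by (simp only: UN_constant if_False)
  finally show ?thesis by (simp add: presented_group_def)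
qed

lemma presented_carrier:
  "carrier (presented_group S E) = {pres_eq S E `` {w} | w. w \<in> words S}"
  by (auto simp: presented_group_def quotient_def)

lemma presented_one: "monoid.one (presented_group S E) = pres_eq S E `` {[]}"
  by (simp add: presented_group_def)

lemma inv_word_left: "w \<in> words S \<Longrightarrow> (inv_word w @ w, []) \<in> pres_eq S E"
proof (induction w)
  case Nil
  then show ?case by (simp add: inv_word_def pres_refl)
next
  case (Cons l w)
  obtain x b where l: "l = (x, b)" by force
  have "(inv_word w @ [(x, \<not> b), (x, \<not> \<not> b)] @ w, inv_word w @ w) \<in> pres_eq S E"
    using Cons.prems l by (intro pres_cancel) auto
  moreover have "inv_word (l # w) @ l # w = inv_word w @ [(x, \<not> b), (x, \<not> \<not> b)] @ w"
    by (simp add: l inv_word_def)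
  ultimately show ?case using Cons by (metis pres_trans words_simps(2))
qed

theorem group_presented_group: "group (presented_group S E)"
proof (rule groupI)
  fix A assume "A \<in> carrier (presented_group S E)"
  then obtain w where w: "w \<in> words S" "A = pres_eq S E `` {w}"
    by (auto simp: presented_carrier)
  have "pres_eq S E `` {inv_word w @ w} = pres_eq S E `` {[]}"
    by (rule equiv_class_eq[OF equiv_pres_eq inv_word_left[OF w(1)]])
  then show "\<exists>B\<in>carrier (presented_group S E).
      B \<otimes>\<^bsub>presented_group S E\<^esub> A = \<one>\<^bsub>presented_group S E\<^esub>"
    using w by (intro bexI[of _ "pres_eq S E `` {inv_word w}"])
      (auto simp: presented_mult presented_one presented_carrier)
next
  fix A B C
  assume "A \<in> carrier (presented_group S E)" "B \<in> carrier (presented_group S E)"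
    "C \<in> carrier (presented_group S E)"
  then show "A \<otimes>\<^bsub>presented_group S E\<^esub> B \<otimes>\<^bsub>presented_group S E\<^esub> C
      = A \<otimes>\<^bsub>presented_group S E\<^esub> (B \<otimes>\<^bsub>presented_group S E\<^esub> C)"
    by (auto simp: presented_carrier presented_mult)
next
  fix A B assume "A \<in> carrier (presented_group S E)" "B \<in> carrier (presented_group S E)"
  then show "A \<otimes>\<^bsub>presented_group S E\<^esub> B \<in> carrier (presented_group S E)"
    by (auto simp: presented_carrier presented_mult)
next
  show "\<one>\<^bsub>presented_group S E\<^esub> \<in> carrier (presented_group S E)"
    by (auto simp: presented_carrier presented_one intro: exI[of _ "[]"])
next
  fix A assume "A \<in> carrier (presented_group S E)"
  then show "\<one>\<^bsub>presented_group S E\<^esub> \<otimes>\<^bsub>presented_group S E\<^esub> A = A"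
    by (auto simp: presented_carrier presented_mult presented_one)
qed

type_synonym 'a st_generator = "nat \<times> nat \<times> 'a"

definition st_generators :: "('a, 'b) ring_scheme \<Rightarrow> nat \<Rightarrow> 'a st_generator set" where
  "st_generators R d =
     {(i, j, r). i \<in> {1..d} \<and> j \<in> {1..d} \<and> i \<noteq> j \<and> r \<in> carrier R}"

abbreviation st_letter :: "nat \<Rightarrow> nat \<Rightarrow> 'a \<Rightarrow> 'a st_generator word" where
  "st_letter i j r \<equiv> [((i, j, r), True)]"

inductive_set st_relations ::
  "('a, 'b) ring_scheme \<Rightarrow> nat \<Rightarrow> ('a st_generator word \<times> 'a st_generator word) set"
  for R :: "('a, 'b) ring_scheme" (structure) and d :: nat where
  st_additive:
    "\<lbrakk>i \<in> {1..d}; j \<in> {1..d}; i \<noteq> j; u \<in> carrier R; v \<in> carrier R\<rbrakk>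
     \<Longrightarrow> (st_letter i j u @ st_letter i j v, st_letter i j (u \<oplus> v)) \<in> st_relations R d"
| st_commutator:
    "\<lbrakk>i \<in> {1..d}; j \<in> {1..d}; k \<in> {1..d}; i \<noteq> j; j \<noteq> k; i \<noteq> k; u \<in> carrier R; v \<in> carrier R\<rbrakk>
     \<Longrightarrow> (comm_word (st_letter i j u) (st_letter j k v), st_letter i k (u \<otimes> v))
         \<in> st_relations R d"
| st_commuting:
    "\<lbrakk>i \<in> {1..d}; j \<in> {1..d}; k \<in> {1..d}; l \<in> {1..d}; i \<noteq> j; k \<noteq> l; j \<noteq> k; i \<noteq> l;
      u \<in> carrier R; v \<in> carrier R\<rbrakk>
     \<Longrightarrow> (comm_word (st_letter i j u) (st_letter k l v), []) \<in> st_relations R d"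

definition Steinberg ::
  "('a, 'b) ring_scheme \<Rightarrow> nat \<Rightarrow> 'a st_generator word set monoid" where
  "Steinberg R d = presented_group (st_generators R d) (st_relations R d)"

definition st_x ::
  "('a, 'b) ring_scheme \<Rightarrow> nat \<Rightarrow> nat \<Rightarrow> nat \<Rightarrow> 'a \<Rightarrow> 'a st_generator word set" where
  "st_x R d i j r = pres_eq (st_generators R d) (st_relations R d) `` {st_letter i j r}"

theorem group_Steinberg: "group (Steinberg R d)"
  unfolding Steinberg_def by (rule group_presented_group)

type_synonym 'a sqmat = "nat \<times> nat \<Rightarrow> 'a"

definition sqmats :: "('a, 'b) ring_scheme \<Rightarrow> nat \<Rightarrow> 'a sqmat set" where
  "sqmats R d = ({1..d} \<times> {1..d}) \<rightarrow>\<^sub>E carrier R"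

definition mat_mult ::
  "('a, 'b) ring_scheme \<Rightarrow> nat \<Rightarrow> 'a sqmat \<Rightarrow> 'a sqmat \<Rightarrow> 'a sqmat" where
  "mat_mult R d A B =
     (\<lambda>(a, c)\<in>{1..d} \<times> {1..d}. \<Oplus>\<^bsub>R\<^esub>b\<in>{1..d}. A (a, b) \<otimes>\<^bsub>R\<^esub> B (b, c))"

definition mat_one :: "('a, 'b) ring_scheme \<Rightarrow> nat \<Rightarrow> 'a sqmat" where
  "mat_one R d = (\<lambda>(a, c)\<in>{1..d} \<times> {1..d}. if a = c then \<one>\<^bsub>R\<^esub> else \<zero>\<^bsub>R\<^esub>)"

definition mat_det :: "('a, 'b) ring_scheme \<Rightarrow> nat \<Rightarrow> 'a sqmat \<Rightarrow> 'a" where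
  "mat_det R d A = (\<Oplus>\<^bsub>R\<^esub>p\<in>{p. p permutes {1..d}}.
     (if evenperm p then \<Otimes>\<^bsub>R\<^esub>a\<in>{1..d}. A (a, p a)
      else \<ominus>\<^bsub>R\<^esub> (\<Otimes>\<^bsub>R\<^esub>a\<in>{1..d}. A (a, p a))))"

definition SL :: "('a, 'b) ring_scheme \<Rightarrow> nat \<Rightarrow> 'a sqmat monoid" where
  "SL R d = \<lparr> carrier = {A \<in> sqmats R d. mat_det R d A = \<one>\<^bsub>R\<^esub>},
              monoid.mult = mat_mult R d, monoid.one = mat_one R d \<rparr>"

definition elem_mat :: "('a, 'b) ring_scheme \<Rightarrow> nat \<Rightarrow> nat \<Rightarrow> nat \<Rightarrow> 'a \<Rightarrow> 'a sqmat" where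
  "elem_mat R d i j u = (\<lambda>(a, c)\<in>{1..d} \<times> {1..d}.
     (if a = c then \<one>\<^bsub>R\<^esub> else \<zero>\<^bsub>R\<^esub>) \<oplus>\<^bsub>R\<^esub> (if a = i \<and> c = j then u else \<zero>\<^bsub>R\<^esub>))"

text \<open>Inverse letters are sent to \<open>Id - u e\<^sub>i\<^sub>j\<close>, the inverse of \<open>Id + u e\<^sub>i\<^sub>j\<close>.\<close>

fun word_mat :: "('a, 'b) ring_scheme \<Rightarrow> nat \<Rightarrow> 'a st_generator word \<Rightarrow> 'a sqmat" where
  "word_mat R d [] = mat_one R d"
| "word_mat R d (((i, j, u), b) # w) =
     mat_mult R d (elem_mat R d i j (if b then u else \<ominus>\<^bsub>R\<^esub> u)) (word_mat R d w)"

text \<open>Elements of the Steinberg group are classes of words, and \<open>word_mat\<close> is constant on each class: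
  see \<open>word_mat_pres_eq\<close>, and \<open>st_phi_st_x\<close> and \<open>st_phi_hom\<close> for the resulting map.\<close>

definition st_phi ::
  "('a, 'b) ring_scheme \<Rightarrow> nat \<Rightarrow> 'a st_generator word set \<Rightarrow> 'a sqmat" where
  "st_phi R d C = the_elem (word_mat R d ` C)"

definition K2 :: "('a, 'b) ring_scheme \<Rightarrow> nat \<Rightarrow> 'a st_generator word set set" where
  "K2 R d = kernel (Steinberg R d) (SL R d) (st_phi R d)"

definition st_w ::
  "('a, 'b) ring_scheme \<Rightarrow> nat \<Rightarrow> nat \<Rightarrow> nat \<Rightarrow> 'a \<Rightarrow> 'a st_generator word set" where
  "st_w R d i j u =
     st_x R d i j u \<otimes>\<^bsub>Steinberg R d\<^esub> st_x R d j i (\<ominus>\<^bsub>R\<^esub> (inv\<^bsub>R\<^esub> u))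
       \<otimes>\<^bsub>Steinberg R d\<^esub> st_x R d i j u"

definition st_h ::
  "('a, 'b) ring_scheme \<Rightarrow> nat \<Rightarrow> nat \<Rightarrow> nat \<Rightarrow> 'a \<Rightarrow> 'a st_generator word set" where
  "st_h R d i j u = st_w R d i j u \<otimes>\<^bsub>Steinberg R d\<^esub> st_w R d i j (\<ominus>\<^bsub>R\<^esub> \<one>\<^bsub>R\<^esub>)"

text \<open>The symbol does not depend on the choice of distinct \<open>i\<close> and \<open>j\<close>; they are kept as parameters.\<close>

definition st_symbol ::
  "('a, 'b) ring_scheme \<Rightarrow> nat \<Rightarrow> nat \<Rightarrow> nat \<Rightarrow> 'a \<Rightarrow> 'a \<Rightarrow> 'a st_generator word set" where
  "st_symbol R d i j u v =
     st_h R d i j (u \<otimes>\<^bsub>R\<^esub> v)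
       \<otimes>\<^bsub>Steinberg R d\<^esub> inv\<^bsub>Steinberg R d\<^esub> (st_h R d i j u)
       \<otimes>\<^bsub>Steinberg R d\<^esub> inv\<^bsub>Steinberg R d\<^esub> (st_h R d i j v)"

context cring
begin

lemma finsum_swap:
  assumes "finite A" "finite B" "\<And>a b. a \<in> A \<Longrightarrow> b \<in> B \<Longrightarrow> f a b \<in> carrier R"
  shows "(\<Oplus>a\<in>A. \<Oplus>b\<in>B. f a b) = (\<Oplus>b\<in>B. \<Oplus>a\<in>A. f a b)"
  using assms
proof (induction A rule: finite_induct)
  case (insert x A)
  have "(\<Oplus>b\<in>B. \<Oplus>a\<in>insert x A. f a b) = (\<Oplus>b\<in>B. f x b \<oplus> (\<Oplus>a\<in>A. f a b))"
    using insert by (intro finsum_cong') (auto intro!: finsum_closed)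
  also have "\<dots> = (\<Oplus>b\<in>B. f x b) \<oplus> (\<Oplus>b\<in>B. \<Oplus>a\<in>A. f a b)"
    using insert by (intro finsum_addf) (auto intro!: finsum_closed)
  finally show ?case
    using insert by (subst finsum_insert) (auto intro!: finsum_closed)
qed simp

lemma sqmats_entry: "A \<in> sqmats R d \<Longrightarrow> a \<in> {1..d} \<Longrightarrow> c \<in> {1..d} \<Longrightarrow> A (a, c) \<in> carrier R"
  by (auto simp: sqmats_def)

lemma sqmats_eqI:
  assumes "A \<in> sqmats R d" "B \<in> sqmats R d"
    and "\<And>a c. a \<in> {1..d} \<Longrightarrow> c \<in> {1..d} \<Longrightarrow> A (a, c) = B (a, c)"
  shows "A = B"
  using assms unfolding sqmats_def by (intro PiE_ext) auto

lemma mat_mult_entry: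
  "a \<in> {1..d} \<Longrightarrow> c \<in> {1..d} \<Longrightarrow>
     mat_mult R d A B (a, c) = (\<Oplus>b\<in>{1..d}. A (a, b) \<otimes> B (b, c))"
  by (simp add: mat_mult_def)

lemma mat_mult_closed:
  "A \<in> sqmats R d \<Longrightarrow> B \<in> sqmats R d \<Longrightarrow> mat_mult R d A B \<in> sqmats R d"
  unfolding sqmats_def mat_mult_def by (auto intro!: finsum_closed simp: PiE_iff)

lemma mat_one_closed: "mat_one R d \<in> sqmats R d"
  unfolding sqmats_def mat_one_def by auto

lemma elem_mat_closed: "u \<in> carrier R \<Longrightarrow> elem_mat R d i j u \<in> sqmats R d"
  unfolding sqmats_def elem_mat_def by auto

lemma mat_mult_assoc:
  assumes "A \<in> sqmats R d" "B \<in> sqmats R d" "C \<in> sqmats R d"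
  shows "mat_mult R d (mat_mult R d A B) C = mat_mult R d A (mat_mult R d B C)"
proof (rule sqmats_eqI)
  fix a c assume ac: "a \<in> {1..d}" "c \<in> {1..d}"
  note e = sqmats_entry[OF assms(1)] sqmats_entry[OF assms(2)] sqmats_entry[OF assms(3)]
  have "mat_mult R d (mat_mult R d A B) C (a, c)
      = (\<Oplus>b\<in>{1..d}. (\<Oplus>e\<in>{1..d}. A (a, e) \<otimes> B (e, b)) \<otimes> C (b, c))"
    unfolding mat_mult_entry[OF ac]
    using ac e by (intro finsum_cong') (auto simp: mat_mult_entry intro!: finsum_closed)
  also have "\<dots> = (\<Oplus>b\<in>{1..d}. \<Oplus>e\<in>{1..d}. A (a, e) \<otimes> B (e, b) \<otimes> C (b, c))"
    using ac e by (intro finsum_cong' finsum_ldistr) (auto intro!: finsum_closed)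
  also have "\<dots> = (\<Oplus>e\<in>{1..d}. \<Oplus>b\<in>{1..d}. A (a, e) \<otimes> B (e, b) \<otimes> C (b, c))"
    using ac e by (intro finsum_swap) auto
  also have "\<dots> = (\<Oplus>e\<in>{1..d}. \<Oplus>b\<in>{1..d}. A (a, e) \<otimes> (B (e, b) \<otimes> C (b, c)))"
    using ac e by (intro finsum_cong') (auto intro!: finsum_closed finsum_cong' simp: m_assoc)
  also have "\<dots> = (\<Oplus>e\<in>{1..d}. A (a, e) \<otimes> (\<Oplus>b\<in>{1..d}. B (e, b) \<otimes> C (b, c)))"
    using ac e by (intro finsum_cong' finsum_rdistr[symmetric]) (auto intro!: finsum_closed)
  also have "\<dots> = mat_mult R d A (mat_mult R d B C) (a, c)"
    unfolding mat_mult_entry[OF ac]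
    using ac e by (intro finsum_cong') (auto simp: mat_mult_entry intro!: finsum_closed)
  finally show "mat_mult R d (mat_mult R d A B) C (a, c)
    = mat_mult R d A (mat_mult R d B C) (a, c)" .
qed (use assms in \<open>auto intro: mat_mult_closed\<close>)

lemma mat_one_left:
  assumes "A \<in> sqmats R d"
  shows "mat_mult R d (mat_one R d) A = A"
proof (rule sqmats_eqI)
  fix a c assume ac: "a \<in> {1..d}" "c \<in> {1..d}"
  note e = sqmats_entry[OF assms]
  have "mat_mult R d (mat_one R d) A (a, c) = (\<Oplus>b\<in>{1..d}. if a = b then A (b, c) else \<zero>)"
    unfolding mat_mult_entry[OF ac]
    using ac e by (intro finsum_cong') (auto simp: mat_one_def)
  also have "\<dots> = A (a, c)"
    using ac e by (intro add.finprod_singleton) auto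
  finally show "mat_mult R d (mat_one R d) A (a, c) = A (a, c)" .
qed (use assms in \<open>auto intro: mat_mult_closed mat_one_closed\<close>)

lemma mat_one_right:
  assumes "A \<in> sqmats R d"
  shows "mat_mult R d A (mat_one R d) = A"
proof (rule sqmats_eqI)
  fix a c assume ac: "a \<in> {1..d}" "c \<in> {1..d}"
  note e = sqmats_entry[OF assms]
  have "mat_mult R d A (mat_one R d) (a, c) = (\<Oplus>b\<in>{1..d}. if c = b then A (a, b) else \<zero>)"
    unfolding mat_mult_entry[OF ac]
    using ac e by (intro finsum_cong') (auto simp: mat_one_def)
  also have "\<dots> = A (a, c)"
    using ac e by (intro add.finprod_singleton) auto
  finally show "mat_mult R d A (mat_one R d) (a, c) = A (a, c)" .
qed (use assms in \<open>auto intro: mat_mult_closed mat_one_closed\<close>)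

lemma elem_mat_mult_entry:
  assumes "A \<in> sqmats R d" "u \<in> carrier R" "i \<in> {1..d}" "j \<in> {1..d}"
    and ac: "a \<in> {1..d}" "c \<in> {1..d}"
  shows "mat_mult R d (elem_mat R d i j u) A (a, c)
    = (if a = i then A (a, c) \<oplus> u \<otimes> A (j, c) else A (a, c))"
proof -
  note e = sqmats_entry[OF assms(1)]
  have "mat_mult R d (elem_mat R d i j u) A (a, c)
      = (\<Oplus>b\<in>{1..d}. (if a = b then A (b, c) else \<zero>)
          \<oplus> (if j = b then (if a = i then u \<otimes> A (b, c) else \<zero>) else \<zero>))"
    unfolding mat_mult_entry[OF ac]
    using assms e by (intro finsum_cong') (auto simp: elem_mat_def l_distr)
  also have "\<dots> = (\<Oplus>b\<in>{1..d}. if a = b then A (b, c) else \<zero>)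
      \<oplus> (\<Oplus>b\<in>{1..d}. if j = b then (if a = i then u \<otimes> A (b, c) else \<zero>) else \<zero>)"
    using assms e by (intro finsum_addf) auto
  also have "(\<Oplus>b\<in>{1..d}. if a = b then A (b, c) else \<zero>) = A (a, c)"
    using ac e by (intro add.finprod_singleton) auto
  also have "(\<Oplus>b\<in>{1..d}. if j = b then (if a = i then u \<otimes> A (b, c) else \<zero>) else \<zero>)
      = (if a = i then u \<otimes> A (j, c) else \<zero>)"
    using assms e by (intro add.finprod_singleton) auto
  finally show ?thesis using ac e by auto
qed

fun act :: "nat \<Rightarrow> 'a st_generator word \<Rightarrow> 'a sqmat \<Rightarrow> 'a sqmat" where
  "act d [] A = A"
| "act d (((i, j, u), b) # w) A = mat_mult R d (elem_mat R d i j (if b then u else \<ominus> u)) (act d w A)"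

lemma act_append: "act d (v @ w) A = act d v (act d w A)"
  by (induction d v A rule: act.induct) auto

lemma act_closed: "w \<in> words (st_generators R d) \<Longrightarrow> A \<in> sqmats R d \<Longrightarrow> act d w A \<in> sqmats R d"
  by (induction d w A rule: act.induct)
    (auto intro!: mat_mult_closed elem_mat_closed simp: st_generators_def)

lemma word_mat_act: "word_mat R d w = act d w (mat_one R d)"
proof (induction w)
  case (Cons l w)
  then show ?case by (cases l) auto
qed simp

lemma act_letter_closed:
  "A \<in> sqmats R d \<Longrightarrow> u \<in> carrier R \<Longrightarrow> mat_mult R d (elem_mat R d i j u) A \<in> sqmats R d"
  by (intro mat_mult_closed elem_mat_closed)

lemma act_cancel:
  assumes "x \<in> st_generators R d" "A \<in> sqmats R d"
  shows "act d [(x, b), (x, \<not> b)] A = A"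
proof -
  obtain i j u where x: "x = (i, j, u)" "i \<in> {1..d}" "j \<in> {1..d}" "i \<noteq> j" "u \<in> carrier R"
    using assms(1) by (auto simp: st_generators_def)
  have aux: "y \<oplus> u \<otimes> z \<oplus> \<ominus> u \<otimes> z = y" "y \<oplus> \<ominus> u \<otimes> z \<oplus> u \<otimes> z = y"
    if "y \<in> carrier R" "z \<in> carrier R" for y z using that x by algebra+
  show ?thesis
  proof (rule sqmats_eqI)
    show "act d [(x, b), (x, \<not> b)] A \<in> sqmats R d"
      using assms x by (auto intro!: act_letter_closed)
    fix a c assume ac: "a \<in> {1..d}" "c \<in> {1..d}"
    show "act d [(x, b), (x, \<not> b)] A (a, c) = A (a, c)"
      using x ac assms sqmats_entry[OF assms(2)]
      by (auto simp: elem_mat_mult_entry act_letter_closed aux simp del: atLeastAtMost_iff One_nat_def)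
  qed (rule assms)
qed

lemma act_relation:
  assumes "(l, r) \<in> st_relations R d" "A \<in> sqmats R d"
  shows "act d l A = act d r A"
  using assms(1)
proof cases
  case (st_additive i j u v)
  show ?thesis
  proof (rule sqmats_eqI)
    fix a c assume ac: "a \<in> {1..d}" "c \<in> {1..d}"
    have aux: "y \<oplus> v \<otimes> z \<oplus> u \<otimes> z = y \<oplus> (u \<oplus> v) \<otimes> z"
      if "y \<in> carrier R" "z \<in> carrier R" for y z using that st_additive by algebra
    show "act d l A (a, c) = act d r A (a, c)"
      using st_additive ac assms sqmats_entry[OF assms(2)]
      by (auto simp: elem_mat_mult_entry act_letter_closed aux simp del: atLeastAtMost_iff One_nat_def)
  qed (use st_additive assms in \<open>auto intro!: act_letter_closed\<close>)
next
  case (st_commutator i j k u v)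
  show ?thesis
  proof (rule sqmats_eqI)
    fix a c assume ac: "a \<in> {1..d}" "c \<in> {1..d}"
    have aux: "y \<oplus> \<ominus> u \<otimes> (z \<oplus> \<ominus> v \<otimes> t) \<oplus> u \<otimes> z = y \<oplus> (u \<otimes> v) \<otimes> t"
      "z \<oplus> \<ominus> v \<otimes> t \<oplus> v \<otimes> t = z"
      if "y \<in> carrier R" "z \<in> carrier R" "t \<in> carrier R" for y z t
      using that st_commutator by algebra+
    show "act d l A (a, c) = act d r A (a, c)"
      using st_commutator ac assms sqmats_entry[OF assms(2)]
      by (auto simp: comm_word_def inv_word_def elem_mat_mult_entry act_letter_closed aux
          simp del: atLeastAtMost_iff One_nat_def)
  qed (use st_commutator assms in \<open>auto intro!: act_letter_closed simp: comm_word_def inv_word_def\<close>)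
next
  case (st_commuting i j k m u v)
  show ?thesis
  proof (rule sqmats_eqI)
    fix a c assume ac: "a \<in> {1..d}" "c \<in> {1..d}"
    have aux: "y \<oplus> \<ominus> v \<otimes> t \<oplus> \<ominus> u \<otimes> z \<oplus> v \<otimes> t \<oplus> u \<otimes> z = y"
      "y \<oplus> \<ominus> v \<otimes> t \<oplus> v \<otimes> t = y" "y \<oplus> \<ominus> u \<otimes> t \<oplus> u \<otimes> t = y"
      if "y \<in> carrier R" "z \<in> carrier R" "t \<in> carrier R" for y z t
      using that st_commuting by algebra+
    show "act d l A (a, c) = act d r A (a, c)"
      using st_commuting ac assms sqmats_entry[OF assms(2)]
      by (auto simp: comm_word_def inv_word_def elem_mat_mult_entry act_letter_closed aux
          simp del: atLeastAtMost_iff One_nat_def)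
  qed (use st_commuting assms in \<open>auto intro!: act_letter_closed simp: comm_word_def inv_word_def\<close>)
qed

lemma act_pres_eq:
  assumes "(v, w) \<in> pres_eq (st_generators R d) (st_relations R d)" "A \<in> sqmats R d"
  shows "act d v A = act d w A"
  using assms
proof (induction arbitrary: A rule: pres_eq.induct)
  case (pres_cancel u v x b)
  then show ?case by (simp only: act_append act_cancel act_closed)
next
  case (pres_relation u v l r)
  then show ?case by (simp only: act_append) (metis act_relation act_closed)
qed auto

lemma word_mat_pres_eq:
  "(v, w) \<in> pres_eq (st_generators R d) (st_relations R d) \<Longrightarrow> word_mat R d v = word_mat R d w"
  by (simp add: word_mat_act act_pres_eq mat_one_closed)

lemma word_mat_append:
  assumes "v \<in> words (st_generators R d)" "w \<in> words (st_generators R d)"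
  shows "word_mat R d (v @ w) = mat_mult R d (word_mat R d v) (word_mat R d w)"
  using assms(1)
proof (induction v)
  case Nil
  then show ?case by (simp add: word_mat_act mat_one_left act_closed assms mat_one_closed)
next
  case (Cons l v)
  obtain i j u b where l: "l = ((i, j, u), b)" by (metis prod.exhaust)
  have u: "u \<in> carrier R" using Cons.prems by (auto simp: l st_generators_def)
  have "word_mat R d v \<in> sqmats R d" "word_mat R d w \<in> sqmats R d"
    using Cons.prems assms by (auto simp: word_mat_act act_closed mat_one_closed)
  then show ?case using Cons u
    by (auto simp: l mat_mult_assoc elem_mat_closed)
qed

lemma st_phi_class:
  assumes "w \<in> words (st_generators R d)"
  shows "st_phi R d (pres_eq (st_generators R d) (st_relations R d) `` {w}) = word_mat R d w"
proof -
  have "word_mat R d ` (pres_eq (st_generators R d) (st_relations R d) `` {w}) = {word_mat R d w}"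
    using word_mat_pres_eq[of w _ d] pres_refl[OF assms] by force
  then show ?thesis by (simp add: st_phi_def)
qed

theorem st_phi_st_x:
  assumes "i \<in> {1..d}" "j \<in> {1..d}" "i \<noteq> j" "u \<in> carrier R"
  shows "st_phi R d (st_x R d i j u) = elem_mat R d i j u"
  unfolding st_x_def using assms
  by (subst st_phi_class) (auto simp: st_generators_def mat_one_right elem_mat_closed)

lemma mat_det_one: "mat_det R d (mat_one R d) = \<one>"
proof -
  let ?P = "{p. p permutes {1..d}}"
  let ?t = "\<lambda>p. (\<Otimes>a\<in>{1..d}. mat_one R d (a, p a))"
  have "mat_det R d (mat_one R d) = (\<Oplus>p\<in>?P. if id = p then \<one> else \<zero>)"
    unfolding mat_det_def
  proof (intro finsum_cong' refl)
    fix p assume p: "p \<in> ?P"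
    show "(if evenperm p then ?t p else \<ominus> ?t p) = (if id = p then \<one> else \<zero>)"
    proof (cases "p = id")
      case True
      have "?t p = \<one>" by (intro finprod_one_eqI) (auto simp: True mat_one_def)
      then show ?thesis by (simp add: True)
    next
      case False
      then obtain a where a: "a \<in> {1..d}" "p a \<noteq> a"
        using p by (metis (no_types, lifting) eq_id_iff mem_Collect_eq permutes_def)
      have cl: "b \<in> {1..d} \<Longrightarrow> mat_one R d (b, p b) \<in> carrier R" for b
        using p by (intro sqmats_entry[OF mat_one_closed])
          (auto simp: permutes_in_image simp del: atLeastAtMost_iff One_nat_def)
      have "?t p = (\<Otimes>b\<in>insert a ({1..d} - {a}). mat_one R d (b, p b))"
        using a by (simp add: insert_absorb)
      also have "\<dots> = mat_one R d (a, p a) \<otimes> (\<Otimes>b\<in>{1..d} - {a}. mat_one R d (b, p b))"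
        using a cl by (intro finprod_insert) auto
      also have "mat_one R d (a, p a) = \<zero>"
        using a p by (auto simp: mat_one_def permutes_in_image simp del: atLeastAtMost_iff One_nat_def)
      also have "\<zero> \<otimes> (\<Otimes>b\<in>{1..d} - {a}. mat_one R d (b, p b)) = \<zero>"
        using cl by (intro l_null finprod_closed) auto
      finally show ?thesis using False by auto
    qed
  qed auto
  also have "\<dots> = \<one>"
    by (intro add.finprod_singleton) (auto simp: finite_permutations permutes_id)
  finally show ?thesis .
qed

lemma mat_det_elem_mult:
  assumes A: "A \<in> sqmats R d" and u: "u \<in> carrier R"
    and i: "i \<in> {1..d}" and j: "j \<in> {1..d}" and ij: "i \<noteq> j"
  shows "mat_det R d (mat_mult R d (elem_mat R d i j u) A) = mat_det R d A"
proof -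
  let ?P = "{p. p permutes {1..d}}"
  let ?B = "mat_mult R d (elem_mat R d i j u) A"
  let ?S = "{1..d} - {i}"
  define sg where "sg = (\<lambda>(p :: nat \<Rightarrow> nat) x. if evenperm p then x else \<ominus> x)"
  define q where "q = (\<lambda>p. \<Otimes>a\<in>?S. A (a, p a))"
  define g where "g = (\<lambda>p. sg p (u \<otimes> A (j, p i) \<otimes> q p))"
  have pin: "p a \<in> {1..d}" if "p \<in> ?P" "a \<in> {1..d}" for p a
    using that by (auto simp: permutes_in_image simp del: atLeastAtMost_iff One_nat_def)
  have e: "A (a, p b) \<in> carrier R" if "p \<in> ?P" "a \<in> {1..d}" "b \<in> {1..d}" for p a b
    using sqmats_entry[OF A] pin that by blast
  have qc: "q p \<in> carrier R" if "p \<in> ?P" for p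
    unfolding q_def using e[OF that] by (intro finprod_closed) auto
  have gc: "g p \<in> carrier R" if "p \<in> ?P" for p
    using e[OF that j i] qc[OF that] u by (auto simp: g_def sg_def)
  have split: "(\<Otimes>a\<in>{1..d}. C (a, p a)) = C (i, p i) \<otimes> (\<Otimes>a\<in>?S. C (a, p a))"
    if "p \<in> ?P" "C \<in> sqmats R d" for p and C :: "'a sqmat"
  proof -
    have "(\<Otimes>a\<in>{1..d}. C (a, p a)) = (\<Otimes>a\<in>insert i ?S. C (a, p a))"
      using i by (simp add: insert_absorb)
    also have "\<dots> = C (i, p i) \<otimes> (\<Otimes>a\<in>?S. C (a, p a))"
      using i sqmats_entry[OF that(2)] pin[OF that(1)] by (intro finprod_insert) auto
    finally show ?thesis .
  qed
  have Bc: "?B \<in> sqmats R d" using A u by (intro act_letter_closed)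
  have prodA: "(\<Otimes>a\<in>{1..d}. A (a, p a)) = A (i, p i) \<otimes> q p" if "p \<in> ?P" for p
    unfolding q_def by (rule split[OF that A])
  have prodB: "(\<Otimes>a\<in>{1..d}. ?B (a, p a)) = (A (i, p i) \<oplus> u \<otimes> A (j, p i)) \<otimes> q p"
    if p: "p \<in> ?P" for p
  proof -
    have "(\<Otimes>a\<in>?S. ?B (a, p a)) = q p"
      unfolding q_def using A u i j pin[OF p] e[OF p]
      by (intro finprod_cong') (auto simp: elem_mat_mult_entry simp del: atLeastAtMost_iff One_nat_def)
    moreover have "?B (i, p i) = A (i, p i) \<oplus> u \<otimes> A (j, p i)"
      using A u i j pin[OF p i] by (simp add: elem_mat_mult_entry del: atLeastAtMost_iff)
    ultimately show ?thesis using split[OF p Bc] by simp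
  qed
  have detA: "mat_det R d A = (\<Oplus>p\<in>?P. sg p (A (i, p i) \<otimes> q p))"
    unfolding mat_det_def
    by (intro finsum_cong') (use e qc i in \<open>auto simp: prodA sg_def simp del: atLeastAtMost_iff One_nat_def\<close>)
  have "mat_det R d ?B = (\<Oplus>p\<in>?P. sg p (A (i, p i) \<otimes> q p) \<oplus> g p)"
    unfolding mat_det_def
  proof (intro finsum_cong' refl)
    fix p assume p: "p \<in> ?P"
    note [simp] = e[OF p i i] e[OF p j i] qc[OF p] u
    have "(A (i, p i) \<oplus> u \<otimes> A (j, p i)) \<otimes> q p = A (i, p i) \<otimes> q p \<oplus> u \<otimes> A (j, p i) \<otimes> q p"
      by (simp add: l_distr)
    then show "(if evenperm p then \<Otimes>a\<in>{1..d}. ?B (a, p a) else \<ominus> (\<Otimes>a\<in>{1..d}. ?B (a, p a)))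
        = sg p (A (i, p i) \<otimes> q p) \<oplus> g p"
      by (simp add: prodB[OF p] sg_def g_def minus_add del: One_nat_def)
  qed (use e qc gc i in \<open>auto simp: sg_def simp del: atLeastAtMost_iff One_nat_def\<close>)
  also have "\<dots> = mat_det R d A \<oplus> (\<Oplus>p\<in>?P. g p)"
    unfolding detA
    by (rule finsum_addf) (use e qc gc i in \<open>auto simp: sg_def simp del: atLeastAtMost_iff One_nat_def\<close>)
  also have "(\<Oplus>p\<in>?P. g p) = \<zero>"
  proof -
    let ?E = "{p \<in> ?P. evenperm p}" and ?O = "{p \<in> ?P. \<not> evenperm p}"
    let ?\<tau> = "transpose i j"
    have fin: "finite ?P" by (simp add: finite_permutations)
    have \<tau>: "?\<tau> permutes {1..d}" using i j by (intro permutes_swap_id)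
    have perm: "permutation p" if "p \<in> ?P" for p
      using that by (auto intro: permutation_permutes[THEN iffD2])
    have comp: "p \<circ> ?\<tau> \<in> ?P" if "p \<in> ?P" for p
      using that \<tau> by (auto intro: permutes_compose)
    have ev: "evenperm (p \<circ> ?\<tau>) \<longleftrightarrow> \<not> evenperm p" if "p \<in> ?P" for p
      using that ij by (simp add: evenperm_comp perm permutation_swap_id evenperm_swap)
    have inj: "inj_on (\<lambda>p. p \<circ> ?\<tau>) ?E"
      by (rule inj_onI) (metis comp_assoc comp_id transpose_comp_involutory)
    have img: "?O = (\<lambda>p. p \<circ> ?\<tau>) ` ?E"
    proof (intro equalityI subsetI)
      fix p assume p: "p \<in> ?O"
      then have "p \<circ> ?\<tau> \<in> ?E" using comp ev by auto
      moreover have "p = (p \<circ> ?\<tau>) \<circ> ?\<tau>" by (simp add: comp_assoc)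
      ultimately show "p \<in> (\<lambda>p. p \<circ> ?\<tau>) ` ?E" by blast
    next
      fix p assume "p \<in> (\<lambda>p. p \<circ> ?\<tau>) ` ?E"
      then show "p \<in> ?O" using comp ev by auto
    qed
    have gneg: "g (p \<circ> ?\<tau>) = \<ominus> g p" if p: "p \<in> ?E" for p
    proof -
      have P: "p \<in> ?P" "p \<circ> ?\<tau> \<in> ?P" "evenperm p" "\<not> evenperm (p \<circ> ?\<tau>)"
        using p comp ev by auto
      let ?T = "{1..d} - {i, j}"
      have q: "q s = A (j, s j) \<otimes> (\<Otimes>a\<in>?T. A (a, s a))"  if s: "s \<in> ?P" for s
      proof -
        have "?S = insert j ?T" using j ij by auto
        then show ?thesis unfolding q_def
          using j ij e[OF s] by simp
      qed
      have T: "(\<Otimes>a\<in>?T. A (a, (p \<circ> ?\<tau>) a)) = (\<Otimes>a\<in>?T. A (a, p a))"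
        using e[OF P(1)] by (intro finprod_cong') auto
      have Tc: "(\<Otimes>a\<in>?T. A (a, p a)) \<in> carrier R"
        using e[OF P(1)] by (intro finprod_closed) auto
      have "u \<otimes> A (j, p j) \<otimes> (A (j, p i) \<otimes> (\<Otimes>a\<in>?T. A (a, p a)))
          = u \<otimes> A (j, p i) \<otimes> (A (j, p j) \<otimes> (\<Otimes>a\<in>?T. A (a, p a)))"
        using Tc u e[OF P(1) j i] e[OF P(1) j j] by (simp add: m_ac)
      then show ?thesis
        unfolding g_def q[OF P(1)] q[OF P(2)] T using P by (simp add: sg_def)
    qed
    have "(\<Oplus>p\<in>?P. g p) = (\<Oplus>p\<in>?E \<union> ?O. g p)"
      by (rule arg_cong[where f = "finsum R g"]) auto
    also have "\<dots> = (\<Oplus>p\<in>?E. g p) \<oplus> (\<Oplus>p\<in>?O. g p)"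
      using fin gc by (intro finsum_Un_disjoint) auto
    also have "(\<Oplus>p\<in>?O. g p) = (\<Oplus>p\<in>?E. g (p \<circ> ?\<tau>))"
      unfolding img by (rule finsum_reindex) (use inj gc comp in auto)
    also have "\<dots> = (\<Oplus>p\<in>?E. \<ominus> g p)"
      using gc gneg by (intro finsum_cong') auto
    also have "(\<Oplus>p\<in>?E. g p) \<oplus> (\<Oplus>p\<in>?E. \<ominus> g p) = (\<Oplus>p\<in>?E. g p \<oplus> \<ominus> g p)"
      using gc by (intro finsum_addf[symmetric]) auto
    also have "\<dots> = \<zero>"
      using gc by (intro add.finprod_one_eqI) (auto simp: r_neg)
    finally show ?thesis .
  qed
  finally have B: "mat_det R d ?B = mat_det R d A \<oplus> \<zero>" .
  have "mat_det R d A \<in> carrier R"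
    unfolding detA using e qc i
    by (intro finsum_closed) (auto simp: sg_def simp del: atLeastAtMost_iff One_nat_def)
  then show ?thesis using B by simp
qed

lemma word_mat_SL:
  "w \<in> words (st_generators R d) \<Longrightarrow> word_mat R d w \<in> carrier (SL R d)"
proof (induction w)
  case Nil
  then show ?case by (simp add: SL_def mat_one_closed mat_det_one)
next
  case (Cons l w)
  obtain i j u b where l: "l = ((i, j, u), b)" by (metis prod.exhaust)
  then show ?case using Cons
    by (auto simp: SL_def st_generators_def intro!: act_letter_closed
        simp: mat_det_elem_mult simp del: atLeastAtMost_iff One_nat_def)
qed

theorem st_phi_hom: "st_phi R d \<in> hom (Steinberg R d) (SL R d)"
proof (rule homI)
  fix C assume "C \<in> carrier (Steinberg R d)"
  then show "st_phi R d C \<in> carrier (SL R d)"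
    unfolding Steinberg_def presented_carrier by (clarsimp simp: st_phi_class word_mat_SL)
next
  fix C D assume "C \<in> carrier (Steinberg R d)" "D \<in> carrier (Steinberg R d)"
  then obtain v w where vw: "v \<in> words (st_generators R d)" "w \<in> words (st_generators R d)"
    and C: "C = pres_eq (st_generators R d) (st_relations R d) `` {v}"
    and D: "D = pres_eq (st_generators R d) (st_relations R d) `` {w}"
    unfolding Steinberg_def presented_carrier by blast
  have "C \<otimes>\<^bsub>Steinberg R d\<^esub> D = pres_eq (st_generators R d) (st_relations R d) `` {v @ w}"
    unfolding Steinberg_def C D using vw by (rule presented_mult)
  then have "st_phi R d (C \<otimes>\<^bsub>Steinberg R d\<^esub> D) = word_mat R d (v @ w)"
    using vw st_phi_class by simp
  also have "\<dots> = mat_mult R d (st_phi R d C) (st_phi R d D)"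
    using vw st_phi_class word_mat_append by (simp add: C D)
  finally show "st_phi R d (C \<otimes>\<^bsub>Steinberg R d\<^esub> D)
      = st_phi R d C \<otimes>\<^bsub>SL R d\<^esub> st_phi R d D"
    by (simp add: SL_def)
qed

end

end

theory Submission
  imports Defs
begin

text \<open>Write \<open>St\<close> for the Steinberg group and \<open>Z\<close> for its central subgroup generated by the symbols.

  For the inclusion of \<open>K2\<close> in \<open>Z\<close>, the set \<open>U\<^sup>+ U\<^sup>- H U\<^sup>+\<close>, with \<open>H\<close> generated by the
  \<open>h i j u\<close>, is stable under left multiplication by the generators of \<open>St\<close>. This reduces to the
  rank one statement \<open>x j i r * x i j s * x j i t \<in> X i j * X j i * H * X i j\<close>, which is easy over a
  local ring and passes to finite rings by splitting off idempotents. A kernel element conjugates to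
  \<open>n t u\<close> with \<open>n\<close> lower, \<open>u\<close> upper unipotent and \<open>t \<in> H\<close>; comparing matrices, \<open>n = u = 1\<close> and
  \<open>t \<in> Z\<close>.

  To count symbols, take \<open>R\<close> local with maximal ideal \<open>m\<close>. The Dennis-Stein elements \<open>ds a b\<close>, defined
  for \<open>a \<in> m\<close> and equal to \<open>{1 - a b, b}\<close> when \<open>b\<close> is a unit, satisfy
  \<open>ds a b * ds a c = ds a (b + c - a b c)\<close> and \<open>ds a 1 = 1\<close>. Hence for fixed \<open>t \<in> m\<close> the elements
  \<open>ds t r\<close> form a group in which every element is a single symbol. If \<open>m\<close> is generated by
  \<open>t\<^sub>0, \<dots>, t\<^sub>k\<close> and \<open>g\<close> lifts a generator of \<open>(R / m)\<^sup>*\<close>, the relation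
  \<open>ds a (b c) = ds (a b) c * ds (a c) b\<close> shows that \<open>Z\<close> is the product of the group of all \<open>{g, v}\<close> and
  the \<open>k + 1\<close> groups of the \<open>ds t\<^sub>i r\<close>. Finally symbols over a product of rings are computed
  componentwise, so the bound \<open>k + 2\<close> passes from local rings to all finite rings.\<close>

section \<open>Groups as a type class\<close>

text \<open>The rank \<open>d\<close> is fixed and may be 3, so the kernel is computed inside the
  group itself. A Bruhat decomposition would need one cell for each permutation; here the second
  copy of the upper unipotent group absorbs the permutations, so that one four-factor set is the
  whole group. Upper generators preserve it trivially, and only lower generators at adjacent indices
  need work.

  An element \<open>ds a b\<close> is visibly a symbol only when \<open>b\<close> is a unit. Over a
  local ring a nonunit \<open>b\<close> lies in the radical, so b - 1 is a unit, and splitting b = 1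
  + (b - 1) is the recurrent device.

  The number \<open>k + 2\<close> arises as one symbol for the residue field, one for the residue
  characteristic \<open>p\<close> and one for each ring generator, because the maximal ideal is
  generated by \<open>p\<close> and the differences between each ring generator and a suitable power
  of it. A product of rings costs no more than one factor, because lists of equal length are merged
  entry by entry.\<close>

text \<open>The Steinberg group is embedded into a type of this class by Cayley's theorem, so that words can
  be rewritten without carrier conditions.\<close>

class grp = monoid_mult + inverse +
  assumes grp_left_inverse: "inverse a * a = 1"
begin

lemma inverse_cancel_left [simp]: "inverse a * (a * b) = b"
  by (simp add: mult.assoc [symmetric] grp_left_inverse)

lemma grp_right_inverse: "a * inverse a = 1"
proof -
  have "a * inverse a = inverse (inverse a) * (inverse a * (a * inverse a))"
    by (metis grp_left_inverse mult.assoc mult_1_left)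
  also have "\<dots> = 1" using grp_left_inverse [of "inverse a"] by simp
  finally show ?thesis .
qed

lemma cancel_inverse_left [simp]: "a * (inverse a * b) = b"
  by (simp add: mult.assoc [symmetric] grp_right_inverse)

lemma grp_left_cancel [simp]: "a * b = a * c \<longleftrightarrow> b = c"
  by (metis inverse_cancel_left)

lemma grp_right_cancel [simp]: "b * a = c * a \<longleftrightarrow> b = c"
  by (metis mult.assoc mult_1_right grp_right_inverse)

lemma grp_inverse_unique: "a * b = 1 \<Longrightarrow> inverse a = b"
  by (metis inverse_cancel_left mult_1_right)

lemma grp_inverse_inverse [simp]: "inverse (inverse a) = a"
  by (rule grp_inverse_unique) (rule grp_left_inverse)

lemma grp_inverse_one [simp]: "inverse 1 = 1"
  by (rule grp_inverse_unique) simp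

lemma grp_inverse_mult [simp]: "inverse (a * b) = inverse b * inverse a"
  by (rule grp_inverse_unique) (simp add: mult.assoc grp_right_inverse)

lemmas grp_simps = mult.assoc grp_left_inverse grp_right_inverse

lemma mult_inverse_eq_iff: "a * inverse b = c \<longleftrightarrow> a = c * b"
  by (metis mult.assoc mult_1_right grp_left_inverse grp_right_inverse)

definition gconj :: "'a \<Rightarrow> 'a \<Rightarrow> 'a" where
  "gconj g y = g * y * inverse g"

lemma gconj_mult: "gconj g (y * z) = gconj g y * gconj g z"
  by (simp add: gconj_def grp_simps)

lemma gconj_inverse: "gconj g (inverse y) = inverse (gconj g y)"
  by (simp add: gconj_def grp_simps)

lemma gconj_one [simp]: "gconj g 1 = 1" "gconj 1 g = g"
  by (simp_all add: gconj_def grp_simps)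

lemma gconj_gconj: "gconj (g * h) y = gconj g (gconj h y)"
  by (simp add: gconj_def grp_simps)

lemma gconj_self [simp]: "gconj g g = g"
  by (simp add: gconj_def grp_simps)

lemma gconj_inverse_gconj [simp]: "gconj (inverse g) (gconj g y) = y" "gconj g (gconj (inverse g) y) = y"
  by (simp_all add: gconj_def grp_simps)

lemma mult_gconj: "g * y = gconj g y * g"
  by (simp add: gconj_def grp_simps)

lemma gconj_eq_self_iff: "gconj g y = y \<longleftrightarrow> g * y = y * g"
  by (simp add: gconj_def mult_inverse_eq_iff)

inductive_set gspan :: "'a set \<Rightarrow> 'a set" for S :: "'a set" where
  gspan_one [simp, intro]: "1 \<in> gspan S"
| gspan_mult_left: "s \<in> S \<Longrightarrow> g \<in> gspan S \<Longrightarrow> s * g \<in> gspan S"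
| gspan_inverse_left: "s \<in> S \<Longrightarrow> g \<in> gspan S \<Longrightarrow> inverse s * g \<in> gspan S"

lemma gspan_base: "s \<in> S \<Longrightarrow> s \<in> gspan S"
  using gspan_mult_left [of s S 1] by simp

lemma gspan_mult: "g \<in> gspan S \<Longrightarrow> h \<in> gspan S \<Longrightarrow> g * h \<in> gspan S"
  by (induction rule: gspan.induct) (auto simp: mult.assoc intro: gspan_mult_left gspan_inverse_left)

lemma gspan_inverse: "g \<in> gspan S \<Longrightarrow> inverse g \<in> gspan S"
proof (induction rule: gspan.induct)
  case (gspan_mult_left s g)
  then show ?case using gspan_mult gspan_inverse_left [of s S 1] by force
next
  case (gspan_inverse_left s g)
  then show ?case using gspan_mult gspan_base by force
qed simp

text \<open>For a generating set closed under inversion the case of inverse letters disappears. It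
  applies to root elements, as \<open>x i j r\<close> has inverse
  \<open>x i j (\<ominus> r)\<close>, and to symbols, as {u, v} has inverse {v, u}.\<close>

lemma gspan_symmetric_induct [consumes 1, case_names inverse one mult]:
  assumes "g \<in> gspan S" "\<And>s. s \<in> S \<Longrightarrow> inverse s \<in> S" "P 1"
    and "\<And>s g. s \<in> S \<Longrightarrow> g \<in> gspan S \<Longrightarrow> P g \<Longrightarrow> P (s * g)"
  shows "P g"
  using assms(1) by (induction rule: gspan.induct) (use assms(2-) in auto)

lemma gspan_subset: "S \<subseteq> gspan T \<Longrightarrow> gspan S \<subseteq> gspan T"
proof
  fix g assume S: "S \<subseteq> gspan T" and "g \<in> gspan S"
  from this(2) show "g \<in> gspan T"
    by (induction rule: gspan.induct) (use S in \<open>auto intro: gspan_mult gspan_inverse\<close>)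
qed

lemma gspan_mono: "S \<subseteq> T \<Longrightarrow> gspan S \<subseteq> gspan T"
  by (rule gspan_subset) (auto intro: gspan_base)

lemma gconj_gspan:
  assumes "\<And>s. s \<in> S \<Longrightarrow> gconj g s \<in> gspan T" and "y \<in> gspan S"
  shows "gconj g y \<in> gspan T"
  using assms(2)
  by (induction rule: gspan.induct) (use assms(1) in \<open>auto simp: gconj_mult gconj_inverse intro: gspan_mult gspan_inverse\<close>)

lemma commute_gspan:
  assumes "\<And>s. s \<in> S \<Longrightarrow> g * s = s * g" and "y \<in> gspan S"
  shows "g * y = y * g"
  using assms(2)
proof (induction rule: gspan.induct)
  case (gspan_mult_left s h)
  then show ?case using assms(1) by (metis mult.assoc)
next
  case (gspan_inverse_left s h)
  have "g * inverse s = inverse s * g"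
    using assms(1) [OF gspan_inverse_left(1)] by (metis inverse_cancel_left mult.assoc mult_inverse_eq_iff)
  then show ?case using gspan_inverse_left by (metis mult.assoc)
qed simp

end

section \<open>Steinberg relations\<close>

lemma (in cring) unit_cancel [simp]:
  assumes "u \<in> Units R" "r \<in> carrier R"
  shows "u \<otimes> (inv u \<otimes> r) = r" "inv u \<otimes> (u \<otimes> r) = r"
  using assms by (simp_all add: Units_closed flip: m_assoc)

text \<open>Associative-commutative normalization may separate a unit from its inverse; these rules
  cancel the pair across one to four intermediate factors, with or without a tail.\<close>

lemma (in cring) unit_cancels:
  "\<lbrakk>a \<in> Units R; p \<in> carrier R; y \<in> carrier R\<rbrakk> \<Longrightarrow> a \<otimes> (p \<otimes> (inv a \<otimes> y)) = p \<otimes> y"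
  "\<lbrakk>a \<in> Units R; p \<in> carrier R\<rbrakk> \<Longrightarrow> a \<otimes> (p \<otimes> inv a) = p"
  "\<lbrakk>a \<in> Units R; p \<in> carrier R; q \<in> carrier R; y \<in> carrier R\<rbrakk> \<Longrightarrow> a \<otimes> (p \<otimes> (q \<otimes> (inv a \<otimes> y))) = p \<otimes> (q \<otimes> y)"
  "\<lbrakk>a \<in> Units R; p \<in> carrier R; q \<in> carrier R\<rbrakk> \<Longrightarrow> a \<otimes> (p \<otimes> (q \<otimes> inv a)) = p \<otimes> q"
  "\<lbrakk>a \<in> Units R; p \<in> carrier R; q \<in> carrier R; s \<in> carrier R; y \<in> carrier R\<rbrakk> \<Longrightarrow> a \<otimes> (p \<otimes> (q \<otimes> (s \<otimes> (inv a \<otimes> y)))) = p \<otimes> (q \<otimes> (s \<otimes> y))"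
  "\<lbrakk>a \<in> Units R; p \<in> carrier R; q \<in> carrier R; s \<in> carrier R\<rbrakk> \<Longrightarrow> a \<otimes> (p \<otimes> (q \<otimes> (s \<otimes> inv a))) = p \<otimes> (q \<otimes> s)"
  "\<lbrakk>a \<in> Units R; p \<in> carrier R; q \<in> carrier R; s \<in> carrier R; t \<in> carrier R; y \<in> carrier R\<rbrakk> \<Longrightarrow> a \<otimes> (p \<otimes> (q \<otimes> (s \<otimes> (t \<otimes> (inv a \<otimes> y))))) = p \<otimes> (q \<otimes> (s \<otimes> (t \<otimes> y)))"
  "\<lbrakk>a \<in> Units R; p \<in> carrier R; q \<in> carrier R; s \<in> carrier R; t \<in> carrier R\<rbrakk> \<Longrightarrow> a \<otimes> (p \<otimes> (q \<otimes> (s \<otimes> (t \<otimes> inv a)))) = p \<otimes> (q \<otimes> (s \<otimes> t))"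
  by (simp_all add: m_lcomm [of a p] m_lcomm [of a q] m_lcomm [of a s] m_lcomm [of a t] Units_closed)

lemma (in cring) unit_minus [simp]:
  assumes "u \<in> Units R"
  shows "\<ominus> u \<in> Units R" "inv (\<ominus> u) = \<ominus> (inv u)"
proof -
  have "\<ominus> u \<otimes> \<ominus> (inv u) = \<one>"
    using assms by (simp add: l_minus r_minus Units_closed)
  moreover from this have "\<ominus> (inv u) \<otimes> \<ominus> u = \<one>"
    using assms by (subst m_comm) (auto simp: Units_closed)
  ultimately show *: "\<ominus> u \<in> Units R"
    unfolding Units_def using assms Units_inv_closed [OF assms] Units_closed [OF assms] by blast
  show "inv (\<ominus> u) = \<ominus> (inv u)"
    using assms \<open>\<ominus> u \<otimes> \<ominus> (inv u) = \<one>\<close> by (intro comm_inv_char) (auto simp: Units_closed)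
qed

lemma (in cring) unit_inv_mult [simp]:
  assumes "u \<in> Units R" "v \<in> Units R"
  shows "inv (u \<otimes> v) = inv u \<otimes> inv v"
  by (rule comm_inv_char) (use assms in \<open>simp_all add: Units_closed m_ac\<close>)

locale steinberg_rep = cring R for R :: "('a, 'b) ring_scheme" (structure) +
  fixes d :: nat and x :: "nat \<Rightarrow> nat \<Rightarrow> 'a \<Rightarrow> 'g :: grp"
  assumes d3: "3 \<le> d"
    and x_add: "\<lbrakk>i \<in> {1..d}; j \<in> {1..d}; i \<noteq> j; u \<in> carrier R; v \<in> carrier R\<rbrakk>
      \<Longrightarrow> x i j u * x i j v = x i j (u \<oplus> v)"
    and x_comm: "\<lbrakk>i \<in> {1..d}; j \<in> {1..d}; k \<in> {1..d}; i \<noteq> j; j \<noteq> k; i \<noteq> k; u \<in> carrier R; v \<in> carrier R\<rbrakk>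
      \<Longrightarrow> x i j u * x j k v * inverse (x i j u) * inverse (x j k v) = x i k (u \<otimes> v)"
    and x_commute: "\<lbrakk>i \<in> {1..d}; j \<in> {1..d}; k \<in> {1..d}; l \<in> {1..d}; i \<noteq> j; k \<noteq> l; j \<noteq> k; i \<noteq> l;
        u \<in> carrier R; v \<in> carrier R\<rbrakk>
      \<Longrightarrow> x i j u * x k l v = x k l v * x i j u"
begin

declare atLeastAtMost_iff [simp del] One_nat_def [simp del] Units_closed [simp]

abbreviation "D \<equiv> {1..d}"

lemma x_zero: "\<lbrakk>i \<in> D; j \<in> D; i \<noteq> j\<rbrakk> \<Longrightarrow> x i j \<zero> = 1"
  using x_add [of i j \<zero> \<zero>] by (metis l_zero grp_left_cancel mult_1_right zero_closed)

lemma x_minus: "\<lbrakk>i \<in> D; j \<in> D; i \<noteq> j; u \<in> carrier R\<rbrakk> \<Longrightarrow> x i j (\<ominus> u) = inverse (x i j u)"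
  by (rule grp_inverse_unique [symmetric]) (simp add: x_add r_neg x_zero)

lemma x_add_left:
  "\<lbrakk>i \<in> D; j \<in> D; i \<noteq> j; u \<in> carrier R; v \<in> carrier R\<rbrakk> \<Longrightarrow> x i j u * (x i j v * g) = x i j (u \<oplus> v) * g"
  by (simp add: x_add flip: mult.assoc)

lemma conj_x_commute:
  "\<lbrakk>i \<in> D; j \<in> D; k \<in> D; l \<in> D; i \<noteq> j; k \<noteq> l; j \<noteq> k; i \<noteq> l; u \<in> carrier R; v \<in> carrier R\<rbrakk>
      \<Longrightarrow> gconj (x i j u) (x k l v) = x k l v"
  using x_commute [of i j k l u v] by (simp add: gconj_eq_self_iff)

lemma conj_x_right:
  "\<lbrakk>i \<in> D; j \<in> D; k \<in> D; i \<noteq> j; j \<noteq> k; i \<noteq> k; u \<in> carrier R; v \<in> carrier R\<rbrakk>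
      \<Longrightarrow> gconj (x i j u) (x j k v) = x i k (u \<otimes> v) * x j k v"
  using x_comm [of i j k u v] unfolding gconj_def by (simp add: mult_inverse_eq_iff)

lemma conj_x_left:
  assumes "i \<in> D" "j \<in> D" "k \<in> D" "i \<noteq> j" "j \<noteq> k" "i \<noteq> k" "u \<in> carrier R" "v \<in> carrier R"
  shows "gconj (x i j u) (x k i v) = x k j (\<ominus> (v \<otimes> u)) * x k i v"
proof -
  have "x k i v * x i j u * inverse (x k i v) * inverse (x i j u) = x k j (v \<otimes> u)"
    using assms by (intro x_comm) auto
  then have "inverse (x k j (v \<otimes> u)) = x i j u * x k i v * inverse (x i j u) * inverse (x k i v)"
    by (metis (no_types, lifting) grp_inverse_inverse grp_inverse_mult mult.assoc)
  then show ?thesis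
    using assms by (simp add: x_minus gconj_def grp_simps)
qed

section \<open>Weyl and torus elements and their action on root elements\<close>

definition w :: "nat \<Rightarrow> nat \<Rightarrow> 'a \<Rightarrow> 'g" where
  "w i j u = x i j u * x j i (\<ominus> (inv u)) * x i j u"

definition h :: "nat \<Rightarrow> nat \<Rightarrow> 'a \<Rightarrow> 'g" where
  "h i j u = w i j u * w i j (\<ominus> \<one>)"

definition symb :: "nat \<Rightarrow> nat \<Rightarrow> 'a \<Rightarrow> 'a \<Rightarrow> 'g" where
  "symb i j u v = h i j (u \<otimes> v) * inverse (h i j u) * inverse (h i j v)"

lemma w_minus: "\<lbrakk>i \<in> D; j \<in> D; i \<noteq> j; u \<in> Units R\<rbrakk> \<Longrightarrow> w i j (\<ominus> u) = inverse (w i j u)"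
  by (simp add: w_def x_minus grp_simps)

context
  fixes i j k :: nat
  assumes ijk: "i \<in> D" "j \<in> D" "k \<in> D" "i \<noteq> j" "j \<noteq> k" "i \<noteq> k"
  notes [simp] = ijk ijk(4-6) [symmetric]
begin

lemma x_reorder:
  assumes [simp]: "a \<in> carrier R" "b \<in> carrier R"
  shows "x i k a * x j k b = x j k b * x i k a"
    "x i k a * (x j k b * g) = x j k b * (x i k a * g)"
    "x k j a * x k i b = x k i b * x k j a"
    "x k j a * (x k i b * g) = x k i b * (x k j a * g)"
proof -
  show 1: "x i k a * x j k b = x j k b * x i k a" by (rule x_commute) simp_all
  show 2: "x k j a * x k i b = x k i b * x k j a" by (rule x_commute) simp_all
  show "x i k a * (x j k b * g) = x j k b * (x i k a * g)"
    "x k j a * (x k i b * g) = x k i b * (x k j a * g)"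
    by (metis 1 mult.assoc, metis 2 mult.assoc)
qed

context
  fixes u
  assumes u: "u \<in> Units R"
begin

lemmas conj_rules = gconj_gconj conj_x_right conj_x_left conj_x_commute gconj_mult
  l_minus r_minus m_ac x_reorder x_add x_add_left x_zero mult.assoc r_neg l_neg

lemma conj_w_jk:
  assumes r: "r \<in> carrier R"
  shows "gconj (w i j u) (x j k r) = x i k (u \<otimes> r)"
  using u r
  by (simp add: w_def conj_rules)

lemma conj_w_ik:
  assumes r: "r \<in> carrier R"
  shows "gconj (w i j u) (x i k r) = x j k (\<ominus> (inv u \<otimes> r))"
  using u r
  by (simp add: w_def conj_rules)

lemma conj_w_kj:
  assumes r: "r \<in> carrier R"
  shows "gconj (w i j u) (x k j r) = x k i (inv u \<otimes> r)"
  using u r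
  by (simp add: w_def conj_rules)

lemma conj_w_ki:
  assumes r: "r \<in> carrier R"
  shows "gconj (w i j u) (x k i r) = x k j (\<ominus> (u \<otimes> r))"
  using u r
  by (simp add: w_def conj_rules)

text \<open>No Steinberg relation links \<open>x i j\<close> with \<open>x j i\<close>, so the
  conjugate cannot be computed directly. The third index \<open>k\<close> helps:
  \<open>x i j r\<close> is the commutator of \<open>x i k r\<close> and
  \<open>x k j \<one>\<close>, whose conjugates are known. This uses rank at least 3.\<close>

lemma conj_w_ij:
  assumes r: "r \<in> carrier R"
  shows "gconj (w i j u) (x i j r) = x j i (\<ominus> (inv u \<otimes> (inv u \<otimes> r)))"
proof -
  have "x i j r = x i k r * x k j \<one> * inverse (x i k r) * inverse (x k j \<one>)"
    using r by (subst x_comm) auto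
  also have "gconj (w i j u) \<dots> = x j k (\<ominus> (inv u \<otimes> r)) * x k i (inv u \<otimes> \<one>)
      * inverse (x j k (\<ominus> (inv u \<otimes> r))) * inverse (x k i (inv u \<otimes> \<one>))"
    using u r by (simp only: gconj_mult gconj_inverse conj_w_ik conj_w_kj one_closed)
  also have "\<dots> = x j i (\<ominus> (inv u \<otimes> r) \<otimes> (inv u \<otimes> \<one>))"
    using u r by (intro x_comm) auto
  finally show ?thesis
    using u r by (simp add: l_minus r_minus m_ac)
qed

lemma conj_w_ji:
  assumes r: "r \<in> carrier R"
  shows "gconj (w i j u) (x j i r) = x i j (\<ominus> (u \<otimes> (u \<otimes> r)))"
proof -
  have "x j i r = x j k r * x k i \<one> * inverse (x j k r) * inverse (x k i \<one>)"
    using r by (subst x_comm) auto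
  also have "gconj (w i j u) \<dots> = x i k (u \<otimes> r) * x k j (\<ominus> (u \<otimes> \<one>))
      * inverse (x i k (u \<otimes> r)) * inverse (x k j (\<ominus> (u \<otimes> \<one>)))"
    using u r by (simp only: gconj_mult gconj_inverse conj_w_jk conj_w_ki one_closed)
  also have "\<dots> = x i j (u \<otimes> r \<otimes> \<ominus> (u \<otimes> \<one>))"
    using u r by (intro x_comm) auto
  finally show ?thesis
    using u r by (simp add: r_minus m_ac)
qed

lemma conj_w_kl:
  assumes r: "r \<in> carrier R" and "k' \<in> D" "k' \<noteq> k" "k' \<noteq> i" "k' \<noteq> j"
  shows "gconj (w i j u) (x k k' r) = x k k' r"
  using u r assms by (simp add: w_def gconj_gconj conj_x_commute)

end

lemma conj_h_jk: "u \<in> Units R \<Longrightarrow> r \<in> carrier R \<Longrightarrow> gconj (h i j u) (x j k r) = x j k (inv u \<otimes> r)"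
  by (simp add: h_def gconj_gconj conj_w_jk conj_w_ik l_minus r_minus)

lemma conj_h_ik: "u \<in> Units R \<Longrightarrow> r \<in> carrier R \<Longrightarrow> gconj (h i j u) (x i k r) = x i k (u \<otimes> r)"
  by (simp add: h_def gconj_gconj conj_w_jk conj_w_ik l_minus r_minus)

lemma conj_h_kj: "u \<in> Units R \<Longrightarrow> r \<in> carrier R \<Longrightarrow> gconj (h i j u) (x k j r) = x k j (u \<otimes> r)"
  by (simp add: h_def gconj_gconj conj_w_kj conj_w_ki l_minus r_minus)

lemma conj_h_ki: "u \<in> Units R \<Longrightarrow> r \<in> carrier R \<Longrightarrow> gconj (h i j u) (x k i r) = x k i (inv u \<otimes> r)"
  by (simp add: h_def gconj_gconj conj_w_kj conj_w_ki l_minus r_minus)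

lemma conj_h_ij: "u \<in> Units R \<Longrightarrow> r \<in> carrier R \<Longrightarrow> gconj (h i j u) (x i j r) = x i j (u \<otimes> (u \<otimes> r))"
  by (simp add: h_def gconj_gconj conj_w_ij conj_w_ji l_minus r_minus)

lemma conj_h_ji: "u \<in> Units R \<Longrightarrow> r \<in> carrier R \<Longrightarrow> gconj (h i j u) (x j i r) = x j i (inv u \<otimes> (inv u \<otimes> r))"
  by (simp add: h_def gconj_gconj conj_w_ij conj_w_ji l_minus r_minus)

lemma conj_h_kl:
  assumes "k' \<in> D" "k' \<noteq> k" "k' \<noteq> i" "k' \<noteq> j" "u \<in> Units R" "r \<in> carrier R"
  shows "gconj (h i j u) (x k k' r) = x k k' r"
  using assms by (simp add: h_def gconj_gconj conj_w_kl)

text \<open>The element \<open>w i j u\<close> is fixed by conjugation with itself; conjugating its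
  three root factors one by one exchanges the roles of \<open>i\<close> and
  \<open>j\<close>.\<close>

lemma w_opposite:
  assumes u: "u \<in> Units R"
  shows "w j i (\<ominus> (inv u)) = w i j u"
proof -
  have "w i j u = gconj (w i j u) (w i j u)" by simp
  also have "\<dots> = gconj (w i j u) (x i j u * x j i (\<ominus> (inv u)) * x i j u)"
    by (simp add: w_def [symmetric])
  also have "\<dots> = x j i (\<ominus> (inv u)) * x i j u * x j i (\<ominus> (inv u))"
    using u by (simp add: gconj_mult conj_w_ij conj_w_ji l_minus r_minus)
  also have "\<dots> = w j i (\<ominus> (inv u))"
    using u by (simp add: w_def)
  finally show ?thesis by simp
qed

text \<open>Conjugating the three factors gives a word of the form \<open>w j i\<close>, which
  \<open>w_opposite\<close> turns back into \<open>w i j\<close>.\<close>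

lemma conj_w_w:
  assumes u: "u \<in> Units R" and v: "v \<in> Units R"
  shows "gconj (w i j u) (w i j v) = w i j (u \<otimes> (u \<otimes> inv v))"
proof -
  let ?c = "\<ominus> (inv u \<otimes> (inv u \<otimes> v))" and ?e = "u \<otimes> (u \<otimes> inv v)"
  have "gconj (w i j u) (w i j v) = gconj (w i j u) (x i j v * x j i (\<ominus> (inv v)) * x i j v)"
    by (simp add: w_def [of i j v])
  also have "\<dots> = x j i ?c * x i j ?e * x j i ?c"
    using u v by (simp add: gconj_mult conj_w_ij conj_w_ji r_minus)
  also have "\<dots> = w j i (\<ominus> (inv ?e))"
    using u v by (simp add: w_def m_assoc)
  also have "\<dots> = w i j ?e"
    using u v by (intro w_opposite) simp
  finally show ?thesis .
qed

end
end

section \<open>Commutator identities\<close>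

context grp
begin

definition gcomm :: "'a \<Rightarrow> 'a \<Rightarrow> 'a" where
  "gcomm a b = a * b * inverse a * inverse b"

lemma inverse_gcomm: "inverse (gcomm a b) = gcomm b a"
  by (simp add: gcomm_def grp_simps)

lemma gcomm_mult_right:
  assumes "gcomm a c * b = b * gcomm a c"
  shows "gcomm a (b * c) = gcomm a b * gcomm a c"
proof -
  have "gcomm a (b * c) = a * b * inverse a * gcomm a c * inverse b"
    by (simp add: gcomm_def grp_simps)
  also have "\<dots> = a * b * inverse a * (inverse b * gcomm a c)"
    using assms by (metis grp_simps(1) inverse_cancel_left mult_inverse_eq_iff)
  also have "\<dots> = gcomm a b * gcomm a c"
    by (simp only: gcomm_def mult.assoc)
  finally show ?thesis .
qed

lemma gcomm_eq_one: "a * b = b * a \<Longrightarrow> gcomm a b = 1"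
  by (simp add: gcomm_def grp_simps)

end

section \<open>Symbols: centrality, choice of indices, bimultiplicativity\<close>

context steinberg_rep
begin

lemma third_index:
  obtains k where "k \<in> D" "k \<noteq> i" "k \<noteq> j"
proof -
  have "(1 \<noteq> i \<and> 1 \<noteq> j) \<or> (2 \<noteq> i \<and> 2 \<noteq> j) \<or> (3 \<noteq> i \<and> 3 \<noteq> j)"
    by presburger
  moreover have "1 \<in> D" "2 \<in> D" "3 \<in> D"
    using d3 unfolding atLeastAtMost_iff by linarith+
  ultimately show ?thesis using that by blast
qed

text \<open>The \<open>k\<close>-th diagonal entry of the matrix of \<open>h i j u\<close>; with it
  a single formula describes the action of \<open>h i j u\<close> on all root elements.\<close>

definition weight :: "nat \<Rightarrow> nat \<Rightarrow> 'a \<Rightarrow> nat \<Rightarrow> 'a" where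
  "weight i j u k = (if k = i then u else if k = j then inv u else \<one>)"

lemma weight_Units [simp]: "u \<in> Units R \<Longrightarrow> weight i j u k \<in> Units R"
  by (simp add: weight_def)

lemma conj_h:
  assumes "i \<in> D" "j \<in> D" "i \<noteq> j" "k \<in> D" "l \<in> D" "k \<noteq> l" "u \<in> Units R" "r \<in> carrier R"
  shows "gconj (h i j u) (x k l r) = x k l (weight i j u k \<otimes> inv (weight i j u l) \<otimes> r)"
proof -
  obtain m where m: "m \<in> D" "m \<noteq> i" "m \<noteq> j" by (rule third_index)
  consider "k = i" "l = j" | "k = j" "l = i" | "k = i" "l \<noteq> j" | "k = j" "l \<noteq> i"
    | "l = i" "k \<noteq> j" | "l = j" "k \<noteq> i" | "k \<noteq> i" "k \<noteq> j" "l \<noteq> i" "l \<noteq> j" by blast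
  then show ?thesis
    using assms m
    by cases (simp_all add: weight_def m_assoc conj_h_ij [of i j m] conj_h_ji [of i j m]
        conj_h_ik conj_h_jk conj_h_ki conj_h_kj conj_h_kl)
qed

lemma conj_inverse_h:
  assumes "i \<in> D" "j \<in> D" "i \<noteq> j" "k \<in> D" "l \<in> D" "k \<noteq> l" "u \<in> Units R" "r \<in> carrier R"
  shows "gconj (inverse (h i j u)) (x k l r) = x k l (inv (weight i j u k) \<otimes> weight i j u l \<otimes> r)"
proof -
  let ?s = "inv (weight i j u k) \<otimes> weight i j u l \<otimes> r"
  have "gconj (h i j u) (x k l ?s) = x k l (weight i j u k \<otimes> inv (weight i j u l) \<otimes> ?s)"
    using assms by (intro conj_h) simp_all
  also have "weight i j u k \<otimes> inv (weight i j u l) \<otimes> ?s = r"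
    using assms by (simp add: m_ac)
  finally show ?thesis by (metis gconj_inverse_gconj(1))
qed

lemma weight_mult: "u \<in> Units R \<Longrightarrow> v \<in> Units R \<Longrightarrow> weight i j (u \<otimes> v) k = weight i j u k \<otimes> weight i j v k"
  by (simp add: weight_def)

definition E :: "'g set" where
  "E = gspan {x i j r | i j r. i \<in> D \<and> j \<in> D \<and> i \<noteq> j \<and> r \<in> carrier R}"

lemma E_induct [consumes 1, case_names one mult]:
  assumes "g \<in> E" "P 1"
    and "\<And>i j r g. i \<in> D \<Longrightarrow> j \<in> D \<Longrightarrow> i \<noteq> j \<Longrightarrow> r \<in> carrier R \<Longrightarrow> g \<in> E \<Longrightarrow> P g \<Longrightarrow> P (x i j r * g)"
  shows "P g"
  using assms(1) unfolding E_def
proof (induction rule: gspan_symmetric_induct)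
  case (inverse s)
  then obtain i j r where "s = x i j r" "i \<in> D" "j \<in> D" "i \<noteq> j" "r \<in> carrier R" by blast
  moreover from this have "inverse s = x i j (\<ominus> r)" by (simp add: x_minus)
  ultimately show ?case using a_inv_closed by blast
qed (use assms(2,3) in \<open>auto simp: E_def\<close>)

lemma x_E [simp]: "i \<in> D \<Longrightarrow> j \<in> D \<Longrightarrow> i \<noteq> j \<Longrightarrow> r \<in> carrier R \<Longrightarrow> x i j r \<in> E"
  unfolding E_def by (rule gspan_base) blast

lemma E_mult [simp]: "g \<in> E \<Longrightarrow> g' \<in> E \<Longrightarrow> g * g' \<in> E"
  unfolding E_def by (rule gspan_mult)

lemma E_inverse [simp]: "g \<in> E \<Longrightarrow> inverse g \<in> E"
  unfolding E_def by (rule gspan_inverse)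

lemma E_one [simp]: "1 \<in> E"
  unfolding E_def by simp

lemma w_E [simp]: "i \<in> D \<Longrightarrow> j \<in> D \<Longrightarrow> i \<noteq> j \<Longrightarrow> u \<in> Units R \<Longrightarrow> w i j u \<in> E"
  by (simp add: w_def)

lemma h_E [simp]: "i \<in> D \<Longrightarrow> j \<in> D \<Longrightarrow> i \<noteq> j \<Longrightarrow> u \<in> Units R \<Longrightarrow> h i j u \<in> E"
  by (simp add: h_def)

lemma symb_E [simp]:
  "i \<in> D \<Longrightarrow> j \<in> D \<Longrightarrow> i \<noteq> j \<Longrightarrow> u \<in> Units R \<Longrightarrow> v \<in> Units R \<Longrightarrow> symb i j u v \<in> E"
  by (simp add: symb_def)

lemma centralI:
  assumes "\<And>i j r. i \<in> D \<Longrightarrow> j \<in> D \<Longrightarrow> i \<noteq> j \<Longrightarrow> r \<in> carrier R \<Longrightarrow> gconj z (x i j r) = x i j r" and "g \<in> E"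
  shows "z * g = g * z"
  using assms(2) unfolding E_def
  by (rule commute_gspan [rotated]) (use assms(1) in \<open>auto simp: gconj_eq_self_iff\<close>)

text \<open>Conjugation scales \<open>x k l r\<close> by a ratio of weights, and weights are
  multiplicative in the unit, so the effects of the three factors of the symbol cancel on every root
  element.\<close>

lemma symb_central:
  assumes "i \<in> D" "j \<in> D" "i \<noteq> j" "u \<in> Units R" "v \<in> Units R" "g \<in> E"
  shows "symb i j u v * g = g * symb i j u v"
  by (rule centralI [OF _ assms(6)])
    (use assms in \<open>simp add: symb_def gconj_gconj conj_h conj_inverse_h weight_mult m_ac unit_cancels\<close>)

lemma conj_symb:
  assumes "i \<in> D" "j \<in> D" "i \<noteq> j" "u \<in> Units R" "v \<in> Units R" "g \<in> E"
  shows "gconj g (symb i j u v) = symb i j u v"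
  using symb_central [OF assms] by (simp add: gconj_eq_self_iff)

context
  fixes i j k :: nat
  assumes ijk: "i \<in> D" "j \<in> D" "k \<in> D" "i \<noteq> j" "j \<noteq> k" "i \<noteq> k"
  notes [simp] = ijk ijk(4-6) [symmetric]
begin

lemma conj_w1_h: "u \<in> Units R \<Longrightarrow> gconj (w j k \<one>) (h i k u) = h i j u"
  "u \<in> Units R \<Longrightarrow> gconj (w j k \<one>) (h k i u) = h j i u"
  by (simp_all add: h_def w_def [of i] w_def [of k] w_def [of j i] gconj_mult conj_w_kj conj_w_jk)

lemma conj_h_h:
  assumes "u \<in> Units R" "v \<in> Units R"
  shows "gconj (h i j u) (h i k v) = h i k (u \<otimes> v) * inverse (h i k u)"
proof -
  have "gconj (h i j u) (h i k v) = w i k (u \<otimes> v) * w i k (\<ominus> u)"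
    using assms
    by (simp add: h_def [of i k] w_def [of i k] gconj_mult conj_h weight_def l_minus r_minus m_ac)
  also have "\<dots> = h i k (u \<otimes> v) * inverse (h i k u)"
    using assms by (simp add: h_def w_minus grp_simps)
  finally show ?thesis .
qed

text \<open>Conjugation by \<open>h i j u\<close> multiplies the arguments of both Weyl factors of
  \<open>h i k v\<close> by \<open>u\<close>, which produces
  \<open>h i k (u \<otimes> v) * inverse (h i k u)\<close>. As a commutator, the symbol inherits the
  calculus of central commutators.\<close>

lemma symb_commutator:
  "u \<in> Units R \<Longrightarrow> v \<in> Units R \<Longrightarrow> symb i k u v = gcomm (h i j u) (h i k v)"
  unfolding symb_def gcomm_def using conj_h_h [of u v] by (simp add: gconj_def)

text \<open>The symbol is central, hence fixed by \<open>w j k \<one>\<close>, whereas conjugation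
  by that element renames \<open>k\<close> to \<open>j\<close> in each \<open>h\<close>.\<close>

lemma symb_change:
  assumes "u \<in> Units R" "v \<in> Units R"
  shows "symb i k u v = symb i j u v" "symb k i u v = symb j i u v"
proof -
  have "symb i k u v = gconj (w j k \<one>) (symb i k u v)"
    "symb k i u v = gconj (w j k \<one>) (symb k i u v)"
    using assms by (simp_all add: conj_symb)
  then show "symb i k u v = symb i j u v" "symb k i u v = symb j i u v"
    using assms by (simp_all add: symb_def gconj_mult gconj_inverse conj_w1_h)
qed

end

lemma symb_indep:
  assumes "i \<in> D" "j \<in> D" "i \<noteq> j" "k \<in> D" "l \<in> D" "k \<noteq> l" and uv: "u \<in> Units R" "v \<in> Units R"
  shows "symb i j u v = symb k l u v"
proof -
  have 2: "symb a b u v = symb a c u v" if "a \<in> D" "b \<in> D" "c \<in> D" "a \<noteq> b" "a \<noteq> c" for a b c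
    using that symb_change(1) [of a c b u v] uv by (cases "b = c") auto
  have 1: "symb b a u v = symb c a u v" if "a \<in> D" "b \<in> D" "c \<in> D" "a \<noteq> b" "a \<noteq> c" for a b c
    using that symb_change(2) [of a c b u v] uv by (cases "b = c") auto
  obtain m where "m \<in> D" "m \<noteq> i" "m \<noteq> j" by (rule third_index)
  \<comment> \<open>If \<open>m\<close> differs from \<open>k\<close>, the index pair passes through
    (i, m) and (k, m); if \<open>m = k\<close>, it passes through (k, j).\<close>
  then show ?thesis
    using assms 2 [of i j m] 2 [of k m l] 1 [of m i k] 1 [of j i k] 2 [of k j l] by metis
qed

abbreviation sy :: "'a \<Rightarrow> 'a \<Rightarrow> 'g" where
  "sy \<equiv> symb 1 2"

lemma D123 [simp]: "1 \<in> D" "2 \<in> D" "3 \<in> D"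
  using d3 unfolding atLeastAtMost_iff by linarith+

lemma symb_sy: "i \<in> D \<Longrightarrow> j \<in> D \<Longrightarrow> i \<noteq> j \<Longrightarrow> u \<in> Units R \<Longrightarrow> v \<in> Units R \<Longrightarrow> symb i j u v = sy u v"
  by (rule symb_indep) simp_all

lemma sy_central: "u \<in> Units R \<Longrightarrow> v \<in> Units R \<Longrightarrow> g \<in> E \<Longrightarrow> sy u v * g = g * sy u v"
  by (rule symb_central) simp_all

lemma sy_commutator:
  "\<lbrakk>i \<in> D; j \<in> D; k \<in> D; i \<noteq> j; j \<noteq> k; i \<noteq> k; u \<in> Units R; v \<in> Units R\<rbrakk>
    \<Longrightarrow> sy u v = gcomm (h i j u) (h i k v)"
  using symb_commutator [of i j k u v] symb_sy [of i k u v] by metis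

lemma inverse_sy:
  assumes "u \<in> Units R" "v \<in> Units R"
  shows "inverse (sy u v) = sy v u"
proof -
  have "sy u v = gcomm (h 1 2 u) (h 1 3 v)" "sy v u = gcomm (h 1 3 v) (h 1 2 u)"
    using assms by (intro sy_commutator; simp)+
  then show ?thesis by (simp only: inverse_gcomm)
qed

lemma h_mult:
  assumes "i \<in> D" "j \<in> D" "i \<noteq> j" "u \<in> Units R" "v \<in> Units R"
  shows "h i j (u \<otimes> v) = sy u v * h i j v * h i j u"
  using assms symb_sy [of i j u v] by (simp add: symb_def grp_simps flip: mult_inverse_eq_iff)

text \<open>A commutator with a fixed left entry is multiplicative in the right entry as long as its
  values are central. \<open>h 1 3\<close> is multiplicative up to a symbol, and this central factor
  does not change the commutator.\<close>

lemma sy_mult_right: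
  assumes u: "u \<in> Units R" and v: "v \<in> Units R" and v': "v' \<in> Units R"
  shows "sy u (v \<otimes> v') = sy u v * sy u v'"
proof -
  let ?A = "h 1 2 u" and ?B = "h 1 3"
  have c: "sy u v = gcomm ?A (?B v)" if "v \<in> Units R" for v
    using sy_commutator [of 1 2 3 u v] u that by simp
  have "sy u (v \<otimes> v') = gcomm ?A (sy v v' * (?B v' * ?B v))"
    using u v v' by (subst c) (simp_all add: h_mult mult.assoc)
  also have "\<dots> = gcomm ?A (sy v v') * gcomm ?A (?B v' * ?B v)"
    using u v v' by (intro gcomm_mult_right sy_central [symmetric]) (simp_all add: gcomm_def)
  also have "gcomm ?A (sy v v') = 1"
    using u v v' by (intro gcomm_eq_one sy_central [symmetric]) simp_all
  also have "gcomm ?A (?B v' * ?B v) = gcomm ?A (?B v') * gcomm ?A (?B v)"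
    using u v v' sy_central [of u v "?B v'"] c [OF v] by (intro gcomm_mult_right) simp
  also have "\<dots> = sy u v * sy u v'"
    using u v v' sy_central [of u v "sy u v'"] by (simp flip: c)
  finally show ?thesis by simp
qed

lemma sy_mult_left:
  assumes u: "u \<in> Units R" and u': "u' \<in> Units R" and v: "v \<in> Units R"
  shows "sy (u \<otimes> u') v = sy u v * sy u' v"
proof -
  have "sy (u \<otimes> u') v = inverse (sy v (u' \<otimes> u))"
    using assms by (simp add: inverse_sy m_comm)
  also have "\<dots> = sy u v * sy u' v"
    using assms by (simp add: sy_mult_right inverse_sy)
  finally show ?thesis .
qed

lemma mult_self_eq_one: "(g :: 'g) * g = g \<Longrightarrow> g = 1"
  using grp_left_cancel [of g g 1] by simp

lemma sy_one [simp]: "u \<in> Units R \<Longrightarrow> sy u \<one> = 1" "u \<in> Units R \<Longrightarrow> sy \<one> u = 1"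
  using sy_mult_right [of u \<one> \<one>] sy_mult_left [of \<one> \<one> u] by (simp_all add: mult_self_eq_one)

lemma sy_inv_right: "u \<in> Units R \<Longrightarrow> v \<in> Units R \<Longrightarrow> sy u (inv v) = inverse (sy u v)"
  using sy_mult_right [of u v "inv v"] by (simp add: grp_inverse_unique)

lemma sy_inv_left: "u \<in> Units R \<Longrightarrow> v \<in> Units R \<Longrightarrow> sy (inv u) v = inverse (sy u v)"
  using sy_mult_left [of u "inv u" v] by (simp add: grp_inverse_unique)

lemma conj_w_w':
  assumes "i \<in> D" "j \<in> D" "i \<noteq> j" "u \<in> Units R" "v \<in> Units R"
  shows "gconj (w i j u) (w i j v) = w i j (u \<otimes> (u \<otimes> inv v))"
  by (rule third_index [of i j]) (use assms conj_w_w [of i j] in auto)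

lemma w_opposite':
  assumes "i \<in> D" "j \<in> D" "i \<noteq> j" "u \<in> Units R"
  shows "w j i (\<ominus> (inv u)) = w i j u"
  by (rule third_index [of i j]) (use assms w_opposite [of i j] in auto)

text \<open>Since \<open>w 1 2 (\<ominus> u)\<close> inverts \<open>w 1 2 u\<close>, the product
  \<open>h 1 2 (\<ominus> u) * h 1 2 u\<close> contains a conjugate of
  \<open>w 1 2 (\<ominus> \<one>)\<close>, equal to \<open>w 1 2\<close> at minus the square of
  \<open>u\<close>. So the product is \<open>h 1 2 (u \<otimes> \<ominus> u)\<close>, with no symbol
  left over.\<close>

lemma sy_minus_self:
  assumes u: "u \<in> Units R"
  shows "sy u (\<ominus> u) = 1"
proof -
  have "h 1 2 (\<ominus> u) * h 1 2 u = gconj (w 1 2 (\<ominus> u)) (w 1 2 (\<ominus> \<one>)) * w 1 2 (\<ominus> \<one>)"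
    using u by (simp add: h_def gconj_def w_minus grp_simps)
  also have "\<dots> = h 1 2 (u \<otimes> \<ominus> u)"
    using u by (simp add: conj_w_w' h_def r_minus l_minus)
  also have "\<dots> = sy u (\<ominus> u) * (h 1 2 (\<ominus> u) * h 1 2 u)"
    using u by (simp add: h_mult mult.assoc)
  finally show ?thesis by (metis grp_right_cancel mult_1_left)
qed

lemma h_one [simp]: "i \<in> D \<Longrightarrow> j \<in> D \<Longrightarrow> i \<noteq> j \<Longrightarrow> h i j \<one> = 1"
  by (simp add: h_def w_minus grp_simps)

end

section \<open>Dennis-Stein elements\<close>

context cring
begin

text \<open>Described by the unit criterion rather than by maximal ideals:
  \<open>\<one> \<ominus> a \<otimes> b\<close> is the element that has to be inverted in
  \<open>ds i j a b\<close>.\<close>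

definition Jac :: "'a set" where
  "Jac = {a \<in> carrier R. \<forall>b\<in>carrier R. \<one> \<ominus> a \<otimes> b \<in> Units R}"

lemma Jac_carrier: "a \<in> Jac \<Longrightarrow> a \<in> carrier R"
  by (simp add: Jac_def)

lemma Jac_unit: "a \<in> Jac \<Longrightarrow> b \<in> carrier R \<Longrightarrow> \<one> \<ominus> a \<otimes> b \<in> Units R"
  by (simp add: Jac_def)

lemma Jac_unit': "a \<in> Jac \<Longrightarrow> b \<in> carrier R \<Longrightarrow> \<one> \<oplus> a \<otimes> b \<in> Units R"
  using Jac_unit [of a "\<ominus> b"] Jac_carrier [of a] by (simp add: minus_eq r_minus)

lemma Jac_mult: "a \<in> Jac \<Longrightarrow> r \<in> carrier R \<Longrightarrow> a \<otimes> r \<in> Jac"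
  by (simp add: Jac_def m_assoc)

lemma Jac_mult': "a \<in> Jac \<Longrightarrow> r \<in> carrier R \<Longrightarrow> r \<otimes> a \<in> Jac"
  using Jac_mult [of a r] Jac_carrier [of a] by (simp add: m_comm)

text \<open>With u = 1 - a c one has 1 - (a + b) c = u (1 - b c / u), a product of two
  units.\<close>

lemma Jac_add:
  assumes "a \<in> Jac" "b \<in> Jac"
  shows "a \<oplus> b \<in> Jac"
proof -
  note [simp] = Jac_carrier [OF assms(1)] Jac_carrier [OF assms(2)]
  have "\<one> \<ominus> (a \<oplus> b) \<otimes> c \<in> Units R" if c [simp]: "c \<in> carrier R" for c
  proof -
    let ?u = "\<one> \<ominus> a \<otimes> c"
    have u: "?u \<in> Units R" using assms by (simp add: Jac_unit)
    have "\<one> \<ominus> b \<otimes> (inv ?u \<otimes> c) \<in> Units R"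
      using assms u by (intro Jac_unit) simp_all
    then have "?u \<otimes> (\<one> \<ominus> b \<otimes> (inv ?u \<otimes> c)) \<in> Units R"
      using u by simp
    also have "w \<otimes> (\<one> \<ominus> b \<otimes> (w' \<otimes> c)) = w \<ominus> b \<otimes> (w \<otimes> (w' \<otimes> c))"
      if "w \<in> carrier R" "w' \<in> carrier R" for w w'
      using that c Jac_carrier [OF assms(2)] by algebra
    then have "?u \<otimes> (\<one> \<ominus> b \<otimes> (inv ?u \<otimes> c)) = ?u \<ominus> b \<otimes> (?u \<otimes> (inv ?u \<otimes> c))"
      using Units_inv_closed [OF u] Units_closed [OF u] by blast
    also have "\<dots> = ?u \<ominus> b \<otimes> c"
      using u by simp
    also have "\<dots> = \<one> \<ominus> (a \<oplus> b) \<otimes> c"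
      using c Jac_carrier [OF assms(1)] Jac_carrier [OF assms(2)] by algebra
    finally show ?thesis .
  qed
  then show ?thesis by (simp add: Jac_def)
qed

lemma Jac_zero: "\<zero> \<in> Jac"
  by (simp add: Jac_def minus_eq)

lemma inv_one_minus:
  assumes [simp]: "a \<in> carrier R" "b \<in> carrier R" and v: "\<one> \<ominus> a \<otimes> b \<in> Units R"
  shows "inv (\<one> \<ominus> a \<otimes> b) = \<one> \<oplus> inv (\<one> \<ominus> a \<otimes> b) \<otimes> (a \<otimes> b)"
proof -
  let ?v = "\<one> \<ominus> a \<otimes> b"
  have "inv ?v = inv ?v \<otimes> ?v \<oplus> inv ?v \<otimes> (a \<otimes> b)"
    using Units_inv_closed [OF v] assms(1,2) by algebra
  then show ?thesis using v by simp
qed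

end

section \<open>Rank one tori and the basic relations of Dennis-Stein elements\<close>

context steinberg_rep
begin

definition K :: "nat \<Rightarrow> nat \<Rightarrow> 'g set" where
  "K i j = gspan {h i j u | u. u \<in> Units R}"

lemma K_h: "u \<in> Units R \<Longrightarrow> h i j u \<in> K i j"
  unfolding K_def by (rule gspan_base) blast

lemma K_mult: "k \<in> K i j \<Longrightarrow> k' \<in> K i j \<Longrightarrow> k * k' \<in> K i j"
  unfolding K_def by (rule gspan_mult)

lemma K_inverse: "k \<in> K i j \<Longrightarrow> inverse k \<in> K i j"
  unfolding K_def by (rule gspan_inverse)

lemma w_mult_w: "i \<in> D \<Longrightarrow> j \<in> D \<Longrightarrow> i \<noteq> j \<Longrightarrow> u \<in> Units R \<Longrightarrow> v \<in> Units R \<Longrightarrow> w i j u * w i j v = h i j u * inverse (h i j (\<ominus> v))"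
  by (simp add: h_def w_minus grp_simps)

lemma K_ww: "i \<in> D \<Longrightarrow> j \<in> D \<Longrightarrow> i \<noteq> j \<Longrightarrow> u \<in> Units R \<Longrightarrow> v \<in> Units R \<Longrightarrow> w i j u * w i j v \<in> K i j"
  by (simp add: w_mult_w K_h K_mult K_inverse)

text \<open>By \<open>w_opposite'\<close> each \<open>w j i v\<close> is some \<open>w i j\<close>,
  and a product of two such elements lies in \<open>K i j\<close>.\<close>

lemma K_swap:
  assumes "i \<in> D" "j \<in> D" "i \<noteq> j"
  shows "K j i \<subseteq> K i j"
  unfolding K_def [of j i]
proof -
  have "h j i u \<in> K i j" if u: "u \<in> Units R" for u
  proof -
    have "w j i v = w i j (\<ominus> (inv v))" if "v \<in> Units R" for v
      using w_opposite' [of i j "\<ominus> (inv v)"] assms that by simp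
    then show ?thesis using assms u K_ww by (simp add: h_def)
  qed
  then show "gspan {h j i u |u. u \<in> Units R} \<subseteq> K i j"
    unfolding K_def by (intro gspan_subset) blast
qed

definition H :: "'g set" where
  "H = gspan {h i j u | i j u. i \<in> D \<and> j \<in> D \<and> i \<noteq> j \<and> u \<in> Units R}"

lemma H_E: "g \<in> H \<Longrightarrow> g \<in> E"
  unfolding H_def by (induction rule: gspan.induct) auto

lemma K_H: "i \<in> D \<Longrightarrow> j \<in> D \<Longrightarrow> i \<noteq> j \<Longrightarrow> K i j \<subseteq> H"
  unfolding K_def H_def by (rule gspan_mono) blast

text \<open>Only the existence of the scalar is recorded: what matters later is that
  \<open>H\<close> normalizes every root subgroup.\<close>

lemma H_scale:
  assumes g: "g \<in> H" and kl: "k \<in> D" "l \<in> D" "k \<noteq> l" and r: "r \<in> carrier R"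
  shows "\<exists>r'\<in>carrier R. gconj g (x k l r) = x k l r'"
  using g unfolding H_def
proof (induction rule: gspan.induct)
  case gspan_one
  then show ?case using r by auto
next
  case (gspan_mult_left s g)
  then obtain i j u r' where "s = h i j u" "i \<in> D" "j \<in> D" "i \<noteq> j" "u \<in> Units R" "r' \<in> carrier R"
    "gconj g (x k l r) = x k l r'" by blast
  then show ?case using kl
    by (intro bexI [of _ "weight i j u k \<otimes> inv (weight i j u l) \<otimes> r'"]) (simp_all add: gconj_gconj conj_h)
next
  case (gspan_inverse_left s g)
  then obtain i j u r' where "s = h i j u" "i \<in> D" "j \<in> D" "i \<noteq> j" "u \<in> Units R" "r' \<in> carrier R"
    "gconj g (x k l r) = x k l r'" by blast
  then show ?case using kl
    by (intro bexI [of _ "inv (weight i j u k) \<otimes> weight i j u l \<otimes> r'"]) (simp_all add: gconj_gconj conj_inverse_h)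
qed

lemma K_scale:
  assumes "i \<in> D" "j \<in> D" "i \<noteq> j" "k \<in> D" "l \<in> D" "k \<noteq> l" "g \<in> K i j" "r \<in> carrier R"
  shows "\<exists>r'\<in>carrier R. g * x k l r = x k l r' * g"
proof -
  obtain r' where "r' \<in> carrier R" "gconj g (x k l r) = x k l r'"
    using H_scale [of g k l r] K_H [of i j] assms by blast
  then show ?thesis by (metis mult_gconj)
qed

definition central :: "'g set" where
  "central = {z \<in> E. \<forall>g\<in>E. z * g = g * z}"

text \<open>With \<open>v = 1 - a b\<close>, the matrix product of \<open>x i j (- a)\<close> and \<open>x j i b\<close> factors as lower unipotent
  \<open>x j i (b / v)\<close>, diagonal \<open>h i j v\<close>, upper unipotent \<open>x i j (- a / v)\<close>; \<open>ds\<close> measures the failure of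
  this factorization in the Steinberg group.\<close>

definition ds :: "nat \<Rightarrow> nat \<Rightarrow> 'a \<Rightarrow> 'a \<Rightarrow> 'g" where
  "ds i j a b = (let v = \<one> \<ominus> a \<otimes> b in
    x j i (\<ominus> (inv v \<otimes> b)) * x i j (\<ominus> a) * x j i b * x i j (inv v \<otimes> a) * inverse (h i j v))"

context
  fixes i j :: nat
  assumes ij: "i \<in> D" "j \<in> D" "i \<noteq> j"
  notes [simp] = ij ij(3) [symmetric]
begin

lemma h_x_ji: "u \<in> Units R \<Longrightarrow> r \<in> carrier R \<Longrightarrow> h i j u * x j i r = x j i (inv u \<otimes> (inv u \<otimes> r)) * h i j u"
  by (subst mult_gconj) (simp add: conj_h weight_def m_assoc)

lemma conj_w_ij': "u \<in> Units R \<Longrightarrow> r \<in> carrier R \<Longrightarrow> gconj (w i j u) (x i j r) = x j i (\<ominus> (inv u \<otimes> (inv u \<otimes> r)))"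
  by (rule third_index [of i j]) (use conj_w_ij [of i j] in auto)

lemma conj_w_ji': "u \<in> Units R \<Longrightarrow> r \<in> carrier R \<Longrightarrow> gconj (w i j u) (x j i r) = x i j (\<ominus> (u \<otimes> (u \<otimes> r)))"
  by (rule third_index [of i j]) (use conj_w_ji [of i j] in auto)

lemma x_ji_unit: "b \<in> Units R \<Longrightarrow> x j i b = x i j (inv b) * w i j (\<ominus> (inv b)) * x i j (inv b)"
  by (simp add: w_def x_minus grp_simps)

lemma x_ij_unit:
  assumes "u \<in> Units R"
  shows "x i j u = x j i (inv u) * w i j u * x j i (inv u)"
proof -
  have "w i j u = x j i (\<ominus> (inv u)) * x i j u * x j i (\<ominus> (inv u))"
    using assms w_opposite' [of i j u] by (simp add: w_def)
  then show ?thesis using assms by (simp add: x_minus grp_simps)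
qed

text \<open>Since \<open>b\<close> is a unit, \<open>x j i b\<close> is rewritten with a Weyl
  element in the middle. The factor \<open>x i j\<close> in front of it then has the unit argument
  \<open>v / b\<close> and is rewritten in the same way. The two Weyl elements combine to
  \<open>h\<close> at \<open>v / b\<close> times the inverse of \<open>h\<close> at
  \<open>1 / b\<close>, and the failure of \<open>h\<close> to be multiplicative is the
  symbol.\<close>

lemma rank_one_unit:
  assumes a [simp]: "a \<in> carrier R" and b [simp]: "b \<in> Units R" and v: "\<one> \<ominus> a \<otimes> b \<in> Units R" (is "?v \<in> _")
  shows "x i j (\<ominus> a) * x j i b = x j i (inv ?v \<otimes> b) * (sy ?v b * h i j ?v) * x i j (\<ominus> (inv ?v \<otimes> a))"
proof -
  note [simp] = v
  let ?b = "inv b" and ?c = "inv ?v"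
  have 1: "\<ominus> a \<oplus> ?b = ?v \<otimes> ?b"
  proof -
    have "?v \<otimes> ?b = ?b \<ominus> a \<otimes> (b \<otimes> ?b)"
      using Units_closed [OF b] Units_inv_closed [OF b] a by algebra
    then show ?thesis by (simp add: minus_eq a_comm)
  qed
  have 2: "\<ominus> (?b \<otimes> ?c) \<oplus> ?b = \<ominus> (?c \<otimes> a)"
  proof -
    have "\<ominus> (?b \<otimes> ?c) \<oplus> ?b = \<ominus> (?b \<otimes> (\<one> \<oplus> ?c \<otimes> (a \<otimes> b))) \<oplus> ?b"
      using inv_one_minus [of a b] by simp
    also have "\<dots> = \<ominus> (?c \<otimes> (a \<otimes> (b \<otimes> ?b)))"
      using Units_closed [OF b] Units_inv_closed [OF b] Units_inv_closed [OF v] a by algebra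
    finally show ?thesis by simp
  qed
  have "x i j (\<ominus> a) * x j i b = x i j (?v \<otimes> ?b) * w i j (\<ominus> ?b) * x i j ?b"
    by (simp add: x_ji_unit [of b] 1 x_add flip: mult.assoc)
  also have "\<dots> = x j i (?c \<otimes> b) * w i j (?v \<otimes> ?b) * (x j i (?c \<otimes> b) * w i j (\<ominus> ?b)) * x i j ?b"
    by (subst x_ij_unit) (simp_all add: mult.assoc)
  also have "x j i (?c \<otimes> b) * w i j (\<ominus> ?b) = w i j (\<ominus> ?b) * x i j (\<ominus> (?b \<otimes> ?c))"
    by (subst mult_gconj [of "w i j (\<ominus> ?b)"]) (simp add: conj_w_ij' l_minus r_minus m_ac)
  also have "x j i (?c \<otimes> b) * w i j (?v \<otimes> ?b) * (w i j (\<ominus> ?b) * x i j (\<ominus> (?b \<otimes> ?c))) * x i j ?b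
    = x j i (?c \<otimes> b) * (w i j (?v \<otimes> ?b) * w i j (\<ominus> ?b)) * x i j (\<ominus> (?c \<otimes> a))"
    by (simp add: mult.assoc x_add 2)
  also have "w i j (?v \<otimes> ?b) * w i j (\<ominus> ?b) = h i j (?b \<otimes> ?v) * inverse (h i j ?b)"
    by (simp add: w_mult_w m_comm)
  also have "\<dots> = sy ?b ?v * h i j ?v"
    by (simp add: h_mult grp_simps)
  also have "sy ?b ?v = sy ?v b"
    by (simp add: sy_inv_left inverse_sy)
  finally show ?thesis .
qed

lemma ds_rel:
  assumes "a \<in> carrier R" "b \<in> carrier R" "\<one> \<ominus> a \<otimes> b \<in> Units R" (is "?v \<in> _")
  shows "x i j (\<ominus> a) * x j i b = x j i (inv ?v \<otimes> b) * (ds i j a b * h i j ?v) * x i j (\<ominus> (inv ?v \<otimes> a))"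
  using assms by (simp add: ds_def Let_def x_minus grp_simps)

text \<open>The outer factors are known, so cancellation isolates the middle one. The basic
  identities for \<open>ds\<close> are obtained by factoring one product in two ways.\<close>

lemma ds_eqI:
  assumes "a \<in> carrier R" "b \<in> carrier R" "\<one> \<ominus> a \<otimes> b \<in> Units R"
    and "x i j (\<ominus> a) * x j i b = x j i (inv (\<one> \<ominus> a \<otimes> b) \<otimes> b) * (z * h i j (\<one> \<ominus> a \<otimes> b))
      * x i j (\<ominus> (inv (\<one> \<ominus> a \<otimes> b) \<otimes> a))"
  shows "ds i j a b = z"
  using ds_rel [OF assms(1-3)] assms(4) by simp

lemma ds_unit:
  assumes "a \<in> carrier R" "b \<in> Units R" "\<one> \<ominus> a \<otimes> b \<in> Units R"
  shows "ds i j a b = sy (\<one> \<ominus> a \<otimes> b) b"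
  using assms by (intro ds_eqI rank_one_unit) simp_all

text \<open>Obtained by splitting \<open>x j i (b + c)\<close> in two and moving \<open>x i j (- a)\<close> to the right in two steps.\<close>

lemma ds_cocycle:
  assumes a: "a \<in> Jac" and b: "b \<in> carrier R" and c: "c \<in> carrier R"
    and v_def: "v = \<one> \<ominus> a \<otimes> b" and v'_def: "v' = \<one> \<ominus> inv v \<otimes> a \<otimes> c"
    and z: "ds i j a b \<in> central" and z': "ds i j (inv v \<otimes> a) c \<in> central"
  shows "ds i j a (b \<oplus> c) = ds i j a b * ds i j (inv v \<otimes> a) c * sy v v'"
proof -
  note [simp] = b c Jac_carrier [OF a]
  have v [simp]: "v \<in> Units R" using a by (simp add: v_def Jac_unit)
  have a2: "inv v \<otimes> a \<in> Jac" using a by (simp add: Jac_mult')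
  have v' [simp]: "v' \<in> Units R" unfolding v'_def using Jac_unit [OF a2] by simp
  have vv': "\<one> \<ominus> a \<otimes> (b \<oplus> c) = v \<otimes> v'"
  proof -
    have "v \<otimes> v' = v \<ominus> v \<otimes> (inv v \<otimes> (a \<otimes> c))"
      unfolding v'_def using Units_inv_closed [OF v] Units_closed [OF v] b c Jac_carrier [OF a] by algebra
    also have "\<dots> = v \<ominus> a \<otimes> c" by simp
    finally show ?thesis unfolding v_def using b c Jac_carrier [OF a] by algebra
  qed
  \<comment> \<open>Argument of the merged left factor: the second lower root element meets the
    first after passing \<open>h i j v\<close>, which scales it by the inverse square of
    \<open>v\<close>.\<close>
  have 1: "inv v \<otimes> b \<oplus> inv v \<otimes> (inv v \<otimes> (inv v' \<otimes> c)) = inv (v \<otimes> v') \<otimes> (b \<oplus> c)"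
  proof -
    have "v \<otimes> v' \<otimes> (inv v \<otimes> b \<oplus> inv v \<otimes> (inv v \<otimes> (inv v' \<otimes> c))) = v' \<otimes> b \<oplus> inv v \<otimes> c"
      by (simp add: r_distr m_ac unit_cancels)
    also have "v' \<otimes> b \<oplus> inv v \<otimes> c = b \<oplus> (inv v \<ominus> inv v \<otimes> (a \<otimes> b)) \<otimes> c"
      unfolding v'_def using Units_inv_closed [OF v] b c Jac_carrier [OF a] by algebra
    also have "inv v \<ominus> inv v \<otimes> (a \<otimes> b) = inv v \<otimes> v"
      unfolding v_def using Units_inv_closed [OF v, unfolded v_def] b Jac_carrier [OF a] by algebra
    finally have "v \<otimes> v' \<otimes> (inv v \<otimes> b \<oplus> inv v \<otimes> (inv v \<otimes> (inv v' \<otimes> c))) = b \<oplus> c"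
      by simp
    then have "inv (v \<otimes> v') \<otimes> (v \<otimes> v' \<otimes> (inv v \<otimes> b \<oplus> inv v \<otimes> (inv v \<otimes> (inv v' \<otimes> c)))) = inv (v \<otimes> v') \<otimes> (b \<oplus> c)"
      by simp
    then show ?thesis by (simp del: unit_inv_mult)
  qed
  let ?z = "ds i j a b" and ?z' = "ds i j (inv v \<otimes> a) c"
  have zc: "?z * g = g * ?z" "?z' * g = g * ?z'" if "g \<in> E" for g
    using z z' that by (auto simp: central_def)
  have [simp]: "?z \<in> E" "?z' \<in> E" using z z' by (auto simp: central_def)
  show ?thesis
  proof (rule ds_eqI)
    have "x i j (\<ominus> a) * x j i (b \<oplus> c) = x i j (\<ominus> a) * x j i b * x j i c"
      by (simp add: x_add mult.assoc)
    also have "\<dots> = x j i (inv v \<otimes> b) * (?z * h i j v) * (x i j (\<ominus> (inv v \<otimes> a)) * x j i c)"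
      by (subst ds_rel) (simp_all add: mult.assoc flip: v_def)
    also have "x i j (\<ominus> (inv v \<otimes> a)) * x j i c
        = x j i (inv v' \<otimes> c) * (?z' * h i j v') * x i j (\<ominus> (inv v' \<otimes> (inv v \<otimes> a)))"
      by (subst ds_rel) (simp_all flip: v'_def)
    also have "x j i (inv v \<otimes> b) * (?z * h i j v) * (x j i (inv v' \<otimes> c) * (?z' * h i j v') * x i j (\<ominus> (inv v' \<otimes> (inv v \<otimes> a))))
      = x j i (inv v \<otimes> b) * (?z * (h i j v * x j i (inv v' \<otimes> c))) * (?z' * h i j v') * x i j (\<ominus> (inv v' \<otimes> (inv v \<otimes> a)))"
      by (simp add: mult.assoc)
    also have "h i j v * x j i (inv v' \<otimes> c) = x j i (inv v \<otimes> (inv v \<otimes> (inv v' \<otimes> c))) * h i j v"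
      by (rule h_x_ji) simp_all
    also have "?z * (x j i (inv v \<otimes> (inv v \<otimes> (inv v' \<otimes> c))) * h i j v) = x j i (inv v \<otimes> (inv v \<otimes> (inv v' \<otimes> c))) * (?z * h i j v)"
      using zc(1) [of "x j i (inv v \<otimes> (inv v \<otimes> (inv v' \<otimes> c)))"] by (simp flip: mult.assoc)
    also have "x j i (inv v \<otimes> b) * (x j i (inv v \<otimes> (inv v \<otimes> (inv v' \<otimes> c))) * (?z * h i j v)) * (?z' * h i j v') * x i j (\<ominus> (inv v' \<otimes> (inv v \<otimes> a)))
      = x j i (inv (v \<otimes> v') \<otimes> (b \<oplus> c)) * (?z * (h i j v * ?z') * h i j v') * x i j (\<ominus> (inv v' \<otimes> (inv v \<otimes> a)))"
      by (simp add: x_add 1 flip: mult.assoc del: unit_inv_mult)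
    also have "h i j v * ?z' = ?z' * h i j v"
      by (simp add: zc(2))
    also have "?z * (?z' * h i j v) * h i j v' = ?z * ?z' * sy v v' * h i j (v \<otimes> v')"
    proof -
      have "h i j (v' \<otimes> v) = sy v' v * h i j v * h i j v'"
        by (rule h_mult) simp_all
      then have "h i j v * h i j v' = sy v v' * h i j (v \<otimes> v')"
        using inverse_sy [of v' v] m_comm [of v v'] by (metis Units_closed inverse_cancel_left mult.assoc v v')
      then show ?thesis by (simp add: mult.assoc)
    qed
    also have "inv v' \<otimes> (inv v \<otimes> a) = inv (v \<otimes> v') \<otimes> a"
      by (simp add: m_ac)
    finally show "x i j (\<ominus> a) * x j i (b \<oplus> c) = x j i (inv (\<one> \<ominus> a \<otimes> (b \<oplus> c)) \<otimes> (b \<oplus> c)) *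
      (?z * ?z' * sy v v' * h i j (\<one> \<ominus> a \<otimes> (b \<oplus> c))) * x i j (\<ominus> (inv (\<one> \<ominus> a \<otimes> (b \<oplus> c)) \<otimes> a))"
      by (simp only: vv')
  qed (use v v' in \<open>simp_all add: vv'\<close>)
qed

end

end

section \<open>Symbols over a local ring\<close>

context steinberg_rep
begin

definition Z :: "'g set" where
  "Z = gspan {sy u v | u v. u \<in> Units R \<and> v \<in> Units R}"

lemma Z_sy: "u \<in> Units R \<Longrightarrow> v \<in> Units R \<Longrightarrow> sy u v \<in> Z"
  unfolding Z_def by (rule gspan_base) blast

lemma Z_induct [consumes 1, case_names one mult]:
  assumes "z \<in> Z" "P 1"
    and "\<And>u v z. u \<in> Units R \<Longrightarrow> v \<in> Units R \<Longrightarrow> z \<in> Z \<Longrightarrow> P z \<Longrightarrow> P (sy u v * z)"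
  shows "P z"
  using assms(1) unfolding Z_def
proof (induction rule: gspan_symmetric_induct)
  case (inverse s)
  then show ?case using inverse_sy by blast
qed (use assms(2,3) in \<open>auto simp: Z_def\<close>)

lemma Z_mult: "z \<in> Z \<Longrightarrow> z' \<in> Z \<Longrightarrow> z * z' \<in> Z"
  unfolding Z_def by (rule gspan_mult)

lemma Z_inverse: "z \<in> Z \<Longrightarrow> inverse z \<in> Z"
  unfolding Z_def by (rule gspan_inverse)

lemma Z_one: "1 \<in> Z"
  unfolding Z_def by simp

lemma Z_E: "z \<in> Z \<Longrightarrow> z \<in> E"
  by (induction rule: Z_induct) auto

lemma Z_commute:
  assumes "z \<in> Z" "g \<in> E"
  shows "z * g = g * z"
proof -
  have "g * z = z * g"
    using assms(1) unfolding Z_def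
    by (rule commute_gspan [rotated]) (use assms(2) sy_central in auto)
  then show ?thesis by simp
qed

lemma Z_central: "Z \<subseteq> central"
  using Z_commute Z_E by (auto simp: central_def)

definition sprod :: "('a \<times> 'a) list \<Rightarrow> 'g" where
  "sprod ps = prod_list (map (\<lambda>(a, b). sy a b) ps)"

lemma sprod_simps [simp]: "sprod [] = 1" "sprod ((a, b) # ps) = sy a b * sprod ps"
  by (simp_all add: sprod_def)

text \<open>A word that begins and ends with \<open>x j i\<close> is brought to begin and end with
  \<open>x i j\<close>. The torus factor is confined to \<open>K i j\<close>, so that the statement
  concerns one index pair only and can be reassembled from two corner rings.\<close>

definition rank_one :: bool where
  "rank_one \<longleftrightarrow> (\<forall>i j r s t. i \<in> D \<longrightarrow> j \<in> D \<longrightarrow> i \<noteq> j \<longrightarrow> r \<in> carrier R \<longrightarrow> s \<in> carrier R \<longrightarrow> t \<in> carrier R \<longrightarrow>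
    (\<exists>a b c k. a \<in> carrier R \<and> b \<in> carrier R \<and> c \<in> carrier R \<and> k \<in> K i j \<and>
      x j i r * x i j s * x j i t = x i j a * x j i b * k * x i j c))"

end

locale local_steinberg = steinberg_rep R d x
  for R :: "('a, 'b) ring_scheme" (structure) and d :: nat and x :: "nat \<Rightarrow> nat \<Rightarrow> 'a \<Rightarrow> 'g :: grp" +
  assumes unit_or_Jac: "b \<in> carrier R \<Longrightarrow> b \<in> Units R \<or> b \<in> Jac"
begin

lemma Jac_sub_one_unit:
  assumes "b \<in> Jac"
  shows "b \<ominus> \<one> \<in> Units R"
proof -
  note [simp] = Jac_carrier [OF assms]
  have "\<ominus> (\<one> \<ominus> b \<otimes> \<one>) \<in> Units R"
    using assms by (intro unit_minus Jac_unit) simp_all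
  then show ?thesis by (simp add: minus_eq minus_add a_comm)
qed

context
  fixes i j :: nat
  assumes ij: "i \<in> D" "j \<in> D" "i \<noteq> j"
  notes [simp] = ij ij(3) [symmetric]
begin

lemma ds_unit_Z: "a \<in> Jac \<Longrightarrow> b \<in> Units R \<Longrightarrow> ds i j a b \<in> Z"
  using ds_unit [OF ij, of a b] by (simp add: Jac_carrier Jac_unit Z_sy)

text \<open>For a unit \<open>b\<close> this is a single symbol. Otherwise \<open>b\<close> lies in
  the radical, so b - 1 is a unit, and \<open>ds_cocycle\<close> splits b = 1 + (b - 1) into two
  elements already known to be central.\<close>

lemma ds_Z:
  assumes a: "a \<in> Jac" and b: "b \<in> carrier R"
  shows "ds i j a b \<in> Z"
proof (cases "b \<in> Units R")
  case True
  then show ?thesis using a by (rule ds_unit_Z [rotated])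
next
  case False
  let ?v = "\<one> \<ominus> a \<otimes> \<one>" and ?c = "b \<ominus> \<one>"
  note [simp] = b Jac_carrier [OF a]
  have v: "?v \<in> Units R" using a by (intro Jac_unit) simp_all
  have a2: "inv ?v \<otimes> a \<in> Jac" using a v by (intro Jac_mult') simp_all
  have c: "?c \<in> Units R" using False b unit_or_Jac Jac_sub_one_unit by blast
  have b_eq: "b = \<one> \<oplus> ?c" using b by algebra
  have v': "\<one> \<ominus> inv ?v \<otimes> a \<otimes> ?c \<in> Units R"
    using a2 by (rule Jac_unit) simp
  have Z: "ds i j a \<one> \<in> Z" "ds i j (inv ?v \<otimes> a) ?c \<in> Z"
    using a a2 c by (simp_all add: ds_unit_Z)
  have "ds i j a (\<one> \<oplus> ?c) = ds i j a \<one> * ds i j (inv ?v \<otimes> a) ?c * sy ?v (\<one> \<ominus> inv ?v \<otimes> a \<otimes> ?c)"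
    using a Z Z_central by (intro ds_cocycle [OF ij]) auto
  also have "\<dots> \<in> Z" using Z v v' by (intro Z_mult Z_sy)
  finally show ?thesis using b_eq by simp
qed

lemma ds_E: "a \<in> Jac \<Longrightarrow> b \<in> carrier R \<Longrightarrow> ds i j a b \<in> E"
  by (rule Z_E [OF ds_Z])

text \<open>Conjugation by \<open>h i k y\<close> with a third index multiplies the argument of
  \<open>x i j\<close> by \<open>y\<close> and that of \<open>x j i\<close> by its inverse;
  \<open>h i j y\<close> itself would only give squares. The central element
  \<open>ds i j a b\<close> does not move, while \<open>h i j ?v\<close> picks up the symbol of
  \<open>y\<close> and \<open>?v\<close>.\<close>

lemma ds_scale:
  assumes a: "a \<in> Jac" and b: "b \<in> carrier R" and y: "y \<in> Units R"
  shows "ds i j (y \<otimes> a) (inv y \<otimes> b) = ds i j a b * sy y (\<one> \<ominus> a \<otimes> b)"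
proof -
  let ?v = "\<one> \<ominus> a \<otimes> b" and ?z = "ds i j a b"
  note [simp] = b y Jac_carrier [OF a]
  have v [simp]: "?v \<in> Units R" using a by (simp add: Jac_unit)
  have vv: "\<one> \<ominus> (y \<otimes> a) \<otimes> (inv y \<otimes> b) = ?v"
    by (simp add: m_ac unit_cancels)
  obtain k where k [simp]: "k \<in> D" "k \<noteq> i" "k \<noteq> j" by (rule third_index)
  note [simp] = k(2,3) [symmetric]
  let ?g = "h i k y"
  have z: "gconj ?g ?z = ?z"
    using Z_commute [OF ds_Z [OF a b], of ?g] by (simp add: gconj_eq_self_iff)
  have hh: "gconj ?g (h i j ?v) = sy y ?v * h i j ?v"
    by (simp add: conj_h_h h_mult grp_simps)
  show ?thesis
  proof (rule ds_eqI [OF ij])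
    have "x i j (\<ominus> (y \<otimes> a)) * x j i (inv y \<otimes> b) = gconj ?g (x i j (\<ominus> a) * x j i b)"
      by (simp add: gconj_mult conj_h weight_def r_minus)
    also have "x i j (\<ominus> a) * x j i b = x j i (inv ?v \<otimes> b) * (?z * h i j ?v) * x i j (\<ominus> (inv ?v \<otimes> a))"
      by (rule ds_rel [OF ij]) simp_all
    also have "gconj ?g \<dots> = x j i (inv y \<otimes> (inv ?v \<otimes> b)) * (?z * sy y ?v * h i j ?v) * x i j (\<ominus> (y \<otimes> (inv ?v \<otimes> a)))"
      by (simp add: gconj_mult conj_h weight_def r_minus z hh mult.assoc)
    finally show "x i j (\<ominus> (y \<otimes> a)) * x j i (inv y \<otimes> b)
        = x j i (inv (\<one> \<ominus> (y \<otimes> a) \<otimes> (inv y \<otimes> b)) \<otimes> (inv y \<otimes> b)) *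
          (?z * sy y ?v * h i j (\<one> \<ominus> (y \<otimes> a) \<otimes> (inv y \<otimes> b))) *
          x i j (\<ominus> (inv (\<one> \<ominus> (y \<otimes> a) \<otimes> (inv y \<otimes> b)) \<otimes> (y \<otimes> a)))"
      unfolding vv by (simp add: m_lcomm)
  qed (use v in \<open>simp_all add: vv\<close>)
qed

text \<open>\<open>ds_scale\<close> with the inverse of \<open>?v\<close> moves the factor 1 / v in
  \<open>ds_cocycle\<close> from the first argument to the second, and the symbol that this creates
  cancels the one in the cocycle.\<close>

lemma ds_add:
  assumes a: "a \<in> Jac" and b: "b \<in> carrier R" and c: "c \<in> carrier R"
  shows "ds i j a (b \<oplus> c) = ds i j a b * ds i j a (inv (\<one> \<ominus> a \<otimes> b) \<otimes> c)"
proof -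
  let ?v = "\<one> \<ominus> a \<otimes> b"
  let ?w = "\<one> \<ominus> a \<otimes> (inv ?v \<otimes> c)"
  note [simp] = b c Jac_carrier [OF a]
  have v [simp]: "?v \<in> Units R" using a by (simp add: Jac_unit)
  have w [simp]: "?w \<in> Units R" using a by (simp add: Jac_unit)
  have w': "\<one> \<ominus> inv ?v \<otimes> a \<otimes> c = ?w" by (simp add: m_ac)
  have a2: "inv ?v \<otimes> a \<in> Jac" using a by (intro Jac_mult') simp_all
  have "ds i j (inv ?v \<otimes> a) (inv (inv ?v) \<otimes> (inv ?v \<otimes> c)) = ds i j a (inv ?v \<otimes> c) * sy (inv ?v) ?w"
    by (rule ds_scale) (use a in simp_all)
  then have 1: "ds i j (inv ?v \<otimes> a) c = ds i j a (inv ?v \<otimes> c) * inverse (sy ?v ?w)"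
    by (simp add: sy_inv_left)
  have "ds i j a (b \<oplus> c) = ds i j a b * ds i j (inv ?v \<otimes> a) c * sy ?v ?w"
    by (rule ds_cocycle [OF ij]) (use a a2 ds_Z Z_central w' in auto)
  then show ?thesis unfolding 1 by (simp add: grp_simps)
qed

lemma ds_one: "a \<in> Jac \<Longrightarrow> ds i j a \<one> = 1"
  using ds_unit [OF ij, of a \<one>] Jac_unit [of a \<one>] by (simp add: Jac_carrier)

lemma ds_zero_left: "b \<in> carrier R \<Longrightarrow> ds i j \<zero> b = 1"
  by (simp add: ds_def minus_eq x_zero x_minus grp_simps)

lemma ds_zero_right: "a \<in> Jac \<Longrightarrow> ds i j a \<zero> = 1"
  by (simp add: ds_def minus_eq x_zero x_minus grp_simps Jac_carrier)

text \<open>Conjugation by \<open>w i j \<one>\<close> exchanges the two root subgroups; after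
  inversion the defining factorization becomes that of
  \<open>ds i j (\<ominus> b) (\<ominus> a)\<close>. The signs are removed by
  \<open>ds_scale\<close> with \<open>\<ominus> \<one>\<close>, and the symbols left over agree
  because {v, -v} = 1.\<close>

lemma ds_swap:
  assumes a: "a \<in> Jac" and b: "b \<in> Jac"
  shows "ds i j b a = inverse (ds i j a b)"
proof -
  let ?v = "\<one> \<ominus> a \<otimes> b" and ?z = "ds i j a b"
  note [simp] = Jac_carrier [OF a] Jac_carrier [OF b]
  have v [simp]: "?v \<in> Units R" using a by (simp add: Jac_unit)
  have vv: "\<one> \<ominus> \<ominus> b \<otimes> \<ominus> a = ?v" "\<one> \<ominus> b \<otimes> a = ?v"
    by (simp_all add: l_minus r_minus m_comm)
  let ?g = "w i j \<one>"
  have zE: "?z \<in> E" using a by (simp add: ds_E)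
  have z: "gconj ?g ?z = ?z"
    using Z_commute [OF ds_Z [OF a Jac_carrier [OF b]], of ?g] by (simp add: gconj_eq_self_iff)
  have gh: "gconj ?g (h i j ?v) = h i j (inv ?v)"
    by (simp add: h_def gconj_mult conj_w_w')
  have "h i j (inv ?v \<otimes> ?v) = sy (inv ?v) ?v * h i j ?v * h i j (inv ?v)"
    by (rule h_mult) simp_all
  then have hv: "inverse (h i j (inv ?v)) = sy (inv ?v) ?v * h i j ?v"
    by (metis Units_l_inv v h_one ij(1-3) grp_inverse_unique grp_inverse_inverse grp_right_cancel grp_left_inverse)
  have sv: "sy (\<ominus> \<one>) ?v = sy (inv ?v) ?v"
  proof -
    have "sy ?v (?v \<otimes> \<ominus> \<one>) = 1" using sy_minus_self [OF v] by (simp add: r_minus)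
    then have "inverse (sy ?v ?v) = sy ?v (\<ominus> \<one>)"
      by (subst (asm) sy_mult_right) (auto intro: grp_inverse_unique)
    then have "sy ?v ?v = sy (\<ominus> \<one>) ?v"
      by (metis grp_inverse_inverse inverse_sy v unit_minus(1) Units_one_closed)
    then show ?thesis using inverse_sy [of ?v ?v] by (simp add: sy_inv_left)
  qed
  have "ds i j (\<ominus> b) (\<ominus> a) = inverse ?z * sy (inv ?v) ?v"
  proof (rule ds_eqI [OF ij])
    have "x i j b * x j i (\<ominus> a) = inverse (gconj ?g (x i j (\<ominus> a) * x j i b))"
      using conj_w_ij' [OF ij, of \<one> "\<ominus> a"] conj_w_ji' [OF ij, of \<one> b]
      by (simp add: gconj_mult x_minus)
    also have "x i j (\<ominus> a) * x j i b = x j i (inv ?v \<otimes> b) * (?z * h i j ?v) * x i j (\<ominus> (inv ?v \<otimes> a))"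
      by (rule ds_rel [OF ij]) simp_all
    also have "gconj ?g \<dots> = x i j (\<ominus> (inv ?v \<otimes> b)) * (?z * h i j (inv ?v)) * x j i (inv ?v \<otimes> a)"
      using conj_w_ij' [OF ij, of \<one> "\<ominus> (inv ?v \<otimes> a)"] conj_w_ji' [OF ij, of \<one> "inv ?v \<otimes> b"]
      by (simp add: gconj_mult z gh)
    also have "inverse \<dots> = x j i (\<ominus> (inv ?v \<otimes> a)) * (inverse (h i j (inv ?v)) * inverse ?z) * x i j (inv ?v \<otimes> b)"
      by (simp add: x_minus mult.assoc)
    also have "inverse (h i j (inv ?v)) * inverse ?z = inverse ?z * sy (inv ?v) ?v * h i j ?v"
      unfolding hv using Z_commute [OF Z_inverse [OF ds_Z [of a b]], of "sy (inv ?v) ?v * h i j ?v"] a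
      by (simp add: mult.assoc)
    finally show "x i j (\<ominus> (\<ominus> b)) * x j i (\<ominus> a) = x j i (inv (\<one> \<ominus> \<ominus> b \<otimes> \<ominus> a) \<otimes> \<ominus> a) *
        (inverse ?z * sy (inv ?v) ?v * h i j (\<one> \<ominus> \<ominus> b \<otimes> \<ominus> a)) *
        x i j (\<ominus> (inv (\<one> \<ominus> \<ominus> b \<otimes> \<ominus> a) \<otimes> \<ominus> b))"
      unfolding vv by (simp add: r_minus)
  qed (use v in \<open>simp_all add: vv\<close>)
  moreover have "ds i j (\<ominus> \<one> \<otimes> b) (inv (\<ominus> \<one>) \<otimes> a) = ds i j b a * sy (\<ominus> \<one>) (\<one> \<ominus> b \<otimes> a)"
    by (rule ds_scale) (use b in simp_all)
  ultimately show ?thesis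
    by (simp add: vv sv l_minus)
qed

text \<open>For a unit \<open>c\<close> this is \<open>ds_scale\<close> with scalar
  \<open>c\<close>, whose symbol is the inverse of \<open>ds i j (a \<otimes> b) c\<close>. The
  remaining case reduces to this one by additivity in the second argument.\<close>

lemma ds_mult:
  assumes a: "a \<in> Jac" and b: "b \<in> Jac" and c: "c \<in> carrier R"
  shows "ds i j a (b \<otimes> c) = ds i j (a \<otimes> b) c * ds i j (a \<otimes> c) b"
proof -
  have unit: "ds i j a (b \<otimes> c) = ds i j (a \<otimes> b) c * ds i j (a \<otimes> c) b"
    if a: "a \<in> Jac" and b: "b \<in> Jac" and c: "c \<in> Units R" for a b c
  proof -
    note [simp] = Jac_carrier [OF a] Jac_carrier [OF b] c
    let ?v = "\<one> \<ominus> a \<otimes> (b \<otimes> c)"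
    have v [simp]: "?v \<in> Units R" using a by (simp add: Jac_unit)
    have "ds i j (c \<otimes> a) (inv c \<otimes> (b \<otimes> c)) = ds i j a (b \<otimes> c) * sy c ?v"
      by (rule ds_scale) (use a in simp_all)
    moreover have "inv c \<otimes> (b \<otimes> c) = b" by (simp add: m_ac)
    moreover have "ds i j (a \<otimes> b) c = inverse (sy c ?v)"
      using ds_unit [OF ij, of "a \<otimes> b" c] by (simp add: m_assoc inverse_sy)
    moreover have "sy c ?v * ds i j a (b \<otimes> c) = ds i j a (b \<otimes> c) * sy c ?v"
      using a by (intro sy_central ds_E) simp_all
    ultimately show ?thesis by (metis inverse_cancel_left m_comm Jac_carrier a Units_closed c)
  qed
  show ?thesis
  proof (cases "c \<in> Units R")
    case True
    then show ?thesis using a b unit by blast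
  next
    case False
    note [simp] = Jac_carrier [OF a] Jac_carrier [OF b] c
    let ?u = "\<one> \<ominus> a \<otimes> b"
    have u [simp]: "?u \<in> Units R" using a by (simp add: Jac_unit)
    \<comment> \<open>Chosen so that c = 1 + (1 - a b) e; the factor 1 - a b is just what
      \<open>ds_add\<close> divides out, both for the arguments \<open>a\<close>, \<open>b\<close>
      and for \<open>b\<close>, \<open>a\<close>. As \<open>c\<close> lies in the radical,
      \<open>e\<close> is a unit.\<close>
    define e where "e = inv ?u \<otimes> (c \<ominus> \<one>)"
    have e [simp]: "e \<in> Units R"
      unfolding e_def using False unit_or_Jac [OF c] Jac_sub_one_unit [of c] u by (auto simp del: u)
    have split: "y \<otimes> c = y \<oplus> ?u \<otimes> (y \<otimes> e)" "inv ?u \<otimes> (?u \<otimes> (y \<otimes> e)) = y \<otimes> e" if y: "y \<in> carrier R" for y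
    proof -
      have "?u \<otimes> (y \<otimes> e) = y \<otimes> (c \<ominus> \<one>)" unfolding e_def using y by (simp add: m_lcomm [of ?u y])
      then show "y \<otimes> c = y \<oplus> ?u \<otimes> (y \<otimes> e)" using y c by algebra
    qed (use y in simp)
    have ba: "\<one> \<ominus> b \<otimes> a = ?u" by (simp add: m_comm)
    have 1: "ds i j a (b \<otimes> c) = ds i j a b * ds i j a (b \<otimes> e)"
      unfolding split(1) [OF Jac_carrier [OF b]] using a by (subst ds_add) (simp_all add: split)
    have 2: "ds i j b (a \<otimes> c) = ds i j b a * ds i j b (a \<otimes> e)"
      unfolding split(1) [OF Jac_carrier [OF a]] using b by (subst ds_add) (simp_all add: split ba)
    have 3: "ds i j (a \<otimes> b) c = ds i j (a \<otimes> b) e"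
      using split [of \<one>] ds_add [of "a \<otimes> b" \<one> "?u \<otimes> e"] ds_one [of "a \<otimes> b"] a
      by (simp add: Jac_mult)
    have 4: "ds i j a (b \<otimes> e) = ds i j (a \<otimes> b) e * ds i j (a \<otimes> e) b"
      using a b by (intro unit) simp_all
    have 5: "ds i j (a \<otimes> y) b = inverse (ds i j b (a \<otimes> y))" if "y \<in> carrier R" for y
      using a b that by (intro ds_swap) (simp_all add: Jac_mult)
    have cm: "g * g' = g' * g" if "g \<in> Z" "g' \<in> Z" for g g'
      using Z_commute [OF that(1) Z_E [OF that(2)]] .
    have mem: "ds i j a b \<in> Z" "ds i j (a \<otimes> b) e \<in> Z" "ds i j b (a \<otimes> e) \<in> Z"
      using a b by (simp_all add: ds_Z Jac_mult)
    show ?thesis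
      using mem cm [of "ds i j a b" "ds i j (a \<otimes> b) e * inverse (ds i j b (a \<otimes> e))"]
      unfolding 1 3 4 5 [OF c] 5 [OF Units_closed [OF e]] 2 ds_swap [OF a b]
      by (simp add: Z_mult Z_inverse mult.assoc)
  qed
qed

lemma Z_K: "Z \<subseteq> K i j"
proof -
  have "sy u v \<in> K i j" if "u \<in> Units R" "v \<in> Units R" for u v
  proof -
    have "symb i j u v \<in> K i j" using that by (simp add: symb_def K_mult K_inverse K_h)
    then show ?thesis using symb_sy [OF ij that] by simp
  qed
  then show ?thesis unfolding Z_def K_def by (intro gspan_subset) blast
qed

text \<open>For a unit \<open>a\<close> the inverse of the product is handled by
  \<open>rank_one_unit\<close> with the indices exchanged; for \<open>a\<close> in the radical the
  central element \<open>ds i j a b\<close> joins the torus part.\<close>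

lemma swap_unipotents:
  assumes a: "a \<in> carrier R" and b: "b \<in> carrier R" and v: "\<one> \<ominus> a \<otimes> b \<in> Units R"
  shows "\<exists>b'\<in>carrier R. \<exists>k\<in>K i j. \<exists>a'\<in>carrier R. x i j (\<ominus> a) * x j i b = x j i b' * k * x i j a'"
proof (cases "a \<in> Units R")
  case True
  let ?v = "\<one> \<ominus> b \<otimes> a"
  have v' [simp]: "?v \<in> Units R" using v by (simp add: m_comm a b)
  have "x i j (\<ominus> a) * x j i b = inverse (x j i (\<ominus> b) * x i j a)"
    using a b by (simp add: x_minus)
  also have "x j i (\<ominus> b) * x i j a = x i j (inv ?v \<otimes> a) * (sy ?v a * h j i ?v) * x j i (\<ominus> (inv ?v \<otimes> b))"
    using True b by (intro rank_one_unit) simp_all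
  also have "inverse \<dots> = x j i (inv ?v \<otimes> b) * inverse (sy ?v a * h j i ?v) * x i j (\<ominus> (inv ?v \<otimes> a))"
    using True b by (simp add: x_minus mult.assoc)
  finally show ?thesis
    using True a b K_inverse [OF K_mult [of "sy ?v a" i j "h j i ?v"]] Z_K Z_sy [of ?v a] K_h [of ?v j i] K_swap [OF ij]
    by (intro bexI [of _ "inv ?v \<otimes> b"] bexI [of _ "inverse (sy ?v a * h j i ?v)"] bexI [of _ "\<ominus> (inv ?v \<otimes> a)"]) auto
next
  case False
  let ?v = "\<one> \<ominus> a \<otimes> b"
  have "a \<in> Jac" using False a unit_or_Jac by blast
  then have "ds i j a b * h i j ?v \<in> K i j"
    using ds_Z [of a b] Z_K b v by (intro K_mult K_h) auto
  then show ?thesis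
    using ds_rel [OF ij a b v] a b v
    by (intro bexI [of _ "inv ?v \<otimes> b"] bexI [of _ "ds i j a b * h i j ?v"] bexI [of _ "\<ominus> (inv ?v \<otimes> a)"]) auto
qed

end

text \<open>If 1 + s t is a unit, the last two factors can be swapped. Otherwise \<open>t\<close> is
  a unit and s + 1/t lies in the radical. Replacing \<open>x j i t\<close> by a Weyl word creates
  \<open>x i j\<close> at s + 1/t, which can be swapped with \<open>x j i r\<close>; the Weyl
  element is then expanded and its root elements are moved left across \<open>k\<close> as
  needed.\<close>

lemma rank_one_local: rank_one
  unfolding rank_one_def
proof (intro allI impI)
  fix i j r s t
  assume ij [simp]: "i \<in> D" "j \<in> D" "i \<noteq> j" and rst [simp]: "r \<in> carrier R" "s \<in> carrier R" "t \<in> carrier R"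
  note [simp] = ij(3) [symmetric]
  let ?v = "\<one> \<ominus> \<ominus> s \<otimes> t"
  show "\<exists>a b c k. a \<in> carrier R \<and> b \<in> carrier R \<and> c \<in> carrier R \<and> k \<in> K i j \<and>
      x j i r * x i j s * x j i t = x i j a * x j i b * k * x i j c"
  proof (cases "?v \<in> Units R")
    case True
    then obtain b k c where bkc: "b \<in> carrier R" "k \<in> K i j" "c \<in> carrier R"
      "x i j (\<ominus> (\<ominus> s)) * x j i t = x j i b * k * x i j c"
      using swap_unipotents [of i j "\<ominus> s" t] by auto
    then have "x j i r * x i j s * x j i t = x i j \<zero> * x j i (r \<oplus> b) * k * x i j c"
      by (simp add: x_zero mult.assoc x_add_left)
    then show ?thesis using bkc by (meson add.m_closed rst(1) zero_closed)
  next
    case False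
    then have vJ: "?v \<in> Jac" using unit_or_Jac [of ?v] by simp
    have t [simp]: "t \<in> Units R"
    proof (rule ccontr)
      assume "t \<notin> Units R"
      then have "t \<in> Jac" using unit_or_Jac [of t] by simp
      then have "?v \<in> Units R" using Jac_unit [of t "\<ominus> s"] by (simp add: m_comm)
      then show False using False by simp
    qed
    have s': "s \<oplus> inv t = ?v \<otimes> inv t"
    proof -
      have "?v \<otimes> inv t = inv t \<oplus> s \<otimes> (t \<otimes> inv t)"
        using Units_inv_closed [OF t] rst by algebra
      then show ?thesis by (simp add: a_comm)
    qed
    have s'J: "s \<oplus> inv t \<in> Jac" unfolding s' using vJ by (intro Jac_mult) simp_all
    then have "\<one> \<ominus> \<ominus> r \<otimes> (s \<oplus> inv t) \<in> Units R"
      using Jac_unit [of "s \<oplus> inv t" "\<ominus> r"] by (simp add: m_comm)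
    then obtain b k c where bkc: "b \<in> carrier R" "k \<in> K j i" "c \<in> carrier R"
      "x j i (\<ominus> (\<ominus> r)) * x i j (s \<oplus> inv t) = x i j b * k * x j i c"
      using swap_unipotents [of j i "\<ominus> r" "s \<oplus> inv t"] by auto
    have k: "k \<in> K i j" using bkc(2) K_swap [OF ij] by blast
    let ?u = "\<ominus> (inv t)" and ?c = "\<ominus> (inv t \<otimes> (inv t \<otimes> c)) \<oplus> inv t"
    have [simp]: "?c \<in> carrier R" using bkc(3) by simp
    have "gconj (w i j (inv t)) (x j i c) = x i j (\<ominus> (inv t \<otimes> (inv t \<otimes> c)))"
      using bkc by (intro conj_w_ji') simp_all
    then have cw: "x j i c * w i j ?u = w i j ?u * x i j (\<ominus> (inv t \<otimes> (inv t \<otimes> c)))"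
      by (metis gconj_inverse_gconj(1) grp_inverse_inverse mult_gconj t Units_inv_Units w_minus ij)
    have "x j i r * x i j s * x j i t = x j i r * x i j (s \<oplus> inv t) * w i j ?u * x i j (inv t)"
      by (simp add: x_ji_unit [of i j t] x_add x_add_left mult.assoc)
    also have "\<dots> = x i j b * k * (x j i c * w i j ?u) * x i j (inv t)"
      using bkc(4) by (simp add: mult.assoc)
    also have "\<dots> = x i j b * (k * x i j ?u) * x j i t * x i j ?u * x i j ?c"
      using bkc(3) unfolding cw by (simp add: w_def mult.assoc x_add x_add_left a_assoc)
    also obtain u' where u': "u' \<in> carrier R" "k * x i j ?u = x i j u' * k"
      using K_scale [OF ij, of i j k ?u] k by auto
    note u'(2)
    also have "x i j b * (x i j u' * k) * x j i t * x i j ?u * x i j ?c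
        = x i j (b \<oplus> u') * (k * x j i t) * x i j (?u \<oplus> ?c)"
      using bkc(1) u'(1) by (simp add: mult.assoc x_add x_add_left)
    also obtain t' where t': "t' \<in> carrier R" "k * x j i t = x j i t' * k"
      using K_scale [OF ij, of j i k t] k by auto
    note t'(2)
    finally have "x j i r * x i j s * x j i t = x i j (b \<oplus> u') * x j i t' * k * x i j (?u \<oplus> ?c)"
      by (simp add: mult.assoc)
    moreover have "?u \<oplus> ?c \<in> carrier R" using bkc(3) by simp
    ultimately show ?thesis using bkc(1) u'(1) t'(1) k by (meson add.m_closed)
  qed
qed

end

text \<open>The ideal generated by the list, defined as an iterated sum so that
  \<open>ds_add\<close> can split off one generator at a time.\<close>

primrec (in cring) lin :: "'a list \<Rightarrow> 'a set" where
  "lin [] = {\<zero>}"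
| "lin (t # ts) = {t \<otimes> s \<oplus> e | s e. s \<in> carrier R \<and> e \<in> lin ts}"

lemma (in cring) lin_scale:
  assumes "set ts \<subseteq> carrier R" "r \<in> carrier R" "e \<in> lin ts"
  shows "e \<in> carrier R \<and> r \<otimes> e \<in> lin ts"
  using assms(1,3)
proof (induction ts arbitrary: e)
  case (Cons t ts)
  then obtain s e' where e: "e = t \<otimes> s \<oplus> e'" "s \<in> carrier R" "e' \<in> lin ts" by auto
  then have e': "e' \<in> carrier R" "r \<otimes> e' \<in> lin ts" using Cons by simp_all
  have "r \<otimes> e = t \<otimes> (r \<otimes> s) \<oplus> r \<otimes> e'"
    using e e' Cons.prems(1) assms(2) by (simp add: r_distr m_ac)
  moreover have "e \<in> carrier R" using e e' Cons.prems(1) by simp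
  ultimately show ?case using e e' assms(2) by auto
qed (use assms(2) in auto)

section \<open>Products with one symbol for each generator of the radical\<close>

context local_steinberg
begin

text \<open>One factor for each entry of the list and a last factor {g, v}. For entries in the
  radical this is a group, because each single family is a group, by \<open>ds_add\<close> or by
  bimultiplicativity, and all the elements are central.\<close>

primrec symbol_group :: "'a \<Rightarrow> 'a list \<Rightarrow> 'g set" where
  "symbol_group g [] = {sy g v | v. v \<in> Units R}"
| "symbol_group g (t # ts) = {ds 1 2 t r * z | r z. r \<in> carrier R \<and> z \<in> symbol_group g ts}"

context
  fixes g :: 'a
  assumes g [simp]: "g \<in> Units R"
begin

lemma symbol_group_ConsI: "r \<in> carrier R \<Longrightarrow> z \<in> symbol_group g ts \<Longrightarrow> ds 1 2 t r * z \<in> symbol_group g (t # ts)"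
  by auto

lemma symbol_group_Z: "set ts \<subseteq> Jac \<Longrightarrow> symbol_group g ts \<subseteq> Z"
  by (induction ts) (auto simp: Z_sy intro!: Z_mult ds_Z)

lemma symbol_group_sy: "set ts \<subseteq> Jac \<Longrightarrow> v \<in> Units R \<Longrightarrow> sy g v \<in> symbol_group g ts"
proof (induction ts)
  case (Cons t ts)
  then have "ds 1 2 t \<zero> = 1" by (intro ds_zero_right) auto
  then show ?case using Cons symbol_group_ConsI [of \<zero> "sy g v" ts t] by simp
qed auto

lemma symbol_group_one: "set ts \<subseteq> Jac \<Longrightarrow> 1 \<in> symbol_group g ts"
  using symbol_group_sy [of ts \<one>] by simp

lemma symbol_group_mult: "set ts \<subseteq> Jac \<Longrightarrow> y \<in> symbol_group g ts \<Longrightarrow> z \<in> symbol_group g ts \<Longrightarrow> y * z \<in> symbol_group g ts"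
proof (induction ts arbitrary: y z)
  case Nil
  then obtain u v where "y = sy g u" "z = sy g v" "u \<in> Units R" "v \<in> Units R" by auto
  then have "y * z = sy g (u \<otimes> v)" "u \<otimes> v \<in> Units R" by (simp_all add: sy_mult_right)
  then show ?case by auto
next
  case (Cons t ts)
  then obtain r y' s z' where yz: "y = ds 1 2 t r * y'" "r \<in> carrier R" "y' \<in> symbol_group g ts"
    "z = ds 1 2 t s * z'" "s \<in> carrier R" "z' \<in> symbol_group g ts" by auto
  have t: "t \<in> Jac" and [simp]: "t \<in> carrier R" using Cons.prems Jac_carrier by auto
  let ?v = "\<one> \<ominus> t \<otimes> r"
  have v: "?v \<in> Units R" using t yz by (simp add: Jac_unit)
  have "y' \<in> Z" "ds 1 2 t s \<in> E"
    using yz symbol_group_Z [of ts] Cons.prems t by (auto simp: ds_E)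
  then have c: "y' * ds 1 2 t s = ds 1 2 t s * y'" by (rule Z_commute)
  have "y * z = ds 1 2 t r * (y' * ds 1 2 t s) * z'"
    using yz by (simp add: mult.assoc)
  also have "\<dots> = ds 1 2 t r * ds 1 2 t s * (y' * z')"
    unfolding c by (simp add: mult.assoc)
  also have "ds 1 2 t r * ds 1 2 t s = ds 1 2 t (r \<oplus> ?v \<otimes> s)"
    using ds_add [of 1 2 t r "?v \<otimes> s"] t yz v by simp
  finally show ?case
    using Cons yz v symbol_group_ConsI [of "r \<oplus> ?v \<otimes> s" "y' * z'" ts t] by simp
qed

lemma symbol_group_inverse: "set ts \<subseteq> Jac \<Longrightarrow> y \<in> symbol_group g ts \<Longrightarrow> inverse y \<in> symbol_group g ts"
proof (induction ts arbitrary: y)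
  case Nil
  then obtain u where "y = sy g u" "u \<in> Units R" by auto
  then have "inverse y = sy g (inv u)" "inv u \<in> Units R" by (simp_all add: sy_inv_right)
  then show ?case by auto
next
  case (Cons t ts)
  then obtain r y' where y: "y = ds 1 2 t r * y'" "r \<in> carrier R" "y' \<in> symbol_group g ts" by auto
  have t: "t \<in> Jac" and [simp]: "t \<in> carrier R" using Cons.prems Jac_carrier by auto
  let ?v = "\<one> \<ominus> t \<otimes> r"
  have v: "?v \<in> Units R" using t y by (simp add: Jac_unit)
  have "ds 1 2 t (r \<oplus> \<ominus> r) = ds 1 2 t r * ds 1 2 t (inv ?v \<otimes> \<ominus> r)"
    using t y by (intro ds_add) simp_all
  then have "ds 1 2 t r * ds 1 2 t (inv ?v \<otimes> \<ominus> r) = 1"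
    using y t by (simp add: r_neg ds_zero_right)
  then have "inverse (ds 1 2 t r) = ds 1 2 t (inv ?v \<otimes> \<ominus> r)"
    by (rule grp_inverse_unique)
  moreover have "inverse y' \<in> Z" "inverse (ds 1 2 t r) \<in> E"
    using y symbol_group_Z [of ts] Cons.prems t by (auto simp: ds_E Z_inverse)
  then have "inverse y' * inverse (ds 1 2 t r) = inverse (ds 1 2 t r) * inverse y'" by (rule Z_commute)
  then have "inverse y = inverse (ds 1 2 t r) * inverse y'" using y by simp
  ultimately show ?case
    using Cons y v symbol_group_ConsI [of "inv ?v \<otimes> \<ominus> r" "inverse y'" ts t] by simp
qed

lemma symbol_group_ds: "set ts \<subseteq> Jac \<Longrightarrow> t \<in> set ts \<Longrightarrow> r \<in> carrier R \<Longrightarrow> ds 1 2 t r \<in> symbol_group g ts"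
proof (induction ts)
  case (Cons s ts)
  show ?case
  proof (cases "t = s")
    case True
    have "ds 1 2 s r * 1 \<in> symbol_group g (s # ts)" using Cons.prems by (intro symbol_group_ConsI symbol_group_one) simp_all
    then show ?thesis using True by simp
  next
    case False
    then have "ds 1 2 t r \<in> symbol_group g ts" using Cons by simp
    moreover have "ds 1 2 s \<zero> = 1" using Cons.prems by (intro ds_zero_right) auto
    ultimately show ?thesis using symbol_group_ConsI [of \<zero> "ds 1 2 t r" ts s] by simp
  qed
qed simp

lemma symbol_group_sy_pow:
  assumes "set ts \<subseteq> Jac" "v \<in> Units R"
  shows "sy v (g [^] (n :: nat)) \<in> symbol_group g ts"
proof -
  have "sy (g [^] n) v \<in> symbol_group g ts"
  proof (induction n)
    case 0
    then show ?case using assms by (simp add: symbol_group_one)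
  next
    case (Suc n)
    then show ?case using assms
      by (simp add: sy_mult_left Units_pow_closed symbol_group_mult symbol_group_sy)
  qed
  then show ?thesis
    using assms symbol_group_inverse [of ts "sy (g [^] n) v"] by (simp add: inverse_sy Units_pow_closed)
qed

text \<open>A factor \<open>ds 1 2 t r\<close> with nonunit \<open>r\<close> is still one symbol:
  since \<open>ds 1 2 t \<one>\<close> is trivial, \<open>r\<close> may be replaced by 1 + (1 - t)
  r, which is a unit because \<open>r\<close> lies in the radical.\<close>

lemma symbol_group_symbols:
  assumes "set ts \<subseteq> Jac" "z \<in> symbol_group g ts"
  shows "\<exists>ps. length ps = Suc (length ts) \<and> set ps \<subseteq> Units R \<times> Units R
    \<and> z = sprod ps"
  using assms
proof (induction ts arbitrary: z)
  case Nil
  then obtain v where "z = sy g v" "v \<in> Units R" by auto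
  then show ?case by (intro exI [of _ "[(g, v)]"]) simp
next
  case (Cons t ts)
  then obtain r z' where z: "z = ds 1 2 t r * z'" "r \<in> carrier R" "z' \<in> symbol_group g ts" by auto
  then obtain ps where ps: "length ps = Suc (length ts)" "set ps \<subseteq> Units R \<times> Units R"
    "z' = sprod ps"
    using Cons by auto
  have t: "t \<in> Jac" and [simp]: "t \<in> carrier R" using Cons.prems Jac_carrier by auto
  obtain s where s: "s \<in> Units R" "ds 1 2 t r = ds 1 2 t s"
  proof (cases "r \<in> Units R")
    case False
    then have r: "r \<in> Jac" using z unit_or_Jac by blast
    let ?v = "\<one> \<ominus> t \<otimes> \<one>"
    have v: "?v \<in> Units R" using t by (intro Jac_unit) simp_all
    have "ds 1 2 t (\<one> \<oplus> ?v \<otimes> r) = ds 1 2 t \<one> * ds 1 2 t (inv ?v \<otimes> (?v \<otimes> r))"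
      using t v z by (intro ds_add) simp_all
    then have "ds 1 2 t r = ds 1 2 t (\<one> \<oplus> ?v \<otimes> r)"
      using t v z by (simp add: ds_one)
    moreover have "\<one> \<oplus> ?v \<otimes> r \<in> Units R"
      using Jac_unit' [OF r, of ?v] r z by (simp add: m_comm)
    ultimately show ?thesis using that by blast
  qed (use that in blast)
  have v: "\<one> \<ominus> t \<otimes> s \<in> Units R" using t s by (simp add: Jac_unit)
  have "ds 1 2 t r = sy (\<one> \<ominus> t \<otimes> s) s"
    unfolding s(2) using s v by (intro ds_unit) simp_all
  then show ?case
    using z ps s v by (intro exI [of _ "(\<one> \<ominus> t \<otimes> s, s) # ps"]) simp
qed

context
  fixes ts :: "'a list"
  assumes fin: "finite (carrier R)"
    and ts: "set ts \<subseteq> Jac" and Jac_lin: "Jac \<subseteq> lin ts"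
    and cyclic: "\<And>b. b \<in> carrier R \<Longrightarrow> b \<notin> Jac \<Longrightarrow> \<exists>n :: nat. \<exists>e\<in>Jac. b = g [^] n \<oplus> e"
begin

text \<open>Induction on the size of the ideal \<open>a R\<close>: multiplying \<open>a\<close> by an element of the radical
  makes it smaller.\<close>

lemma ds_symbol_group: "a \<in> Jac \<Longrightarrow> b \<in> carrier R \<Longrightarrow> ds 1 2 a b \<in> symbol_group g ts"
proof (induction "card ((\<lambda>r. a \<otimes> r) ` carrier R)" arbitrary: a b rule: less_induct)
  case less
  note a = less.prems(1)
  note [simp] = Jac_carrier [OF a]
  show ?case
  proof (cases "a = \<zero>")
    case True
    then show ?thesis using less.prems ts by (simp add: ds_zero_left symbol_group_one)
  next
    case False
    \<comment> \<open>The inclusion of ideals is strict, since a = a t r would give a (1 - t r) = 0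
      and hence a = 0.\<close>
    have smaller: "ds 1 2 (a \<otimes> t) s \<in> symbol_group g ts" if t: "t \<in> Jac" and s: "s \<in> carrier R" for t s
    proof (rule less.hyps [OF _ Jac_mult [OF a Jac_carrier [OF t]] s])
      note [simp] = Jac_carrier [OF t]
      have "(\<lambda>r. a \<otimes> t \<otimes> r) ` carrier R \<subseteq> (\<lambda>r. a \<otimes> r) ` carrier R"
      proof
        fix y assume "y \<in> (\<lambda>r. a \<otimes> t \<otimes> r) ` carrier R"
        then obtain r where "r \<in> carrier R" "y = a \<otimes> (t \<otimes> r)" by (auto simp: m_assoc)
        then show "y \<in> (\<lambda>r. a \<otimes> r) ` carrier R" by simp
      qed
      moreover have "a \<notin> (\<lambda>r. a \<otimes> t \<otimes> r) ` carrier R"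
      proof
        assume "a \<in> (\<lambda>r. a \<otimes> t \<otimes> r) ` carrier R"
        then obtain r where r: "r \<in> carrier R" "a = a \<otimes> t \<otimes> r" by blast
        have u: "\<one> \<ominus> t \<otimes> r \<in> Units R" using t r by (intro Jac_unit)
        have "a \<otimes> (\<one> \<ominus> t \<otimes> r) = a \<ominus> a \<otimes> t \<otimes> r"
          using r(1) Jac_carrier [OF a] Jac_carrier [OF t] by algebra
        also have "\<dots> = \<zero>" using r by (simp flip: r(2))
        finally have "a \<otimes> (\<one> \<ominus> t \<otimes> r) \<otimes> inv (\<one> \<ominus> t \<otimes> r) = \<zero>" using u by simp
        then show False using u False by (simp add: m_assoc)
      qed
      moreover have "a \<in> (\<lambda>r. a \<otimes> r) ` carrier R" by (rule image_eqI [of _ _ \<one>]) simp_all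
      ultimately show "card ((\<lambda>r. a \<otimes> t \<otimes> r) ` carrier R) < card ((\<lambda>r. a \<otimes> r) ` carrier R)"
        using fin by (intro psubset_card_mono) auto
    qed
    \<comment> \<open>The generators occurring in \<open>e\<close> are stripped one by one. In the
      product rule the factor \<open>ds 1 2 (a \<otimes> t) s\<close> is covered by the induction on
      the ideal, while \<open>ds 1 2 (a \<otimes> s) t\<close> is, after a swap, the inverse of an
      element with first argument \<open>t\<close>.\<close>
    have lin: "ds 1 2 a e \<in> symbol_group g ts" if "set us \<subseteq> set ts" "e \<in> lin us" for us e
      using that
    proof (induction us arbitrary: e)
      case Nil
      then show ?case using a ts by (simp add: ds_zero_right symbol_group_one)
    next
      case (Cons t us)
      then obtain s e' where e: "e = t \<otimes> s \<oplus> e'" "s \<in> carrier R" "e' \<in> lin us" by auto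
      have t: "t \<in> Jac" "t \<in> set ts" and [simp]: "t \<in> carrier R" using Cons.prems ts Jac_carrier by auto
      let ?v = "\<one> \<ominus> a \<otimes> (t \<otimes> s)"
      have v: "?v \<in> Units R" using a e by (simp add: Jac_unit)
      have us: "set us \<subseteq> carrier R" using Cons.prems ts Jac_carrier by auto
      have e': "e' \<in> carrier R" "inv ?v \<otimes> e' \<in> lin us"
        using lin_scale [OF us _ e(3), of "inv ?v"] v by simp_all
      have "ds 1 2 a e = ds 1 2 a (t \<otimes> s) * ds 1 2 a (inv ?v \<otimes> e')"
        unfolding e(1) using a e e' by (intro ds_add) simp_all
      also have "ds 1 2 a (t \<otimes> s) = ds 1 2 (a \<otimes> t) s * ds 1 2 (a \<otimes> s) t"
        using a t e by (intro ds_mult) simp_all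
      also have "ds 1 2 (a \<otimes> s) t = inverse (ds 1 2 t (a \<otimes> s))"
        using a t e by (intro ds_swap) (simp_all add: Jac_mult)
      finally show ?case
        using smaller [OF t(1) e(2)] Cons.IH [OF _ e'(2)] Cons.prems ts t e
        by (simp add: symbol_group_mult symbol_group_inverse symbol_group_ds)
    qed
    then have J: "ds 1 2 a e \<in> symbol_group g ts" if "e \<in> Jac" for e
      using that Jac_lin by blast
    show ?thesis
    proof (cases "b \<in> Jac")
      case False
      then obtain n :: nat and e where b: "b = g [^] n \<oplus> e" "e \<in> Jac"
        using cyclic less.prems by blast
      let ?v = "\<one> \<ominus> a \<otimes> g [^] n"
      have gn [simp]: "g [^] n \<in> Units R" by (simp add: Units_pow_closed)
      have v: "?v \<in> Units R" using a by (intro Jac_unit) simp_all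
      have "ds 1 2 a b = ds 1 2 a (g [^] n) * ds 1 2 a (inv ?v \<otimes> e)"
        unfolding b(1) using a Jac_carrier [OF b(2)] by (intro ds_add) simp_all
      also have "ds 1 2 a (g [^] n) = sy ?v (g [^] n)"
        using v by (intro ds_unit) simp_all
      finally show ?thesis
        using v b ts J [of "inv ?v \<otimes> e"] by (simp add: symbol_group_mult symbol_group_sy_pow Jac_mult')
    qed (rule J)
  qed
qed

lemma Z_symbol_group: "z \<in> Z \<Longrightarrow> z \<in> symbol_group g ts"
proof -
  \<comment> \<open>The symbol {1 + e, v} is the Dennis-Stein element with arguments - e / v and
    \<open>v\<close>, since 1 - (- e / v) v = 1 + e.\<close>
  have 1: "sy (\<one> \<oplus> e) v \<in> symbol_group g ts" if e: "e \<in> Jac" and v: "v \<in> Units R" for e v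
  proof -
    have [simp]: "e \<in> carrier R" using e Jac_carrier by blast
    have eq: "\<one> \<ominus> \<ominus> (e \<otimes> inv v) \<otimes> v = \<one> \<oplus> e"
      using v by (simp add: l_minus minus_eq m_assoc)
    have "e \<otimes> (inv v \<otimes> \<ominus> \<one>) \<in> Jac" using e v by (intro Jac_mult) simp_all
    then have J: "\<ominus> (e \<otimes> inv v) \<in> Jac" using v by (simp add: r_minus)
    then have "ds 1 2 (\<ominus> (e \<otimes> inv v)) v = sy (\<one> \<oplus> e) v"
      using ds_unit [of 1 2 "\<ominus> (e \<otimes> inv v)" v] Jac_unit [OF J, of v] v by (simp add: eq)
    then show ?thesis using ds_symbol_group [OF J, of v] v by simp
  qed
  have sy: "sy u v \<in> symbol_group g ts" if u: "u \<in> Units R" and v: "v \<in> Units R" for u v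
  proof (cases "u \<in> Jac")
    \<comment> \<open>A unit in the radical makes the radical the whole ring; in particular u - 1
      lies in it.\<close>
    case True
    have "u \<oplus> \<ominus> \<one> \<in> Jac"
      using Jac_mult [OF True, of "\<one> \<oplus> \<ominus> (inv u)"] u by (simp add: r_distr r_minus)
    from 1 [OF this v] show ?thesis using u by (simp add: a_lcomm r_neg)
  next
    case False
    then obtain n :: nat and e where b: "u = g [^] n \<oplus> e" "e \<in> Jac"
      using cyclic u by blast
    have gn [simp]: "g [^] n \<in> Units R" by (simp add: Units_pow_closed)
    let ?f = "inv (g [^] n) \<otimes> e"
    have f: "?f \<in> Jac" using b by (simp add: Jac_mult')
    have f1: "\<one> \<oplus> ?f \<in> Units R" using Jac_unit' [OF f, of \<one>] Jac_carrier [OF f] by simp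
    have "u = g [^] n \<otimes> (\<one> \<oplus> ?f)"
      using b Jac_carrier [OF b(2)] by (simp add: r_distr)
    then have "sy u v = sy (g [^] n) v * sy (\<one> \<oplus> ?f) v"
      using f1 v by (simp add: sy_mult_left)
    moreover have "sy (g [^] n) v = inverse (sy v (g [^] n))" using v by (simp add: inverse_sy)
    ultimately show ?thesis
      using 1 [OF f v] ts v by (simp add: symbol_group_mult symbol_group_inverse symbol_group_sy_pow)
  qed
  assume "z \<in> Z"
  then show ?thesis
    by (induction rule: Z_induct) (use sy ts in \<open>auto simp: symbol_group_one intro: symbol_group_mult\<close>)
qed

lemma Z_symbols_local:
  "z \<in> Z \<Longrightarrow> \<exists>ps. length ps = Suc (length ts) \<and> set ps \<subseteq> Units R \<times> Units R
    \<and> z = sprod ps"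
  using symbol_group_symbols [OF ts Z_symbol_group] by blast

end

end

end

section \<open>Finite local rings\<close>

text \<open>A sequence with finitely many values, in which equal values stay equal under shifts, is
  periodic from some index \<open>i\<close> on. A positive multiple \<open>l\<close> of the period
  that is at least \<open>i\<close> has the required property. It serves for powers of an element
  and for iterates of Frobenius.\<close>

lemma idempotent_index:
  fixes f :: "nat \<Rightarrow> 'b"
  assumes fin: "finite (range f)" and shift: "\<And>i j c. f i = f j \<Longrightarrow> f (i + c) = f (j + c)"
  obtains l where "0 < l" "f (2 * l) = f l"
proof -
  have "\<not> inj f" using fin finite_imageD by blast
  then obtain i j where ij: "i < j" "f i = f j"
    by (metis injI linorder_neqE_nat)
  define p where "p = j - i"
  have p: "0 < p" "f (i + p + c) = f (i + c)" for c
    using ij shift [of j i c] by (simp_all add: p_def)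
  have per: "f (n + q * p) = f n" if "i \<le> n" for n q
  proof (induction q)
    case (Suc q)
    have "n + Suc q * p = i + p + (n - i + q * p)" "n + q * p = i + (n - i + q * p)"
      using that by simp_all
    then show ?case by (metis p(2) Suc.IH)
  qed simp
  have "i \<le> Suc i * p" using p(1) by (cases p) auto
  from per [OF this, of "Suc i"] have "f (2 * (Suc i * p)) = f (Suc i * p)" by (simp only: mult_2)
  moreover have "0 < Suc i * p" using p(1) by simp
  ultimately show ?thesis using that by blast
qed

context cring
begin

lemma finite_idempotent_power:
  assumes fin: "finite (carrier R)" and a: "a \<in> carrier R"
  obtains n :: nat where "0 < n" "(a [^] n) \<otimes> (a [^] n) = a [^] n"
proof -
  have "finite (range (\<lambda>n :: nat. a [^] n))"
    using a by (intro finite_subset [OF _ fin]) auto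
  moreover have "a [^] (i + c) = a [^] (j + c)" if "a [^] i = a [^] j" for i j c :: nat
    using a that by (simp flip: nat_pow_mult)
  ultimately obtain n :: nat where "0 < n" "a [^] (2 * n) = a [^] n"
    by (rule idempotent_index)
  then show ?thesis using that a by (simp add: nat_pow_mult mult_2)
qed

lemma finite_unitI:
  assumes fin: "finite (carrier R)" and u: "u \<in> carrier R"
    and inj: "\<And>r. r \<in> carrier R \<Longrightarrow> u \<otimes> r = \<zero> \<Longrightarrow> r = \<zero>"
  shows "u \<in> Units R"
proof -
  have "inj_on (\<lambda>r. u \<otimes> r) (carrier R)"
  proof (rule inj_onI)
    fix r s assume rs: "r \<in> carrier R" "s \<in> carrier R" "u \<otimes> r = u \<otimes> s"
    then have "u \<otimes> (r \<ominus> s) = \<zero>" using u by (simp add: minus_eq r_distr r_minus r_neg)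
    then have "r \<ominus> s = \<zero>" using rs inj by simp
    then show "r = s" using rs by simp
  qed
  moreover have "(\<lambda>r. u \<otimes> r) ` carrier R \<subseteq> carrier R" using u by auto
  ultimately have "(\<lambda>r. u \<otimes> r) ` carrier R = carrier R"
    using fin by (metis endo_inj_surj)
  then obtain r where "r \<in> carrier R" "u \<otimes> r = \<one>" by (metis imageE one_closed)
  then show ?thesis using u by (auto simp: Units_def m_comm)
qed

lemma unit_powD:
  assumes "a \<in> carrier R" "0 < n" "a [^] (n :: nat) \<in> Units R"
  shows "a \<in> Units R"
proof -
  have "a [^] n = a \<otimes> a [^] (n - 1)"
    using assms(1,2) nat_pow_Suc2 [of a "n - 1"] by simp
  then show ?thesis using assms unit_factor [of a "a [^] (n - 1)"] by simp
qed

text \<open>Some power of \<open>a\<close> is idempotent. If it is 1, then \<open>a\<close> is a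
  unit. If it is 0, then \<open>a\<close> is nilpotent, an equation r = a b r forces r = 0, and in a
  finite ring this makes 1 - a b a unit.\<close>

lemma finite_unit_or_Jac:
  assumes fin: "finite (carrier R)"
    and idem: "\<And>e. e \<in> carrier R \<Longrightarrow> e \<otimes> e = e \<Longrightarrow> e = \<zero> \<or> e = \<one>"
    and a: "a \<in> carrier R"
  shows "a \<in> Units R \<or> a \<in> Jac"
proof -
  obtain n :: nat where n: "0 < n" "(a [^] n) \<otimes> (a [^] n) = a [^] n"
    using finite_idempotent_power [OF fin a] .
  from idem [OF _ n(2)] a consider "a [^] n = \<one>" | "a [^] n = \<zero>" by auto
  then show ?thesis
  proof cases
    case 1
    then show ?thesis using unit_powD [OF a n(1)] by simp
  next
    case 2
    have "\<one> \<ominus> a \<otimes> b \<in> Units R" if b: "b \<in> carrier R" for b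
    proof (rule finite_unitI [OF fin])
      fix r assume r: "r \<in> carrier R" "(\<one> \<ominus> a \<otimes> b) \<otimes> r = \<zero>"
      have "r = (\<one> \<ominus> a \<otimes> b) \<otimes> r \<oplus> a \<otimes> b \<otimes> r" using a b r(1) by algebra
      then have ab: "r = a \<otimes> b \<otimes> r" using a b r by simp
      have "r = (a \<otimes> b) [^] m \<otimes> r" for m :: nat
      proof (induction m)
        case (Suc m)
        have "(a \<otimes> b) [^] Suc m \<otimes> r = (a \<otimes> b) [^] m \<otimes> (a \<otimes> b \<otimes> r)"
          using a b r(1) by (simp add: m_assoc)
        then show ?case using Suc ab by simp
      qed (use r in simp)
      from this [of n] show "r = \<zero>" using 2 a b r by (simp add: nat_pow_distrib)
    qed (use a b in simp)
    then show ?thesis using a by (simp add: Jac_def)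
  qed
qed

section \<open>Ideals given by a list of generators\<close>

lemma lin_closed: "set ts \<subseteq> carrier R \<Longrightarrow> e \<in> lin ts \<Longrightarrow> e \<in> carrier R"
  using lin_scale [of ts \<one> e] by simp

lemma lin_zero: "set ts \<subseteq> carrier R \<Longrightarrow> \<zero> \<in> lin ts"
proof (induction ts)
  case (Cons t ts)
  then have "\<zero> = t \<otimes> \<zero> \<oplus> \<zero>" "\<zero> \<in> lin ts" by simp_all
  then show ?case by (simp, blast)
qed simp

lemma lin_add: "set ts \<subseteq> carrier R \<Longrightarrow> e \<in> lin ts \<Longrightarrow> f \<in> lin ts \<Longrightarrow> e \<oplus> f \<in> lin ts"
proof (induction ts arbitrary: e f)
  case (Cons t ts)
  then obtain s e' r f' where ef: "e = t \<otimes> s \<oplus> e'" "s \<in> carrier R" "e' \<in> lin ts"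
    "f = t \<otimes> r \<oplus> f'" "r \<in> carrier R" "f' \<in> lin ts" by auto
  have c: "t \<in> carrier R" "e' \<in> carrier R" "f' \<in> carrier R"
    using Cons.prems(1) ef lin_closed [of ts] by simp_all
  have "e \<oplus> f = t \<otimes> (s \<oplus> r) \<oplus> (e' \<oplus> f')" unfolding ef using c ef(2,5) by algebra
  moreover have "e' \<oplus> f' \<in> lin ts" using Cons ef by simp
  ultimately show ?case using ef by auto
qed simp

lemma lin_minus: "set ts \<subseteq> carrier R \<Longrightarrow> e \<in> lin ts \<Longrightarrow> \<ominus> e \<in> lin ts"
  using lin_scale [of ts "\<ominus> \<one>" e] lin_closed [of ts e] by (simp add: l_minus)

lemma lin_member:
  assumes "set ts \<subseteq> carrier R" "t \<in> set ts" "s \<in> carrier R"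
  shows "t \<otimes> s \<in> lin ts"
  using assms(1,2)
proof (induction ts)
  case (Cons u ts)
  show ?case
  proof (cases "t = u")
    case True
    have "t \<otimes> s = u \<otimes> s \<oplus> \<zero>" using True Cons.prems(1) assms(3) by simp
    then show ?thesis using lin_zero [of ts] Cons.prems(1) assms(3)
      unfolding lin.simps mem_Collect_eq by (metis insert_subset list.simps(15))
  next
    case False
    then have "t \<otimes> s \<in> lin ts" using Cons by simp
    moreover from this have "t \<otimes> s = u \<otimes> \<zero> \<oplus> t \<otimes> s" using Cons.prems(1) lin_closed [of ts "t \<otimes> s"] by simp
    ultimately show ?thesis by auto
  qed
qed simp

lemma lin_Jac: "set ts \<subseteq> Jac \<Longrightarrow> e \<in> lin ts \<Longrightarrow> e \<in> Jac"
  by (induction ts arbitrary: e) (auto simp: Jac_zero Jac_add Jac_mult)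

lemma unit_not_Jac:
  assumes "\<one> \<noteq> \<zero>" "u \<in> Units R"
  shows "u \<notin> Jac"
proof
  assume "u \<in> Jac"
  then have "\<one> \<ominus> u \<otimes> inv u \<in> Units R" using assms by (intro Jac_unit) simp_all
  then have "\<zero> \<in> Units R" using assms by (simp add: minus_eq r_neg)
  then have "\<zero> \<otimes> inv \<zero> = \<one>" by (rule Units_r_inv)
  then show False using assms(1) Units_inv_closed [OF \<open>\<zero> \<in> Units R\<close>] by simp
qed

section \<open>Frobenius in a ring where \<open>p\<close> need not vanish\<close>

lemma binomial:
  assumes a: "a \<in> carrier R" and b: "b \<in> carrier R"
  shows "(a \<oplus> b) [^] n = (\<Oplus>k\<in>{..n}. [(n choose k)] \<cdot> (a [^] k \<otimes> b [^] (n - k)))"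
proof (induction n)
  case (Suc n)
  let ?f = "\<lambda>n k. [(n choose k)] \<cdot> (a [^] k \<otimes> b [^] (n - k))"
  let ?g = "\<lambda>k. [(n choose k)] \<cdot> (a [^] k \<otimes> b [^] (Suc n - k))"
  have [simp]: "?f n k \<in> carrier R" for n k using a b by simp
  have [simp]: "?g k \<in> carrier R" for k using a b by simp
  have A: "(\<Oplus>k\<in>{..n}. ?f n k) \<otimes> a = (\<Oplus>k\<in>{..n}. [(n choose k)] \<cdot> (a [^] Suc k \<otimes> b [^] (n - k)))"
  proof -
    have "?f n k \<otimes> a = [(n choose k)] \<cdot> (a [^] Suc k \<otimes> b [^] (n - k))" for k
      using a b by (subst add_pow_ldistr) (simp_all add: m_ac)
    then show ?thesis using a b by (simp add: finsum_ldistr del: nat_pow_Suc)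
  qed
  have B: "(\<Oplus>k\<in>{..n}. ?f n k) \<otimes> b = (\<Oplus>k\<in>{..Suc n}. ?g k)"
  proof -
    have "?f n k \<otimes> b = ?g k" if "k \<le> n" for k
      using a b that by (subst add_pow_ldistr) (simp_all add: m_assoc Suc_diff_le)
    then have "(\<Oplus>k\<in>{..n}. ?f n k) \<otimes> b = (\<Oplus>k\<in>{..n}. ?g k)"
      using a b by (subst finsum_ldistr) (auto intro!: finsum_cong')
    also have "\<dots> = (\<Oplus>k\<in>{..Suc n}. ?g k)" by (simp add: binomial_eq_0)
    finally show ?thesis .
  qed
  have C: "(\<Oplus>k\<in>{..Suc n}. ?g k) = (\<Oplus>k\<in>{..n}. ?g (Suc k)) \<oplus> ?g 0"
    by (rule add.finprod_Suc2) simp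
  have "(a \<oplus> b) [^] Suc n = (\<Oplus>k\<in>{..n}. ?f n k) \<otimes> a \<oplus> (\<Oplus>k\<in>{..n}. ?f n k) \<otimes> b"
    using a b Suc by (simp add: r_distr)
  also have "(\<Oplus>k\<in>{..n}. ?f n k) \<otimes> a \<oplus> (\<Oplus>k\<in>{..n}. ?f n k) \<otimes> b = (\<Oplus>k\<in>{..Suc n}. ?f (Suc n) k)"
  proof -
    have "(\<Oplus>k\<in>{..Suc n}. ?f (Suc n) k) = (\<Oplus>k\<in>{..n}. ?f (Suc n) (Suc k)) \<oplus> ?f (Suc n) 0"
      by (rule add.finprod_Suc2) simp
    also have "(\<Oplus>k\<in>{..n}. ?f (Suc n) (Suc k))
        = (\<Oplus>k\<in>{..n}. [(n choose k)] \<cdot> (a [^] Suc k \<otimes> b [^] (n - k)) \<oplus> ?g (Suc k))"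
      using a b by (intro finsum_cong' refl) (simp_all add: add.nat_pow_mult)
    also have "\<dots> = (\<Oplus>k\<in>{..n}. [(n choose k)] \<cdot> (a [^] Suc k \<otimes> b [^] (n - k))) \<oplus> (\<Oplus>k\<in>{..n}. ?g (Suc k))"
      using a b by (intro finsum_addf) simp_all
    finally show ?thesis
      unfolding A B C using a b by (simp add: a_assoc)
  qed
  finally show ?case .
qed (use a b in simp)

text \<open>The inner binomial coefficients are divisible by \<open>p\<close>. Their sum is kept as
  an error term \<open>([p] \<cdot> \<one>) \<otimes> s\<close>, because the ring need not have
  characteristic \<open>p\<close>.\<close>

lemma frobenius_prime:
  assumes p: "Factorial_Ring.prime (p :: nat)" and a: "a \<in> carrier R" and b: "b \<in> carrier R"
  obtains s where "s \<in> carrier R" "(a \<oplus> b) [^] p = a [^] p \<oplus> b [^] p \<oplus> ([p] \<cdot> \<one>) \<otimes> s"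
proof -
  let ?f = "\<lambda>k. [(p choose k)] \<cdot> (a [^] k \<otimes> b [^] (p - k))"
  let ?h = "\<lambda>k. [((p choose k) div p)] \<cdot> (a [^] k \<otimes> b [^] (p - k))"
  have p2: "2 \<le> p" using p by (rule prime_ge_2_nat)
  have [simp]: "?f k \<in> carrier R" for k using a b by simp
  have f: "?f k = ([p] \<cdot> \<one>) \<otimes> ?h k" if "k \<in> {1..<p}" for k
  proof -
    have "p dvd (p choose k)" using p that p2 by (intro dvd_choose_prime) auto
    then have "p choose k = (p choose k) div p * p" by simp
    then have "?f k = [((p choose k) div p * p)] \<cdot> (a [^] k \<otimes> b [^] (p - k))" by simp
    also have "\<dots> = [p] \<cdot> ?h k" using a b by (simp flip: add.nat_pow_pow)
    also have "\<dots> = ([p] \<cdot> \<one>) \<otimes> ?h k" using a b by (simp add: add_pow_ldistr)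
    finally show ?thesis .
  qed
  have "{..p} = insert 0 (insert p {1..<p})" using p2 by auto
  then have "(a \<oplus> b) [^] p = (\<Oplus>k\<in>insert 0 (insert p {1..<p}). ?f k)"
    using binomial [OF a b, of p] by simp
  also have "\<dots> = ?f 0 \<oplus> (?f p \<oplus> (\<Oplus>k\<in>{1..<p}. ?f k))"
  proof -
    have "(\<Oplus>k\<in>insert 0 (insert p {1..<p}). ?f k) = ?f 0 \<oplus> (\<Oplus>k\<in>insert p {1..<p}. ?f k)"
      by (rule finsum_insert) (use p2 a b in auto)
    also have "(\<Oplus>k\<in>insert p {1..<p}. ?f k) = ?f p \<oplus> (\<Oplus>k\<in>{1..<p}. ?f k)"
      by (rule finsum_insert) (use a b in auto)
    finally show ?thesis .
  qed
  also have "(\<Oplus>k\<in>{1..<p}. ?f k) = ([p] \<cdot> \<one>) \<otimes> (\<Oplus>k\<in>{1..<p}. ?h k)"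
    using f a b by (subst finsum_rdistr) (auto intro!: finsum_cong')
  also have "?f 0 \<oplus> (?f p \<oplus> ([p] \<cdot> \<one>) \<otimes> (\<Oplus>k\<in>{1..<p}. ?h k)) = a [^] p \<oplus> b [^] p \<oplus> ([p] \<cdot> \<one>) \<otimes> (\<Oplus>k\<in>{1..<p}. ?h k)"
    using a b by (simp add: a_ac)
  finally have "(a \<oplus> b) [^] p = a [^] p \<oplus> b [^] p \<oplus> ([p] \<cdot> \<one>) \<otimes> (\<Oplus>k\<in>{1..<p}. ?h k)" .
  then show ?thesis by (rule that [rotated]) (use a b in \<open>auto intro!: finsum_closed\<close>)
qed

text \<open>The error stays a multiple of \<open>p\<close> under a further \<open>p\<close>-th
  power, by \<open>frobenius_prime\<close> and because the \<open>p\<close>-th power of a multiple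
  of \<open>p\<close> is again one.\<close>

lemma frobenius_prime_power:
  assumes p: "Factorial_Ring.prime (p :: nat)" and a: "a \<in> carrier R" and b: "b \<in> carrier R"
  shows "\<exists>s\<in>carrier R. (a \<oplus> b) [^] (p ^ n) = a [^] (p ^ n) \<oplus> b [^] (p ^ n) \<oplus> ([p] \<cdot> \<one>) \<otimes> s"
proof (induction n)
  case 0
  then show ?case using a b by (intro bexI [of _ \<zero>]) simp_all
next
  case (Suc n)
  let ?p = "[p] \<cdot> \<one>"
  have [simp]: "?p \<in> carrier R" by simp
  obtain s where s: "s \<in> carrier R" "(a \<oplus> b) [^] (p ^ n) = a [^] (p ^ n) \<oplus> b [^] (p ^ n) \<oplus> ?p \<otimes> s"
    using Suc by blast
  let ?a = "a [^] (p ^ n)" and ?b = "b [^] (p ^ n)"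
  obtain t where t: "t \<in> carrier R" "(?a \<oplus> ?b \<oplus> ?p \<otimes> s) [^] p = (?a \<oplus> ?b) [^] p \<oplus> (?p \<otimes> s) [^] p \<oplus> ?p \<otimes> t"
    using frobenius_prime [OF p, of "?a \<oplus> ?b" "?p \<otimes> s"] a b s by auto
  obtain r where r: "r \<in> carrier R" "(?a \<oplus> ?b) [^] p = ?a [^] p \<oplus> ?b [^] p \<oplus> ?p \<otimes> r"
    using frobenius_prime [OF p, of ?a ?b] a b by auto
  have pp: "(?p \<otimes> s) [^] p = ?p \<otimes> (s \<otimes> (?p \<otimes> s) [^] (p - 1))"
    using nat_pow_Suc2 [of "?p \<otimes> s" "p - 1"] prime_gt_0_nat [OF p] s by (simp add: m_assoc)
  have pow: "y [^] p ^ Suc n = (y [^] (p ^ n)) [^] p" if "y \<in> carrier R" for y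
    using that by (simp add: nat_pow_pow mult.commute)
  let ?q = "s \<otimes> (?p \<otimes> s) [^] (p - 1)"
  have c: "?a [^] p \<in> carrier R" "?b [^] p \<in> carrier R" "?q \<in> carrier R" "?p \<in> carrier R"
    using a b s by simp_all
  have "(a \<oplus> b) [^] p ^ Suc n = ?a [^] p \<oplus> ?b [^] p \<oplus> ?p \<otimes> r \<oplus> ?p \<otimes> ?q \<oplus> ?p \<otimes> t"
    unfolding pow [OF a_closed [OF a b]] s(2) t(2) r(2) pp ..
  also have "\<dots> = ?a [^] p \<oplus> ?b [^] p \<oplus> ?p \<otimes> (r \<oplus> ?q \<oplus> t)"
    using c r(1) t(1) by algebra
  finally show ?case
    using pow [OF a] pow [OF b] c r(1) t(1) by (intro bexI [of _ "r \<oplus> ?q \<oplus> t"]) simp_all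
qed

section \<open>Residue field, residue characteristic, generators of the radical\<close>

lemma Jac_ideal: "ideal Jac R"
proof (rule idealI)
  have "\<ominus> a \<in> Jac" if "a \<in> Jac" for a
    using Jac_mult [OF that, of "\<ominus> \<one>"] Jac_carrier [OF that] by (simp add: r_minus)
  then show "subgroup Jac (add_monoid R)"
    by (intro add.subgroupI) (use Jac_carrier Jac_zero Jac_add in \<open>auto simp: a_inv_def [symmetric]\<close>)
qed (use Jac_mult Jac_mult' ring_axioms in auto)

text \<open>The quotient by the radical is a finite field, whose multiplicative group is cyclic;
  \<open>g\<close> lifts a generator of that group.\<close>

lemma residue_field_generator:
  assumes fin: "finite (carrier R)" and nz: "\<one> \<noteq> \<zero>"
    and loc: "\<And>b. b \<in> carrier R \<Longrightarrow> b \<in> Units R \<or> b \<in> Jac"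
  obtains g where "g \<in> Units R"
    "\<And>b. b \<in> carrier R \<Longrightarrow> b \<notin> Jac \<Longrightarrow> \<exists>n :: nat. \<exists>e\<in>Jac. b = g [^] n \<oplus> e"
proof -
  interpret J: ideal Jac R by (rule Jac_ideal)
  have "maximalideal Jac R"
  proof (rule maximalidealI [OF Jac_ideal])
    show "carrier R \<noteq> Jac" using unit_not_Jac [OF nz, of \<one>] by auto
    fix I assume I: "ideal I R" "Jac \<subseteq> I" "I \<subseteq> carrier R"
    show "I = Jac \<or> I = carrier R"
    proof (cases "I = Jac")
      case False
      then obtain u where u: "u \<in> I" "u \<in> Units R" using I loc by blast
      then have "\<one> \<in> I" using ideal.I_r_closed [OF I(1) u(1), of "inv u"] by simp
      then show ?thesis using ideal.one_imp_carrier [OF I(1)] by simp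
    qed simp
  qed
  then interpret F: field "R Quot Jac"
    using maximalideal.quotient_is_field is_cring by blast
  have carr: "carrier (R Quot Jac) = (\<lambda>a. Jac +> a) ` carrier R"
    by (auto simp: FactRing_def A_RCOSETS_def')
  then have "finite (carrier (R Quot Jac))" using fin by simp
  from F.finite_field_mult_group_has_gen [OF this]
  obtain c where c: "c \<in> carrier (R Quot Jac)" "c \<noteq> \<zero>\<^bsub>R Quot Jac\<^esub>"
    "carrier (R Quot Jac) - {\<zero>\<^bsub>R Quot Jac\<^esub>} = {c [^]\<^bsub>R Quot Jac\<^esub> i | i :: nat. i \<in> UNIV}"
    by (auto simp: mult_of_simps)
  obtain g where g: "g \<in> carrier R" "c = Jac +> g" using c(1) carr by blast
  have zero: "Jac +> b = \<zero>\<^bsub>R Quot Jac\<^esub> \<longleftrightarrow> b \<in> Jac" if "b \<in> carrier R" for b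
    using that J.a_rcos_const J.a_rcos_self [of b] by (auto simp: FactRing_def)
  have pow: "c [^]\<^bsub>R Quot Jac\<^esub> n = Jac +> (g [^] n)" for n :: nat
  proof (induction n)
    case 0
    show ?case by (simp add: FactRing_def)
  next
    case (Suc n)
    then show ?case using g ring_hom_mult [OF J.rcos_ring_hom, of "g [^] n" g] by simp
  qed
  show ?thesis
  proof (rule that)
    show "g \<in> Units R" using loc [of g] zero [of g] g c(2) by auto
    fix b assume b: "b \<in> carrier R" "b \<notin> Jac"
    then have "Jac +> b \<in> carrier (R Quot Jac) - {\<zero>\<^bsub>R Quot Jac\<^esub>}"
      using carr zero by auto
    then obtain n :: nat where "Jac +> b = Jac +> (g [^] n)"
      using c(3) pow by auto
    then have "b \<ominus> g [^] n \<in> Jac"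
      using quotient_eq_iff_same_a_r_cos [OF Jac_ideal b(1), of "g [^] n"] g by simp
    moreover have "b = g [^] n \<oplus> (b \<ominus> g [^] n)"
      using b g by (simp add: minus_eq a_lcomm r_neg)
    ultimately show "\<exists>n :: nat. \<exists>e\<in>Jac. b = g [^] n \<oplus> e" by blast
  qed
qed

text \<open>The order of the additive group annihilates 1, so some positive multiple of 1 is not a
  unit. The least number giving such a multiple is prime, since a proper factorization would make
  that multiple a product of units.\<close>

lemma residue_characteristic:
  assumes fin: "finite (carrier R)" and nz: "\<one> \<noteq> \<zero>"
  obtains p :: nat where "Factorial_Ring.prime p" "[p] \<cdot> \<one> \<notin> Units R"
proof -
  define p where "p = (LEAST n :: nat. 0 < n \<and> [n] \<cdot> \<one> \<notin> Units R)"
  have z: "\<zero> \<notin> Units R"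
    using unit_not_Jac [OF nz, of \<zero>] Jac_zero by blast
  have "[(order (add_monoid R))] \<cdot> \<one> = \<zero>" using add.pow_order_eq_1 [of \<one>] by simp
  moreover have "0 < order (add_monoid R)"
    using fin add.order_gt_0_iff_finite by simp
  ultimately have ex: "\<exists>n :: nat. 0 < n \<and> [n] \<cdot> \<one> \<notin> Units R" using z by metis
  have p: "0 < p" "[p] \<cdot> \<one> \<notin> Units R"
    using LeastI_ex [OF ex] unfolding p_def by blast+
  have min: "[n] \<cdot> \<one> \<in> Units R" if "0 < n" "n < p" for n :: nat
    using not_less_Least [of n "\<lambda>n. 0 < n \<and> [n] \<cdot> \<one> \<notin> Units R"] that unfolding p_def by blast
  have "Factorial_Ring.prime p"
    unfolding prime_nat_iff
  proof (intro conjI allI impI)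
    have "p \<noteq> 1" using p(2) by auto
    then show "1 < p" using p(1) by simp
    fix m assume "m dvd p"
    then obtain n where n: "p = m * n" by blast
    show "m = 1 \<or> m = p"
    proof (rule ccontr)
      assume "\<not> (m = 1 \<or> m = p)"
      then have "0 < m" "m < p" "0 < n" "n < p" using n p(1) by auto
      then have "([m] \<cdot> \<one>) \<otimes> ([n] \<cdot> \<one>) \<in> Units R" using min by simp
      also have "([m] \<cdot> \<one>) \<otimes> ([n] \<cdot> \<one>) = [p] \<cdot> \<one>"
        unfolding n by (simp add: add_pow_ldistr add.nat_pow_pow mult.commute)
      finally show False using p(2) by blast
    qed
  qed
  then show ?thesis using that p by blast
qed

text \<open>With \<open>\<tau> a = a ^ (p ^ l)\<close> the idempotent iterate of Frobenius, the radical is generated by \<open>p\<close> and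
  the elements \<open>x - \<tau> x\<close>, where \<open>x\<close> runs over the generators of the ring: modulo these elements
  the values of \<open>\<tau>\<close> form a subring, and \<open>\<tau>\<close> vanishes on the radical.\<close>

lemma Jac_generators:
  assumes fin: "finite (carrier R)" and nz: "\<one> \<noteq> \<zero>"
    and loc: "\<And>b. b \<in> carrier R \<Longrightarrow> b \<in> Units R \<or> b \<in> Jac"
    and xs: "set xs \<subseteq> carrier R" and gen: "generate_ring R (set xs) = carrier R"
  obtains ts where "length ts = Suc (length xs)" "set ts \<subseteq> Jac" "Jac \<subseteq> lin ts"
proof -
  obtain p :: nat where p: "Factorial_Ring.prime p" "[p] \<cdot> \<one> \<notin> Units R"
    using residue_characteristic [OF fin nz] .
  let ?p = "[p] \<cdot> \<one>"
  have pJ: "?p \<in> Jac" using loc p(2) by blast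
  \<comment> \<open>Functions on the carrier rather than powers of one element, so that one exponent
    \<open>l\<close> makes the iterate idempotent on all elements at once. Restriction to the
    carrier keeps the set of functions finite.\<close>
  define f where "f = (\<lambda>n. \<lambda>a\<in>carrier R. a [^] (p ^ n))"
  have "finite (range f)"
    by (rule finite_subset [OF _ finite_PiE [of "carrier R" "\<lambda>_. carrier R"]]) (auto simp: f_def fin)
  moreover have "f (i + c) = f (j + c)" if ij: "f i = f j" for i j c
  proof -
    have eq: "a [^] (p ^ i) = a [^] (p ^ j)" if "a \<in> carrier R" for a
      using fun_cong [OF ij, of a] that by (simp add: f_def)
    have "a [^] (p ^ (i + c)) = a [^] (p ^ (j + c))" if "a \<in> carrier R" for a
      using eq [OF that] that by (simp add: power_add flip: nat_pow_pow)
    then show ?thesis unfolding f_def by (intro restrict_ext)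
  qed
  ultimately obtain l where l: "0 < l" "f (2 * l) = f l" by (rule idempotent_index)
  define M where "M = p ^ l"
  have M: "1 < M" unfolding M_def by (rule one_less_power [OF prime_gt_1_nat [OF p(1)] l(1)])
  define \<tau> where "\<tau> a = a [^] M" for a
  have [simp]: "\<tau> a \<in> carrier R" if "a \<in> carrier R" for a
    using that by (simp add: \<tau>_def)
  have idem: "\<tau> (\<tau> a) = \<tau> a" if "a \<in> carrier R" for a
    using fun_cong [OF l(2), of a] that
    by (simp add: f_def \<tau>_def M_def nat_pow_pow mult_2 flip: power_add)
  have add: "\<exists>s\<in>carrier R. \<tau> (a \<oplus> b) = \<tau> a \<oplus> \<tau> b \<oplus> ?p \<otimes> s"
    if "a \<in> carrier R" "b \<in> carrier R" for a b
    unfolding \<tau>_def M_def by (rule frobenius_prime_power [OF p(1) that])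
  have mult: "\<tau> (a \<otimes> b) = \<tau> a \<otimes> \<tau> b" if "a \<in> carrier R" "b \<in> carrier R" for a b
    using that by (simp add: \<tau>_def nat_pow_distrib)
  have \<tau>_zero: "\<tau> a = \<zero>" if a: "a \<in> Jac" for a
  proof -
    note [simp] = Jac_carrier [OF a]
    have "M < M * M" using M by simp
    \<comment> \<open>Idempotence of \<tau> gives a^M = a^(M M) = a^M a^(N+1), hence a^M (1 - a a^N)
      = 0 with a unit as second factor.\<close>
    then obtain N where "M * M = M + Suc N" using less_imp_Suc_add by fastforce
    then have "a [^] M = a [^] M \<otimes> (a \<otimes> a [^] N)"
      using idem [of a] by (simp add: \<tau>_def nat_pow_pow flip: nat_pow_mult) (simp add: m_ac)
    then have z: "a [^] M \<otimes> (\<one> \<ominus> a \<otimes> a [^] N) = \<zero>"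
      by (simp add: minus_eq r_distr r_minus r_neg)
    have u: "\<one> \<ominus> a \<otimes> a [^] N \<in> Units R" using a by (intro Jac_unit) simp_all
    have "a [^] M = a [^] M \<otimes> (\<one> \<ominus> a \<otimes> a [^] N) \<otimes> inv (\<one> \<ominus> a \<otimes> a [^] N)"
      using u by (simp add: m_assoc)
    then show ?thesis using z u by (simp add: \<tau>_def)
  qed
  have \<tau>_Jac: "a \<in> Jac" if "a \<in> carrier R" "\<tau> a \<in> Jac" for a
  proof (rule ccontr)
    assume "a \<notin> Jac"
    then have "a \<in> Units R" using loc that(1) by blast
    then have "\<tau> a \<in> Units R" by (simp add: \<tau>_def Units_pow_closed)
    then show False using unit_not_Jac [OF nz] that(2) by blast
  qed
  \<comment> \<open>Applying \<tau> to x = (x - \<tau> x) + \<tau> x and using idempotence shows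
    that \<tau> (x - \<tau> x) is a multiple of \<open>p\<close>, hence in the radical; powers of a
    unit would not be.\<close>
  have tJ: "x \<ominus> \<tau> x \<in> Jac" if x: "x \<in> carrier R" for x
  proof -
    have "x \<ominus> \<tau> x \<oplus> \<tau> x = x" using x by (simp add: minus_eq a_assoc l_neg)
    then obtain s where s: "s \<in> carrier R" "\<tau> x = \<tau> (x \<ominus> \<tau> x) \<oplus> \<tau> x \<oplus> ?p \<otimes> s"
      using add [of "x \<ominus> \<tau> x" "\<tau> x"] idem [OF x] x by auto
    then have "\<tau> x = \<tau> x \<oplus> (\<tau> (x \<ominus> \<tau> x) \<oplus> ?p \<otimes> s)"
      using x by (simp add: a_ac)
    then have "\<tau> (x \<ominus> \<tau> x) \<oplus> ?p \<otimes> s = \<zero>"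
      using x s by (metis \<open>\<And>a. a \<in> carrier R \<Longrightarrow> \<tau> a \<in> carrier R\<close> a_closed add.l_cancel_one' m_closed minus_closed pJ Jac_carrier)
    then have "\<tau> (x \<ominus> \<tau> x) = \<ominus> (?p \<otimes> s)" using x s by (simp add: minus_equality add.inv_equality)
    also have "\<dots> = ?p \<otimes> \<ominus> s" using s by (simp add: r_minus)
    finally have "\<tau> (x \<ominus> \<tau> x) \<in> Jac" using pJ s by (simp add: Jac_mult)
    then show ?thesis using \<tau>_Jac x by simp
  qed
  define ts where "ts = ?p # map (\<lambda>x. x \<ominus> \<tau> x) xs"
  have tsJ: "set ts \<subseteq> Jac" using pJ tJ xs by (auto simp: ts_def)
  then have tsR: "set ts \<subseteq> carrier R" using Jac_carrier by blast
  have lR [simp]: "e \<in> carrier R" if "e \<in> lin ts" for e using lin_closed [OF tsR that] .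
  have p_lin: "?p \<otimes> s \<in> lin ts" if "s \<in> carrier R" for s
    by (rule lin_member [OF tsR _ that]) (simp add: ts_def)
  have scale: "r \<otimes> e \<in> lin ts" "e \<otimes> r \<in> lin ts" if "e \<in> lin ts" "r \<in> carrier R" for r e
    using lin_scale [OF tsR that(2,1)] that by (simp_all add: m_comm)
  \<comment> \<open>Closed under the ring operations, because \<tau> is multiplicative, and additive
    up to multiples of \<open>p\<close>, which belong to \<open>lin ts\<close>. Containing the
    generators, \<open>S\<close> is the whole ring.\<close>
  define S where "S = {\<tau> a \<oplus> e | a e. a \<in> carrier R \<and> e \<in> lin ts}"
  have SI: "y \<in> S" if "y = \<tau> a \<oplus> e" "a \<in> carrier R" "e \<in> lin ts" for y a e
    using that unfolding S_def by blast
  have S_R: "y \<in> carrier R" if "y \<in> S" for y using that by (auto simp: S_def)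
  have S_add: "y \<oplus> z \<in> S" if yz: "y \<in> S" "z \<in> S" for y z
  proof -
    obtain a e b f where y: "y = \<tau> a \<oplus> e" "a \<in> carrier R" "e \<in> lin ts"
      and z: "z = \<tau> b \<oplus> f" "b \<in> carrier R" "f \<in> lin ts" using yz by (auto simp: S_def)
    obtain s where s: "s \<in> carrier R" "\<tau> (a \<oplus> b) = \<tau> a \<oplus> \<tau> b \<oplus> ?p \<otimes> s" using add y z by blast
    have c: "\<tau> a \<in> carrier R" "\<tau> b \<in> carrier R" "e \<in> carrier R" "f \<in> carrier R" "?p \<in> carrier R"
      using y z by simp_all
    show ?thesis
    proof (rule SI)
      show "y \<oplus> z = \<tau> (a \<oplus> b) \<oplus> (?p \<otimes> \<ominus> s \<oplus> (e \<oplus> f))"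
        unfolding y(1) z(1) s(2) using c s(1) by algebra
    qed (use y z s tsR in \<open>auto intro!: lin_add p_lin\<close>)
  qed
  have S_lin: "e \<in> S" if "e \<in> lin ts" for e
    using SI [of e \<zero> e] that M by (simp add: \<tau>_def nat_pow_zero)
  have S_minus: "\<ominus> y \<in> S" if yS: "y \<in> S" for y
  proof -
    obtain a e where y: "y = \<tau> a \<oplus> e" "a \<in> carrier R" "e \<in> lin ts" using yS by (auto simp: S_def)
    have "\<tau> \<zero> = \<zero>" using M by (simp add: \<tau>_def nat_pow_zero)
    then obtain s where s: "s \<in> carrier R" "\<zero> = \<tau> a \<oplus> \<tau> (\<ominus> a) \<oplus> ?p \<otimes> s"
      using add [of a "\<ominus> a"] y by (auto simp: r_neg)
    have c: "\<tau> a \<in> carrier R" "\<tau> (\<ominus> a) \<in> carrier R" "e \<in> carrier R" "?p \<in> carrier R"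
      using y by simp_all
    have "\<ominus> y = (\<tau> a \<oplus> \<tau> (\<ominus> a) \<oplus> ?p \<otimes> s) \<ominus> y" using y(1) c s(1) by (simp add: minus_eq flip: s(2))
    also have "\<dots> = \<tau> (\<ominus> a) \<oplus> (?p \<otimes> s \<oplus> \<ominus> e)" unfolding y(1) using c s(1) by algebra
    finally show ?thesis by (rule SI) (use y s tsR in \<open>auto intro!: lin_add lin_minus p_lin\<close>)
  qed
  have S_mult: "y \<otimes> z \<in> S" if yz: "y \<in> S" "z \<in> S" for y z
  proof -
    obtain a e b f where y: "y = \<tau> a \<oplus> e" "a \<in> carrier R" "e \<in> lin ts"
      and z: "z = \<tau> b \<oplus> f" "b \<in> carrier R" "f \<in> lin ts" using yz by (auto simp: S_def)
    have c: "\<tau> a \<in> carrier R" "\<tau> b \<in> carrier R" "e \<in> carrier R" "f \<in> carrier R"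
      using y z by simp_all
    show ?thesis
    proof (rule SI)
      show "y \<otimes> z = \<tau> (a \<otimes> b) \<oplus> (\<tau> a \<otimes> f \<oplus> (e \<otimes> \<tau> b \<oplus> e \<otimes> f))"
        unfolding y(1) z(1) mult [OF y(2) z(2)] using c by algebra
    qed (use y z c in \<open>simp_all add: lin_add [OF tsR] scale\<close>)
  qed
  have "y \<in> S" if "y \<in> generate_ring R (set xs)" for y
    using that
  proof (induction rule: generate_ring.induct)
    case one
    show ?case using SI [of \<one> \<one> \<zero>] lin_zero [OF tsR] by (simp add: \<tau>_def)
  next
    case (incl x)
    then have x: "x \<in> carrier R" using xs by blast
    have "(x \<ominus> \<tau> x) \<otimes> \<one> \<in> lin ts"
      using incl by (intro lin_member [OF tsR]) (auto simp: ts_def)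
    moreover have "x = \<tau> x \<oplus> (x \<ominus> \<tau> x)" using x by (simp add: minus_eq a_lcomm r_neg)
    ultimately show ?case using SI [of x x "x \<ominus> \<tau> x"] x by simp
  qed (use S_minus S_add S_mult in auto)
  then have RS: "carrier R \<subseteq> S" using gen by blast
  have "Jac \<subseteq> lin ts"
  proof
    fix r assume r: "r \<in> Jac"
    \<comment> \<open>An element \<tau> a + e of the radical has \<tau> a in the radical, hence also
      \<open>a\<close>, and then \<tau> a = 0. Only the part \<open>e\<close> in the ideal
      remains.\<close>
    then obtain a e where a: "r = \<tau> a \<oplus> e" "a \<in> carrier R" "e \<in> lin ts"
      using RS Jac_carrier unfolding S_def by blast
    have e: "e \<in> Jac" using lin_Jac [OF tsJ a(3)] .
    have "\<tau> a = r \<oplus> e \<otimes> \<ominus> \<one>" using a by (simp add: r_minus a_assoc r_neg)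
    also have "\<dots> \<in> Jac" using r e by (simp add: Jac_add Jac_mult)
    finally have "\<tau> a = \<zero>" using \<tau>_Jac a(2) \<tau>_zero by blast
    then show "r \<in> lin ts" using a by simp
  qed
  moreover have "length ts = Suc (length xs)" by (simp add: ts_def)
  ultimately show ?thesis using that tsJ by blast
qed

end

section \<open>Splitting off idempotents\<close>

text \<open>The ring \<open>e R\<close> with identity \<open>e\<close>. As a record update it shares
  addition, multiplication and zero with \<open>R\<close>, so only the carrier, negation and
  inverses have to be compared.\<close>

definition corner :: "('a, 'b) ring_scheme \<Rightarrow> 'a \<Rightarrow> ('a, 'b) ring_scheme" where
  "corner R e = R\<lparr>carrier := (\<lambda>r. e \<otimes>\<^bsub>R\<^esub> r) ` carrier R, one := e\<rparr>"

lemma corner_simps [simp]: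
  "monoid.mult (corner R e) = monoid.mult R" "ring.add (corner R e) = ring.add R" "ring.zero (corner R e) = ring.zero R"
  "monoid.one (corner R e) = e"
  by (simp_all add: corner_def)

context cring
begin

context
  fixes e
  assumes e: "e \<in> carrier R" "e \<otimes> e = e"
  notes [simp] = e
begin

lemma corner_carrier: "a \<in> carrier (corner R e) \<longleftrightarrow> a \<in> carrier R \<and> e \<otimes> a = a"
proof
  assume "a \<in> carrier (corner R e)"
  then obtain r where "r \<in> carrier R" "a = e \<otimes> r" by (auto simp: corner_def)
  then show "a \<in> carrier R \<and> e \<otimes> a = a" by (simp flip: m_assoc)
next
  assume "a \<in> carrier R \<and> e \<otimes> a = a"
  then have "a = e \<otimes> a" "a \<in> carrier R" by simp_all
  then show "a \<in> carrier (corner R e)" unfolding corner_def by auto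
qed

lemma corner_mult_closed: "r \<in> carrier R \<Longrightarrow> e \<otimes> r \<in> carrier (corner R e)"
  by (simp add: corner_def)

lemma cring_corner: "cring (corner R e)"
proof (rule cringI)
  show "abelian_group (corner R e)"
  proof (rule abelian_groupI)
    fix a assume a: "a \<in> carrier (corner R e)"
    then have "\<ominus> a \<in> carrier (corner R e)" "\<ominus> a \<oplus> a = \<zero>"
      by (simp_all add: corner_carrier r_minus l_neg)
    then show "\<exists>b\<in>carrier (corner R e). b \<oplus>\<^bsub>corner R e\<^esub> a = \<zero>\<^bsub>corner R e\<^esub>" by auto
  qed (simp_all add: corner_carrier r_distr a_assoc, simp add: a_comm)
  show "comm_monoid (corner R e)"
  proof (rule comm_monoidI)
    fix a b assume "a \<in> carrier (corner R e)" "b \<in> carrier (corner R e)"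
    then show "a \<otimes>\<^bsub>corner R e\<^esub> b \<in> carrier (corner R e)"
      by (simp add: corner_carrier flip: m_assoc)
  qed (simp_all add: corner_carrier m_assoc, simp add: m_comm)
qed (simp add: corner_carrier l_distr)

interpretation C: cring "corner R e"
  by (rule cring_corner)

lemma corner_minus: "a \<in> carrier (corner R e) \<Longrightarrow> \<ominus>\<^bsub>corner R e\<^esub> a = \<ominus> a"
  by (rule C.minus_equality) (simp_all add: corner_carrier l_neg r_minus)

lemma corner_Units:
  "u \<in> Units (corner R e) \<longleftrightarrow> u \<in> carrier R \<and> e \<otimes> u = u \<and> (\<exists>v\<in>carrier R. e \<otimes> v = v \<and> u \<otimes> v = e)"
proof
  assume "u \<in> Units (corner R e)"
  then obtain v where "u \<in> carrier (corner R e)" "v \<in> carrier (corner R e)" "u \<otimes> v = e"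
    by (auto simp: Units_def)
  then show "u \<in> carrier R \<and> e \<otimes> u = u \<and> (\<exists>v\<in>carrier R. e \<otimes> v = v \<and> u \<otimes> v = e)"
    unfolding corner_carrier by blast
next
  assume "u \<in> carrier R \<and> e \<otimes> u = u \<and> (\<exists>v\<in>carrier R. e \<otimes> v = v \<and> u \<otimes> v = e)"
  then obtain v where "u \<in> carrier (corner R e)" "v \<in> carrier (corner R e)" "u \<otimes> v = e" "v \<otimes> u = e"
    unfolding corner_carrier by (metis m_comm)
  then show "u \<in> Units (corner R e)"
    unfolding Units_def by auto
qed

end

end

section \<open>The bound on the number of symbols and its local case\<close>

context steinberg_rep
begin

lemma rank_oneE:
  assumes rank_one "i \<in> D" "j \<in> D" "i \<noteq> j" "r \<in> carrier R" "s \<in> carrier R" "t \<in> carrier R"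
  obtains a b c k where "a \<in> carrier R" "b \<in> carrier R" "c \<in> carrier R" "k \<in> K i j"
    "x j i r * x i j s * x j i t = x i j a * x j i b * k * x i j c"
  using assms(1) [unfolded rank_one_def, rule_format, OF assms(2-)] that by blast

text \<open>The length is exactly \<open>n\<close>, which allows lists from two corner rings to be
  merged entry by entry. \<open>rank_one\<close> is carried along because it passes to products by
  the same induction.\<close>

definition symbols_bounded :: "nat \<Rightarrow> bool" where
  "symbols_bounded n \<longleftrightarrow> rank_one \<and> (\<forall>z\<in>Z. \<exists>ps. length ps = n \<and> set ps \<subseteq> Units R \<times> Units R
    \<and> z = sprod ps)"

lemma K_E: "i \<in> D \<Longrightarrow> j \<in> D \<Longrightarrow> i \<noteq> j \<Longrightarrow> k \<in> K i j \<Longrightarrow> k \<in> E"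
  using K_H H_E by blast

text \<open>The local argument needs a residue field, which the zero ring lacks. Here all root
  elements are trivial, and the list is filled with trivial symbols.\<close>

lemma symbols_bounded_zero_ring:
  assumes "\<one> = \<zero>"
  shows "symbols_bounded n"
proof -
  have 0: "r = \<zero>" if "r \<in> carrier R" for r
    using that assms by (metis l_one l_null)
  have 1: "x i j r = 1" if "i \<in> D" "j \<in> D" "i \<noteq> j" "r \<in> carrier R" for i j r
    using 0 [OF that(4)] that x_zero by simp
  have "rank_one"
    unfolding rank_one_def
  proof (intro allI impI)
    fix i j r s t assume "i \<in> D" "j \<in> D" "i \<noteq> j" "r \<in> carrier R" "s \<in> carrier R" "t \<in> carrier R"
    then have "x j i r * x i j s * x j i t = x i j \<zero> * x j i \<zero> * 1 * x i j \<zero>" by (simp add: 1)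
    moreover have "1 \<in> K i j" by (simp add: K_def)
    ultimately show "\<exists>a b c k. a \<in> carrier R \<and> b \<in> carrier R \<and> c \<in> carrier R \<and> k \<in> K i j \<and>
      x j i r * x i j s * x j i t = x i j a * x j i b * k * x i j c" by blast
  qed
  moreover have "g = 1" if "g \<in> E" for g
    using that by (induction rule: E_induct) (auto simp: 1)
  then have "z = 1" if "z \<in> Z" for z using that Z_E by blast
  moreover have "sprod (replicate n (\<one>, \<one>)) = 1" by (induction n) simp_all
  then have "\<exists>ps. length ps = n \<and> set ps \<subseteq> Units R \<times> Units R \<and> 1 = sprod ps"
    by (intro exI [of _ "replicate n (\<one>, \<one>)"]) auto
  ultimately show ?thesis unfolding symbols_bounded_def by blast
qed

lemma symbols_bounded_local:
  assumes fin: "finite (carrier R)" and nz: "\<one> \<noteq> \<zero>"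
    and idem: "\<And>e. e \<in> carrier R \<Longrightarrow> e \<otimes> e = e \<Longrightarrow> e = \<zero> \<or> e = \<one>"
    and gens: "set gens \<subseteq> carrier R" "generate_ring R (set gens) = carrier R"
  shows "symbols_bounded (length gens + 2)"
proof -
  have loc: "b \<in> Units R \<or> b \<in> Jac" if "b \<in> carrier R" for b
    using finite_unit_or_Jac [OF fin idem that] by blast
  interpret L: local_steinberg R d x
    by unfold_locales (rule loc)
  obtain g where g: "g \<in> Units R"
    "\<And>b. b \<in> carrier R \<Longrightarrow> b \<notin> Jac \<Longrightarrow> \<exists>n :: nat. \<exists>e\<in>Jac. b = g [^] n \<oplus> e"
    using residue_field_generator [OF fin nz loc] by metis
  obtain ts where ts: "length ts = Suc (length gens)" "set ts \<subseteq> Jac" "Jac \<subseteq> lin ts"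
    using Jac_generators [OF fin nz loc gens] by metis
  show ?thesis
    \<comment> \<open>One symbol for {g, v} and one for each entry of \<open>ts\<close>, of which
      there are \<open>length gens + 1\<close>.\<close>
    unfolding symbols_bounded_def using L.rank_one_local L.Z_symbols_local [OF g(1) fin ts(2,3) g(2)] ts(1) by simp
qed

lemma steinberg_rep_corner:
  assumes e: "e \<in> carrier R" "e \<otimes> e = e"
  shows "steinberg_rep (corner R e) d x"
proof -
  interpret C: cring "corner R e" by (rule cring_corner [OF e])
  show ?thesis
    by unfold_locales (auto simp: d3 corner_carrier [OF e] x_add x_comm intro: x_commute)
qed

text \<open>All products of \<open>r\<close> and \<open>s\<close> vanish, which settles the pairs
  covered by a Steinberg relation. For opposite roots, \<open>x i j r\<close> is the commutator of
  \<open>x i m r\<close> and \<open>x m j e\<close>, both of which commute with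
  \<open>x j i s\<close> because r s = e s = 0.\<close>

lemma conj_x_orthogonal:
  assumes ij: "i \<in> D" "j \<in> D" "i \<noteq> j" and kl: "k \<in> D" "l \<in> D" "k \<noteq> l"
    and [simp]: "e \<in> carrier R" "r \<in> carrier R" "s \<in> carrier R" and er: "e \<otimes> r = r" and es: "e \<otimes> s = \<zero>"
  shows "gconj (x i j r) (x k l s) = x k l s"
proof -
  note [simp] = ij ij(3) [symmetric] kl kl(3) [symmetric]
  have rs [simp]: "r \<otimes> s = \<zero>"
  proof -
    have "r \<otimes> s = (e \<otimes> r) \<otimes> s" by (simp add: er)
    also have "\<dots> = r \<otimes> (e \<otimes> s)" by (simp add: m_ac)
    finally show ?thesis by (simp add: es)
  qed
  have [simp]: "s \<otimes> r = \<zero>" using rs by (simp add: m_comm)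
  consider "j \<noteq> k" "i \<noteq> l" | "j = k" "i \<noteq> l" | "j \<noteq> k" "i = l" | "j = k" "i = l" by blast
  then show ?thesis
  proof cases
    case 1
    then show ?thesis by (simp add: conj_x_commute)
  next
    case 2
    then show ?thesis using ij kl by (subst \<open>j = k\<close> [symmetric], subst conj_x_right) (auto simp: x_zero)
  next
    case 3
    then show ?thesis using ij kl by (subst \<open>i = l\<close> [symmetric], subst conj_x_left) (auto simp: x_zero)
  next
    case 4
    obtain m where m [simp]: "m \<in> D" "m \<noteq> i" "m \<noteq> j" by (rule third_index)
    note [simp] = m(2,3) [symmetric]
    have "x i j r = x i m r * x m j e * inverse (x i m r) * inverse (x m j e)"
      by (subst x_comm) (simp_all add: m_comm [of r] er)
    moreover have "x i m r * x j i s = x j i s * x i m r"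
      using conj_x_left [of i m j r s] by (simp add: x_zero gconj_eq_self_iff)
    moreover have "x m j e * x j i s = x j i s * x m j e"
      using conj_x_right [of m j i e s] by (simp add: x_zero gconj_eq_self_iff es)
    ultimately have "x j i s * x i j r = x i j r * x j i s"
      by (metis (no_types, lifting) inverse_cancel_left mult.assoc mult_inverse_eq_iff)
    then show ?thesis using 4 by (simp add: gconj_eq_self_iff)
  qed
qed

section \<open>Recombining two complementary corner rings\<close>

context
  fixes e f
  assumes e: "e \<in> carrier R" "e \<otimes> e = e" and f: "f \<in> carrier R" "f \<otimes> f = f"
    and ef: "e \<otimes> f = \<zero>" "e \<oplus> f = \<one>"
  notes [simp] = e f ef
begin

interpretation A: steinberg_rep "corner R e" d x
  by (rule steinberg_rep_corner [OF e])

interpretation B: steinberg_rep "corner R f" d x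
  by (rule steinberg_rep_corner [OF f])

lemmas corner_closed = corner_carrier [OF e] corner_carrier [OF f]

lemma orthogonal:
  assumes r: "r \<in> carrier (corner R e)" and s: "s \<in> carrier (corner R f)"
  shows "r \<otimes> s = \<zero>" "s \<otimes> r = \<zero>"
proof -
  have rs: "r \<in> carrier R" "s \<in> carrier R" "e \<otimes> r = r" "f \<otimes> s = s"
    using r s by (simp_all add: corner_closed)
  have "r \<otimes> s = e \<otimes> r \<otimes> (f \<otimes> s)" using rs by simp
  also have "\<dots> = e \<otimes> f \<otimes> (r \<otimes> s)"
    using rs(1,2) e(1) f(1) by (simp add: m_ac del: ef)
  finally show "r \<otimes> s = \<zero>" using rs by simp
  then show "s \<otimes> r = \<zero>" using rs by (simp add: m_comm)
qed

lemma corners_commute: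
  assumes g: "g \<in> A.E" and k: "k \<in> B.E"
  shows "g * k = k * g"
proof -
  have 1: "x k l s * x i j r = x i j r * x k l s"
    if "i \<in> D" "j \<in> D" "i \<noteq> j" "r \<in> carrier (corner R e)" "k \<in> D" "l \<in> D" "k \<noteq> l" "s \<in> carrier (corner R f)"
    for i j r k l s
  proof -
    have "e \<otimes> s = e \<otimes> f \<otimes> s" using that by (simp add: corner_closed m_assoc del: ef)
    then have "e \<otimes> s = \<zero>" using that by (simp add: corner_closed)
    then have "gconj (x i j r) (x k l s) = x k l s"
      using that by (intro conj_x_orthogonal [of _ _ _ _ e]) (simp_all add: corner_closed)
    then show ?thesis by (simp add: gconj_eq_self_iff)
  qed
  have 2: "g * x k l s = x k l s * g" if "k \<in> D" "l \<in> D" "k \<noteq> l" "s \<in> carrier (corner R f)" for k l s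
    by (rule commute_gspan [OF _ g [unfolded A.E_def], symmetric]) (use 1 that in blast)
  show ?thesis
    by (rule commute_gspan [OF _ k [unfolded B.E_def]]) (use 2 in blast)
qed

lemma join_Units:
  assumes "u \<in> Units (corner R e)" "v \<in> Units (corner R f)"
  shows "u \<oplus> v \<in> Units R" "inv (u \<oplus> v) = inv\<^bsub>corner R e\<^esub> u \<oplus> inv\<^bsub>corner R f\<^esub> v"
proof -
  let ?u = "inv\<^bsub>corner R e\<^esub> u" and ?v = "inv\<^bsub>corner R f\<^esub> v"
  have c: "u \<in> carrier (corner R e)" "?u \<in> carrier (corner R e)" "v \<in> carrier (corner R f)" "?v \<in> carrier (corner R f)"
    using assms by simp_all
  have cR: "u \<in> carrier R" "?u \<in> carrier R" "v \<in> carrier R" "?v \<in> carrier R"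
    using c by (simp_all add: corner_closed)
  have uv: "u \<otimes> ?u = e" "v \<otimes> ?v = f"
    using A.Units_r_inv [OF assms(1)] B.Units_r_inv [OF assms(2)] by simp_all
  have "(u \<oplus> v) \<otimes> (?u \<oplus> ?v) = \<one>"
    using cR uv orthogonal [OF c(1,4)] orthogonal [OF c(2,3)] by (simp add: l_distr r_distr)
  then show "u \<oplus> v \<in> Units R" "inv (u \<oplus> v) = ?u \<oplus> ?v"
    using cR comm_inv_char [of "u \<oplus> v" "?u \<oplus> ?v"] unit_factor [of "u \<oplus> v" "?u \<oplus> ?v"] by simp_all
qed

lemma split_Units:
  assumes u: "u \<in> Units R"
  shows "e \<otimes> u \<in> Units (corner R e)" "f \<otimes> u \<in> Units (corner R f)" "u = e \<otimes> u \<oplus> f \<otimes> u"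
proof -
  have "g \<otimes> u \<in> Units (corner R g)" if g: "g \<in> carrier R" "g \<otimes> g = g" for g
    unfolding corner_Units [OF g]
  proof (intro conjI bexI)
    have 1: "g \<otimes> (g \<otimes> r) = g \<otimes> r" if "r \<in> carrier R" for r
      using g that by (simp flip: m_assoc)
    then show "g \<otimes> (g \<otimes> u) = g \<otimes> u" "g \<otimes> (g \<otimes> inv u) = g \<otimes> inv u" using u by simp_all
    have "g \<otimes> u \<otimes> (g \<otimes> inv u) = g \<otimes> g \<otimes> (u \<otimes> inv u)"
      using u g(1) by (simp add: m_ac del: Units_r_inv unit_cancel)
    then show "g \<otimes> u \<otimes> (g \<otimes> inv u) = g" using u g by simp
  qed (use u g in simp_all)
  then show "e \<otimes> u \<in> Units (corner R e)" "f \<otimes> u \<in> Units (corner R f)" by simp_all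
  show "u = e \<otimes> u \<oplus> f \<otimes> u" using u by (simp flip: l_distr)
qed

lemma x_join:
  assumes "i \<in> D" "j \<in> D" "i \<noteq> j" "r \<in> carrier (corner R e)" "s \<in> carrier (corner R f)"
  shows "x i j (r \<oplus> s) = x i j r * x i j s"
  using assms by (simp add: x_add corner_closed)

lemma join_mult:
  assumes "g \<in> A.E" "g' \<in> A.E" "k \<in> B.E" "k' \<in> B.E"
  shows "(g * k) * (g' * k') = (g * g') * (k * k')"
  using corners_commute [OF assms(2,3)] by (metis mult.assoc)

lemma join_mult3:
  assumes "g1 \<in> A.E" "g2 \<in> A.E" "g3 \<in> A.E" "k1 \<in> B.E" "k2 \<in> B.E" "k3 \<in> B.E"
  shows "(g1 * k1) * (g2 * k2) * (g3 * k3) = (g1 * g2 * g3) * (k1 * k2 * k3)"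
  using assms join_mult [of g1 g2 k1 k2] join_mult [of "g1 * g2" g3 "k1 * k2" k3] by simp

lemma join_mult4:
  assumes "g1 \<in> A.E" "g2 \<in> A.E" "g3 \<in> A.E" "g4 \<in> A.E" "k1 \<in> B.E" "k2 \<in> B.E" "k3 \<in> B.E" "k4 \<in> B.E"
  shows "(g1 * k1) * (g2 * k2) * (g3 * k3) * (g4 * k4) = (g1 * g2 * g3 * g4) * (k1 * k2 * k3 * k4)"
  using assms join_mult3 [of g1 g2 g3 k1 k2 k3] join_mult [of "g1 * g2 * g3" g4 "k1 * k2 * k3" k4] by simp

lemma join_inverse: "g \<in> A.E \<Longrightarrow> k \<in> B.E \<Longrightarrow> inverse (g * k) = inverse g * inverse k"
  using corners_commute [of "inverse g" "inverse k"] by simp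

context
  fixes i j assumes ij: "i \<in> D" "j \<in> D" "i \<noteq> j"
  notes [simp] = ij ij(3) [symmetric]
begin

lemma w_join:
  assumes u: "u \<in> Units (corner R e)" and v: "v \<in> Units (corner R f)"
  shows "w i j (u \<oplus> v) = A.w i j u * B.w i j v"
proof -
  let ?u = "inv\<^bsub>corner R e\<^esub> u" and ?v = "inv\<^bsub>corner R f\<^esub> v"
  have c: "u \<in> carrier (corner R e)" "?u \<in> carrier (corner R e)" "v \<in> carrier (corner R f)" "?v \<in> carrier (corner R f)"
    using u v by simp_all
  have m: "\<ominus>\<^bsub>corner R e\<^esub> ?u = \<ominus> ?u" "\<ominus>\<^bsub>corner R f\<^esub> ?v = \<ominus> ?v"
    using c corner_minus [OF e] corner_minus [OF f] by simp_all
  have mc: "\<ominus> ?u \<in> carrier (corner R e)" "\<ominus> ?v \<in> carrier (corner R f)"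
    using c A.a_inv_closed [of ?u] B.a_inv_closed [of ?v] unfolding m by simp_all
  have "\<ominus> (inv (u \<oplus> v)) = \<ominus> ?u \<oplus> \<ominus> ?v"
    unfolding join_Units(2) [OF u v] using c by (simp add: corner_closed minus_add)
  then have "w i j (u \<oplus> v) = (x i j u * x i j v) * (x j i (\<ominus> ?u) * x j i (\<ominus> ?v)) * (x i j u * x i j v)"
    unfolding w_def using c mc by (simp add: x_join)
  also have "\<dots> = (x i j u * x j i (\<ominus> ?u) * x i j u) * (x i j v * x j i (\<ominus> ?v) * x i j v)"
    by (rule join_mult3) (use c mc in simp_all)
  finally show ?thesis unfolding A.w_def B.w_def m .
qed

lemma h_join:
  assumes u: "u \<in> Units (corner R e)" and v: "v \<in> Units (corner R f)"
  shows "h i j (u \<oplus> v) = A.h i j u * B.h i j v"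
proof -
  have m: "\<ominus>\<^bsub>corner R e\<^esub> e = \<ominus> e" "\<ominus>\<^bsub>corner R f\<^esub> f = \<ominus> f"
    using corner_minus [OF e, of e] corner_minus [OF f, of f] by (simp_all add: corner_closed)
  have U: "\<ominus> e \<in> Units (corner R e)" "\<ominus> f \<in> Units (corner R f)"
    using A.unit_minus(1) [of e] B.unit_minus(1) [of f] A.Units_one_closed B.Units_one_closed
    unfolding m by simp_all
  have "\<ominus> \<one> = \<ominus> e \<oplus> \<ominus> f" by (simp add: minus_add flip: ef(2))
  then have "h i j (u \<oplus> v) = (A.w i j u * B.w i j v) * (A.w i j (\<ominus> e) * B.w i j (\<ominus> f))"
    unfolding h_def using u v U by (simp add: w_join)
  also have "\<dots> = A.h i j u * B.h i j v"
    unfolding A.h_def B.h_def by (simp only: m corner_simps, rule join_mult) (use u v U in simp_all)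
  finally show ?thesis .
qed

lemma symb_join:
  assumes u: "u \<in> Units (corner R e)" "u' \<in> Units (corner R e)" and v: "v \<in> Units (corner R f)" "v' \<in> Units (corner R f)"
  shows "symb i j (u \<oplus> v) (u' \<oplus> v') = A.symb i j u u' * B.symb i j v v'"
proof -
  have c: "u \<in> carrier (corner R e)" "u' \<in> carrier (corner R e)" "v \<in> carrier (corner R f)" "v' \<in> carrier (corner R f)"
    using u v by simp_all
  then have cR: "u \<in> carrier R" "u' \<in> carrier R" "v \<in> carrier R" "v' \<in> carrier R"
    by (simp_all add: corner_closed)
  have U: "u \<otimes> u' \<in> Units (corner R e)" "v \<otimes> v' \<in> Units (corner R f)"
    using A.Units_m_closed [OF u] B.Units_m_closed [OF v] by simp_all
  have eq: "(u \<oplus> v) \<otimes> (u' \<oplus> v') = u \<otimes> u' \<oplus> v \<otimes> v'"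
    using cR orthogonal [OF c(1,4)] orthogonal [OF c(2,3)] by (simp add: l_distr r_distr)
  have "symb i j (u \<oplus> v) (u' \<oplus> v') = (A.h i j (u \<otimes> u') * B.h i j (v \<otimes> v'))
      * (inverse (A.h i j u) * inverse (B.h i j v)) * (inverse (A.h i j u') * inverse (B.h i j v'))"
    unfolding symb_def eq using u v U join_inverse [of "A.h i j u" "B.h i j v"] join_inverse [of "A.h i j u'" "B.h i j v'"]
    by (simp add: h_join)
  also have "\<dots> = A.symb i j u u' * B.symb i j v v'"
    unfolding A.symb_def B.symb_def by (simp only: corner_simps, rule join_mult3) (use u v U in simp_all)
  finally show ?thesis .
qed

lemma K_join:
  assumes "k \<in> A.K i j" "k' \<in> B.K i j"
  shows "k * k' \<in> K i j"
proof (rule K_mult)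
  have one: "e \<in> Units (corner R e)" "f \<in> Units (corner R f)"
    using A.Units_one_closed B.Units_one_closed by simp_all
  \<comment> \<open>A torus element of one corner is the joined element whose entry in the other
    corner is the identity, where \<open>h\<close> is trivial.\<close>
  have "A.h i j u \<in> K i j" if "u \<in> Units (corner R e)" for u
    using h_join [OF that one(2)] B.h_one [of i j] K_h [OF join_Units(1) [OF that one(2)], of i j] by simp
  then have "A.K i j \<subseteq> K i j" unfolding K_def A.K_def by (intro gspan_subset) blast
  then show "k \<in> K i j" using assms by blast
  have "B.h i j u \<in> K i j" if "u \<in> Units (corner R f)" for u
    using h_join [OF one(1) that] A.h_one [of i j] K_h [OF join_Units(1) [OF one(1) that], of i j] by simp
  then have "B.K i j \<subseteq> K i j" unfolding K_def B.K_def by (intro gspan_subset) blast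
  then show "k' \<in> K i j" using assms by blast
qed

end

lemma rank_one_join:
  assumes A: "A.rank_one" and B: "B.rank_one"
  shows rank_one
  unfolding rank_one_def
proof (intro allI impI)
  fix i j r s t
  assume ij [simp]: "i \<in> D" "j \<in> D" "i \<noteq> j" and rst: "r \<in> carrier R" "s \<in> carrier R" "t \<in> carrier R"
  note [simp] = ij(3) [symmetric]
  have split: "r = e \<otimes> r \<oplus> f \<otimes> r" if "r \<in> carrier R" for r using that by (simp flip: l_distr)
  have mem: "e \<otimes> r \<in> carrier (corner R e)" "f \<otimes> r \<in> carrier (corner R f)" if "r \<in> carrier R" for r
    using that by (simp_all add: corner_mult_closed)
  obtain a b c k where 1: "a \<in> carrier (corner R e)" "b \<in> carrier (corner R e)" "c \<in> carrier (corner R e)" "k \<in> A.K i j"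
    "x j i (e \<otimes> r) * x i j (e \<otimes> s) * x j i (e \<otimes> t) = x i j a * x j i b * k * x i j c"
    by (rule A.rank_oneE [OF A ij mem(1) [OF rst(1)] mem(1) [OF rst(2)] mem(1) [OF rst(3)]])
  obtain a' b' c' k' where 2: "a' \<in> carrier (corner R f)" "b' \<in> carrier (corner R f)" "c' \<in> carrier (corner R f)" "k' \<in> B.K i j"
    "x j i (f \<otimes> r) * x i j (f \<otimes> s) * x j i (f \<otimes> t) = x i j a' * x j i b' * k' * x i j c'"
    by (rule B.rank_oneE [OF B ij mem(2) [OF rst(1)] mem(2) [OF rst(2)] mem(2) [OF rst(3)]])
  note kE = A.K_E [OF ij 1(4)] B.K_E [OF ij 2(4)]
  have xj: "x i j y = x i j (e \<otimes> y) * x i j (f \<otimes> y)" "x j i y = x j i (e \<otimes> y) * x j i (f \<otimes> y)" if "y \<in> carrier R" for y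
    using x_join [of i j "e \<otimes> y" "f \<otimes> y"] x_join [of j i "e \<otimes> y" "f \<otimes> y"] mem [OF that] split [OF that] by simp_all
  have "x j i r * x i j s * x j i t
      = (x j i (e \<otimes> r) * x i j (e \<otimes> s) * x j i (e \<otimes> t)) * (x j i (f \<otimes> r) * x i j (f \<otimes> s) * x j i (f \<otimes> t))"
    unfolding xj(1) [OF rst(2)] xj(2) [OF rst(1)] xj(2) [OF rst(3)] by (rule join_mult3) (use mem rst in simp_all)
  also have "\<dots> = (x i j a * x i j a') * (x j i b * x j i b') * (k * k') * (x i j c * x i j c')"
    unfolding 1(5) 2(5) by (rule join_mult4 [symmetric]) (use 1(1-3) 2(1-3) kE in simp_all)
  also have "\<dots> = x i j (a \<oplus> a') * x j i (b \<oplus> b') * (k * k') * x i j (c \<oplus> c')"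
    using 1(1-3) 2(1-3) by (simp add: x_join)
  finally show "\<exists>a b c k. a \<in> carrier R \<and> b \<in> carrier R \<and> c \<in> carrier R \<and> k \<in> K i j \<and>
      x j i r * x i j s * x j i t = x i j a * x j i b * k * x i j c"
    using 1(1-3) 2(1-3) K_join [OF ij 1(4) 2(4)] unfolding corner_closed by (meson add.m_closed)
qed

lemma Z_split:
  assumes "z \<in> Z"
  shows "\<exists>y\<in>A.Z. \<exists>y'\<in>B.Z. z = y * y'"
  using assms
proof (induction rule: Z_induct)
  case one
  show ?case by (intro bexI [of _ 1]) (auto simp: A.Z_one B.Z_one)
next
  case (mult u v z)
  then obtain y y' where z: "z = y * y'" "y \<in> A.Z" "y' \<in> B.Z" by blast
  let ?p = "A.sy (e \<otimes> u) (e \<otimes> v)" and ?q = "B.sy (f \<otimes> u) (f \<otimes> v)"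
  have pq: "?p \<in> A.Z" "?q \<in> B.Z" using mult by (simp_all add: A.Z_sy B.Z_sy split_Units)
  have "sy u v = ?p * ?q"
    using symb_join [of 1 2 "e \<otimes> u" "e \<otimes> v" "f \<otimes> u" "f \<otimes> v"] mult split_Units [of u] split_Units [of v] by simp
  then have "sy u v * z = (?p * y) * (?q * y')"
    using join_mult [of ?p y ?q y'] A.Z_E [of y] B.Z_E [of y'] A.Z_E [OF pq(1)] B.Z_E [OF pq(2)] z by simp
  then show ?case using pq z A.Z_mult B.Z_mult by blast
qed

text \<open>Elements of different corners commute, so the two products interleave. Membership in
  \<open>A.E\<close> and \<open>B.E\<close> is part of the induction since it yields that
  commutation.\<close>

lemma symbols_join:
  assumes "length ps = length qs" "set ps \<subseteq> Units (corner R e) \<times> Units (corner R e)"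
    "set qs \<subseteq> Units (corner R f) \<times> Units (corner R f)"
  shows "\<exists>rs. length rs = length ps \<and> set rs \<subseteq> Units R \<times> Units R \<and>
    A.sprod ps * B.sprod qs
      = sprod rs
    \<and> A.sprod ps \<in> A.E \<and> B.sprod qs \<in> B.E"
  using assms
proof (induction ps qs rule: list_induct2)
  case Nil
  then show ?case by simp
next
  case (Cons p ps q qs)
  obtain a b a' b' where pq: "p = (a, b)" "q = (a', b')" by force
  have U: "a \<in> Units (corner R e)" "b \<in> Units (corner R e)" "a' \<in> Units (corner R f)" "b' \<in> Units (corner R f)"
    using Cons.prems pq by simp_all
  obtain rs where rs: "length rs = length ps" "set rs \<subseteq> Units R \<times> Units R"
    "A.sprod ps * B.sprod qs
      = sprod rs"
    "A.sprod ps \<in> A.E" "B.sprod qs \<in> B.E"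
    using Cons by auto
  show ?case
  proof (intro exI [of _ "(a \<oplus> a', b \<oplus> b') # rs"] conjI)
    show "A.sprod (p # ps) * B.sprod (q # qs) = sprod ((a \<oplus> a', b \<oplus> b') # rs)"
      using join_mult [of "A.sy a b" "A.sprod ps" "B.sy a' b'"
          "B.sprod qs"] rs(4,5) U pq
      by (simp add: symb_join flip: rs(3))
  qed (use rs U pq join_Units in simp_all)
qed

lemma symbols_bounded_join:
  assumes A: "A.symbols_bounded n" and B: "B.symbols_bounded n"
  shows "symbols_bounded n"
  unfolding symbols_bounded_def
proof (intro conjI ballI)
  show rank_one using A B by (intro rank_one_join) (auto simp: A.symbols_bounded_def B.symbols_bounded_def)
  fix z assume "z \<in> Z"
  then obtain y y' where y: "y \<in> A.Z" "y' \<in> B.Z" "z = y * y'" using Z_split by blast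
  obtain ps where ps: "length ps = n" "set ps \<subseteq> Units (corner R e) \<times> Units (corner R e)"
    "y = A.sprod ps" using A y(1) unfolding A.symbols_bounded_def by blast
  obtain qs where qs: "length qs = n" "set qs \<subseteq> Units (corner R f) \<times> Units (corner R f)"
    "y' = B.sprod qs" using B y(2) unfolding B.symbols_bounded_def by blast
  show "\<exists>ps. length ps = n \<and> set ps \<subseteq> Units R \<times> Units R \<and> z = sprod ps"
    using symbols_join [OF _ ps(2) qs(2)] ps(1,3) qs(1,3) y(3) by auto
qed

end

end

lemma (in cring) generate_ring_corner:
  assumes e: "e \<in> carrier R" "e \<otimes> e = e" and S: "S \<subseteq> carrier R" "generate_ring R S = carrier R"
  shows "generate_ring (corner R e) ((\<lambda>r. e \<otimes> r) ` S) = carrier (corner R e)"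
proof
  interpret C: cring "corner R e" by (rule cring_corner [OF e])
  show "generate_ring (corner R e) ((\<lambda>r. e \<otimes> r) ` S) \<subseteq> carrier (corner R e)"
    by (rule C.generate_ring_incl) (use S corner_mult_closed [OF e] in auto)
  have "r \<in> carrier R \<and> e \<otimes> r \<in> generate_ring (corner R e) ((\<lambda>r. e \<otimes> r) ` S)" if "r \<in> generate_ring R S" for r
    using that
  proof (induction rule: generate_ring.induct)
    case one
    then show ?case using e generate_ring.one [of "corner R e"] by simp
  next
    case (incl r)
    then show ?case using S by (auto intro: generate_ring.incl)
  next
    case (a_inv r)
    then show ?case
      using generate_ring.a_inv [of "e \<otimes> r" "corner R e"] corner_minus [OF e, of "e \<otimes> r"] e
      by (simp add: corner_mult_closed r_minus)
  next
    case (eng_add r s)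
    then show ?case
      using generate_ring.eng_add [of "e \<otimes> r" "corner R e" _ "e \<otimes> s"] e by (simp add: r_distr)
  next
    case (eng_mult r s)
    have "e \<otimes> r \<otimes> (e \<otimes> s) = e \<otimes> e \<otimes> (r \<otimes> s)" using eng_mult e(1) by (simp add: m_ac)
    then show ?case
      using eng_mult generate_ring.eng_mult [of "e \<otimes> r" "corner R e" _ "e \<otimes> s"] e by simp
  qed
  then show "carrier (corner R e) \<subseteq> generate_ring (corner R e) ((\<lambda>r. e \<otimes> r) ` S)"
    using S(2) by (auto simp: corner_def)
qed

text \<open>Induction on the size of the ring, with the group and \<open>x\<close> fixed. A
  nontrivial idempotent splits the ring into two smaller corners, each generated by the images of
  the given generators, so the length of the list does not change.\<close>

lemma symbols_bounded_finite:
  fixes R :: "('a, 'b) ring_scheme" and x :: "nat \<Rightarrow> nat \<Rightarrow> 'a \<Rightarrow> 'g :: grp"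
  assumes "steinberg_rep R d x" "finite (carrier R)" "set gens \<subseteq> carrier R" "generate_ring R (set gens) = carrier R"
  shows "steinberg_rep.symbols_bounded R d x (length gens + 2)"
  using assms
proof (induction "card (carrier R)" arbitrary: R gens rule: less_induct)
  case less
  interpret steinberg_rep R d x by (rule less.prems)
  note fin = less.prems(2)
  show ?case
  proof (cases "\<one>\<^bsub>R\<^esub> = \<zero>\<^bsub>R\<^esub> \<or> (\<forall>e\<in>carrier R. e \<otimes>\<^bsub>R\<^esub> e = e \<longrightarrow> e = \<zero>\<^bsub>R\<^esub> \<or> e = \<one>\<^bsub>R\<^esub>)")
    case True
    then show ?thesis using symbols_bounded_zero_ring symbols_bounded_local less.prems by blast
  next
    case False
    then obtain e where e: "e \<in> carrier R" "e \<otimes>\<^bsub>R\<^esub> e = e" "e \<noteq> \<zero>\<^bsub>R\<^esub>" "e \<noteq> \<one>\<^bsub>R\<^esub>" by blast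
    define f where "f = \<one>\<^bsub>R\<^esub> \<ominus>\<^bsub>R\<^esub> e"
    have f: "f \<in> carrier R" using e by (simp add: f_def)
    have ef: "e \<otimes>\<^bsub>R\<^esub> f = \<zero>\<^bsub>R\<^esub>" "e \<oplus>\<^bsub>R\<^esub> f = \<one>\<^bsub>R\<^esub>"
      using e by (simp_all add: f_def minus_eq r_distr r_minus r_neg a_lcomm [of e])
    have ff: "f \<otimes>\<^bsub>R\<^esub> f = f"
    proof -
      have "f = (e \<oplus>\<^bsub>R\<^esub> f) \<otimes>\<^bsub>R\<^esub> f" using f ef by simp
      also have "\<dots> = f \<otimes>\<^bsub>R\<^esub> f" using e(1) f ef(1) by (simp add: l_distr del: ef)
      finally show ?thesis by simp
    qed
    have f1: "f \<noteq> \<one>\<^bsub>R\<^esub>"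
    proof
      assume "f = \<one>\<^bsub>R\<^esub>"
      then show False using ef(1) e(1,3) by simp
    qed
    have symbols_bounded: "steinberg_rep.symbols_bounded (corner R g) d x (length gens + 2)"
      if g: "g \<in> carrier R" "g \<otimes>\<^bsub>R\<^esub> g = g" "g \<noteq> \<one>\<^bsub>R\<^esub>" for g
    proof -
      have sub: "carrier (corner R g) \<subset> carrier R"
      proof
        show "carrier (corner R g) \<subseteq> carrier R" by (rule subsetI) (simp add: corner_carrier [OF g(1,2)])
        have "\<one>\<^bsub>R\<^esub> \<notin> carrier (corner R g)" using g(1,3) by (simp add: corner_carrier [OF g(1,2)])
        then show "carrier (corner R g) \<noteq> carrier R" using one_closed by metis
      qed
      have "steinberg_rep.symbols_bounded (corner R g) d x (length (map (\<lambda>r. g \<otimes>\<^bsub>R\<^esub> r) gens) + 2)"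
      proof (rule less.hyps)
        show "card (carrier (corner R g)) < card (carrier R)"
          using sub fin by (rule psubset_card_mono [rotated])
        show "steinberg_rep (corner R g) d x" by (rule steinberg_rep_corner [OF g(1,2)])
        show "finite (carrier (corner R g))" using sub fin by (rule finite_subset [OF psubset_imp_subset])
        show "set (map (\<lambda>r. g \<otimes>\<^bsub>R\<^esub> r) gens) \<subseteq> carrier (corner R g)"
          using less.prems(3) g(1,2) by (auto simp: corner_mult_closed)
        show "generate_ring (corner R g) (set (map (\<lambda>r. g \<otimes>\<^bsub>R\<^esub> r) gens)) = carrier (corner R g)"
          using generate_ring_corner [OF g(1,2) less.prems(3,4)] by simp
      qed
      then show ?thesis by simp
    qed
    show ?thesis
      using symbols_bounded_join [OF e(1,2) f ff ef symbols_bounded [OF e(1,2,4)] symbols_bounded [OF f ff f1]] .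
  qed
qed

section \<open>The big cell\<close>

context steinberg_rep
begin

lemma H_mult: "g \<in> H \<Longrightarrow> k \<in> H \<Longrightarrow> g * k \<in> H"
  unfolding H_def by (rule gspan_mult)

lemma H_inverse: "g \<in> H \<Longrightarrow> inverse g \<in> H"
  unfolding H_def by (rule gspan_inverse)

text \<open>The function \<rho> orders the indices: \<open>id\<close> yields upper and
  \<open>\<lambda>k. d - k\<close> lower triangular elements, so that each lemma serves both. The
  set \<open>P\<close> selects some of the positive roots.\<close>

definition rootset :: "(nat \<Rightarrow> nat) \<Rightarrow> (nat \<times> nat) set \<Rightarrow> 'g set" where
  "rootset \<rho> P = gspan {x k l r | k l r. k \<in> D \<and> l \<in> D \<and> \<rho> k < \<rho> l \<and> (k, l) \<in> P \<and> r \<in> carrier R}"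

abbreviation U :: "(nat \<Rightarrow> nat) \<Rightarrow> 'g set" where
  "U \<rho> \<equiv> rootset \<rho> UNIV"

lemma rootset_x: "k \<in> D \<Longrightarrow> l \<in> D \<Longrightarrow> \<rho> k < \<rho> l \<Longrightarrow> (k, l) \<in> P \<Longrightarrow> r \<in> carrier R \<Longrightarrow> x k l r \<in> rootset \<rho> P"
  unfolding rootset_def by (rule gspan_base) blast

lemma rootset_mult: "g \<in> rootset \<rho> P \<Longrightarrow> k \<in> rootset \<rho> P \<Longrightarrow> g * k \<in> rootset \<rho> P"
  unfolding rootset_def by (rule gspan_mult)

lemma rootset_inverse: "g \<in> rootset \<rho> P \<Longrightarrow> inverse g \<in> rootset \<rho> P"
  unfolding rootset_def by (rule gspan_inverse)

lemma rootset_one: "1 \<in> rootset \<rho> P"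
  unfolding rootset_def by simp

lemma rootset_mono: "P \<subseteq> Q \<Longrightarrow> rootset \<rho> P \<subseteq> rootset \<rho> Q"
  unfolding rootset_def by (rule gspan_mono) blast

lemma rootset_E: "g \<in> rootset \<rho> P \<Longrightarrow> g \<in> E"
proof -
  have "{x k l r | k l r. k \<in> D \<and> l \<in> D \<and> \<rho> k < \<rho> l \<and> (k, l) \<in> P \<and> r \<in> carrier R}
      \<subseteq> {x i j r | i j r. i \<in> D \<and> j \<in> D \<and> i \<noteq> j \<and> r \<in> carrier R}"
    by force
  then show "g \<in> rootset \<rho> P \<Longrightarrow> g \<in> E"
    unfolding rootset_def E_def using gspan_mono by blast
qed

lemma rootset_induct [consumes 1, case_names one mult]:
  assumes "g \<in> rootset \<rho> P" "Q 1"
    and mult: "\<And>k l r g. k \<in> D \<Longrightarrow> l \<in> D \<Longrightarrow> k \<noteq> l \<Longrightarrow> \<rho> k < \<rho> l \<Longrightarrow> (k, l) \<in> P \<Longrightarrow> r \<in> carrier R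
      \<Longrightarrow> g \<in> rootset \<rho> P \<Longrightarrow> Q g \<Longrightarrow> Q (x k l r * g)"
  shows "Q g"
  using assms(1) unfolding rootset_def
proof (induction rule: gspan_symmetric_induct)
  case (inverse s)
  then obtain k l r where "s = x k l r" "k \<in> D" "l \<in> D" "\<rho> k < \<rho> l" "(k, l) \<in> P" "r \<in> carrier R" by blast
  moreover from this have "inverse s = x k l (\<ominus> r)" by (subst x_minus) auto
  ultimately show ?case using a_inv_closed by blast
qed (use assms(2) mult in \<open>auto simp: rootset_def\<close>)

lemma H_rootset: "g \<in> H \<Longrightarrow> y \<in> rootset \<rho> P \<Longrightarrow> gconj g y \<in> rootset \<rho> P"
  unfolding rootset_def
proof (rule gconj_gspan)
  fix s assume "g \<in> H" "s \<in> {x k l r |k l r. k \<in> D \<and> l \<in> D \<and> \<rho> k < \<rho> l \<and> (k, l) \<in> P \<and> r \<in> carrier R}"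
  then obtain k l r where s: "g \<in> H" "s = x k l r" "k \<in> D" "l \<in> D" "\<rho> k < \<rho> l" "(k, l) \<in> P" "r \<in> carrier R" by blast
  then obtain r' where "r' \<in> carrier R" "gconj g s = x k l r'" using H_scale [of g k l r] by auto
  then show "gconj g s \<in> gspan {x k l r |k l r. k \<in> D \<and> l \<in> D \<and> \<rho> k < \<rho> l \<and> (k, l) \<in> P \<and> r \<in> carrier R}"
    using s rootset_x [of k l \<rho> P r'] by (simp add: rootset_def)
qed

context
  fixes \<rho> :: "nat \<Rightarrow> nat" and i j :: nat
  assumes inj: "inj_on \<rho> D" and ij: "i \<in> D" "j \<in> D" and adjacent: "\<rho> j = Suc (\<rho> i)"
begin

lemma adjacent_less:
  assumes "k \<in> D"
  shows "\<rho> k < \<rho> j \<Longrightarrow> k \<noteq> i \<Longrightarrow> \<rho> k < \<rho> i" "\<rho> i < \<rho> k \<Longrightarrow> k \<noteq> j \<Longrightarrow> \<rho> j < \<rho> k"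
proof -
  have "\<rho> k \<noteq> \<rho> i" if "k \<noteq> i" using inj assms ij that by (auto dest: inj_onD)
  then show "\<rho> k < \<rho> j \<Longrightarrow> k \<noteq> i \<Longrightarrow> \<rho> k < \<rho> i" using adjacent by fastforce
  have "\<rho> k \<noteq> \<rho> j" if "k \<noteq> j" using inj assms ij that by (auto dest: inj_onD)
  then show "\<rho> i < \<rho> k \<Longrightarrow> k \<noteq> j \<Longrightarrow> \<rho> j < \<rho> k" using adjacent by fastforce
qed

text \<open>For neighbours \<open>i\<close>, \<open>j\<close> in the order, the remaining positive
  roots form the unipotent radical of a minimal parabolic: adding (i, j) or (j, i) to one of them
  never leads out of this set, since no index lies strictly between.\<close>

lemma conj_unipotent_radical:
  assumes y: "y \<in> rootset \<rho> (- {(i, j)})" and r: "r \<in> carrier R"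
  shows "gconj (x i j r) y \<in> rootset \<rho> (- {(i, j)})" "gconj (x j i r) y \<in> rootset \<rho> (- {(i, j)})"
proof -
  let ?V = "rootset \<rho> (- {(i, j)})"
  have ne: "i \<noteq> j" using adjacent by auto
  have gen: "gconj (x i j r) (x k l s) \<in> ?V \<and> gconj (x j i r) (x k l s) \<in> ?V"
    if kl: "k \<in> D" "l \<in> D" "\<rho> k < \<rho> l" "(k, l) \<noteq> (i, j)" "s \<in> carrier R" for k l s
  proof
    have kne: "k \<noteq> l" using kl by auto
    have V: "x k l s \<in> ?V" using kl by (intro rootset_x) auto
    consider "j = k" "i \<noteq> l" | "i = l" "j \<noteq> k" | "j \<noteq> k" "i \<noteq> l" using kl(3) adjacent by fastforce
    then show "gconj (x i j r) (x k l s) \<in> ?V"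
    proof cases
      case 1
      then have "x i l (r \<otimes> s) \<in> ?V" using kl ij r adjacent kne by (intro rootset_x) auto
      moreover have "gconj (x i j r) (x k l s) = x i l (r \<otimes> s) * x k l s"
        unfolding 1(1) [symmetric] using 1 kl ij r ne kne by (intro conj_x_right) auto
      ultimately show ?thesis using V by (simp add: rootset_mult)
    next
      case 2
      then have "x k j (\<ominus> (s \<otimes> r)) \<in> ?V" using kl ij r adjacent kne by (intro rootset_x) auto
      moreover have "gconj (x i j r) (x k l s) = x k j (\<ominus> (s \<otimes> r)) * x k l s"
        unfolding 2(1) [symmetric] using 2 kl ij r ne kne by (intro conj_x_left) auto
      ultimately show ?thesis using V by (simp add: rootset_mult)
    next
      case 3
      then show ?thesis using V kl ij r ne kne by (subst conj_x_commute) auto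
    qed
    consider "i = k" "j \<noteq> l" | "j = l" "i \<noteq> k" | "i \<noteq> k" "j \<noteq> l" using kl(4) by blast
    then show "gconj (x j i r) (x k l s) \<in> ?V"
    proof cases
      case 1
      then have "x j l (r \<otimes> s) \<in> ?V" using kl ij r ne adjacent_less(2) [of l] by (intro rootset_x) auto
      moreover have "gconj (x j i r) (x k l s) = x j l (r \<otimes> s) * x k l s"
        unfolding 1(1) [symmetric] using 1 kl ij r ne kne by (intro conj_x_right) auto
      ultimately show ?thesis using V by (simp add: rootset_mult)
    next
      case 2
      then have "x k i (\<ominus> (s \<otimes> r)) \<in> ?V" using kl ij r ne adjacent_less(1) [of k] by (intro rootset_x) auto
      moreover have "gconj (x j i r) (x k l s) = x k i (\<ominus> (s \<otimes> r)) * x k l s"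
        unfolding 2(1) [symmetric] using 2 kl ij r ne kne by (intro conj_x_left) auto
      ultimately show ?thesis using V by (simp add: rootset_mult)
    next
      case 3
      then show ?thesis using V kl ij r ne kne by (subst conj_x_commute) auto
    qed
  qed
  then have "gconj (x i j r) s \<in> ?V \<and> gconj (x j i r) s \<in> ?V"
    if "s \<in> {x k l r |k l r. k \<in> D \<and> l \<in> D \<and> \<rho> k < \<rho> l \<and> (k, l) \<in> - {(i, j)} \<and> r \<in> carrier R}" for s
    using that by blast
  then show "gconj (x i j r) y \<in> ?V" "gconj (x j i r) y \<in> ?V"
    using gconj_gspan [OF _ y [unfolded rootset_def]] unfolding rootset_def by blast+
qed

text \<open>All factors \<open>x i j\<close> are collected in front; the factors that they pass are
  conjugated within the unipotent radical.\<close>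

lemma U_factor:
  assumes "u \<in> U \<rho>"
  obtains r v where "r \<in> carrier R" "v \<in> rootset \<rho> (- {(i, j)})" "u = x i j r * v"
proof -
  let ?V = "rootset \<rho> (- {(i, j)})"
  have ne: "i \<noteq> j" using adjacent by auto
  have "\<exists>r\<in>carrier R. \<exists>v\<in>?V. u = x i j r * v"
    using assms
  proof (induction rule: rootset_induct)
    case one
    show ?case using ne ij rootset_one x_zero [of i j] by (intro bexI [of _ \<zero>] bexI [of _ 1]) auto
  next
    case (mult k l s g)
    then obtain r v where g: "r \<in> carrier R" "v \<in> ?V" "g = x i j r * v" by blast
    show ?case
    proof (cases "(k, l) = (i, j)")
      case True
      then show ?thesis using g mult ne
        by (intro bexI [of _ "s \<oplus> r"] bexI [of _ v]) (auto simp: x_add_left)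
    next
      case False
      have inv: "x i j (\<ominus> r) = inverse (x i j r)" using g ij ne by (simp add: x_minus)
      have "x k l s * g = x i j r * (gconj (x i j (\<ominus> r)) (x k l s) * v)"
        unfolding g(3) inv by (simp add: gconj_def mult.assoc)
      moreover have "gconj (x i j (\<ominus> r)) (x k l s) \<in> ?V"
        using mult False g by (intro conj_unipotent_radical rootset_x) auto
      ultimately show ?thesis using g rootset_mult by blast
    qed
  qed
  then show ?thesis using that by blast
qed

end

definition cell :: "'g set" where
  "cell = {u * n * g * u' | u n g u'. u \<in> U id \<and> n \<in> U (\<lambda>k. d - k) \<and> g \<in> H \<and> u' \<in> U id}"

text \<open>Adjacent indices are neighbours for both orders, so \<open>x i (Suc i)\<close> can be
  split off from the upper factor and \<open>x (Suc i) i\<close> from the lower one, the remaining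
  parts being normalized by both root subgroups. What is left in the middle is the rank one
  situation.\<close>

lemma cell_simple:
  assumes R1: rank_one and i: "i \<in> D" "Suc i \<in> D" and r: "r \<in> carrier R" and y: "y \<in> cell"
  shows "x (Suc i) i r * y \<in> cell"
proof -
  let ?j = "Suc i" and ?n = "\<lambda>k. d - k"
  let ?V = "rootset id (- {(i, Suc i)})" and ?W = "rootset ?n (- {(Suc i, i)})"
  have p: "inj_on id D" "id ?j = Suc (id i)" by simp_all
  have n: "inj_on ?n D" "?n i = Suc (?n ?j)"
    using i by (auto simp: inj_on_def atLeastAtMost_iff)
  obtain u m g u' where y: "y = u * m * g * u'" "u \<in> U id" "m \<in> U ?n" "g \<in> H" "u' \<in> U id"
    using y by (auto simp: cell_def)
  obtain s v where u: "s \<in> carrier R" "v \<in> ?V" "u = x i ?j s * v"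
    using U_factor [OF p(1) i p(2) y(2)] .
  obtain t v' where m: "t \<in> carrier R" "v' \<in> ?W" "m = x ?j i t * v'"
    using U_factor [OF n(1) i(2,1) n(2) y(3)] .
  obtain a b c k where abc: "a \<in> carrier R" "b \<in> carrier R" "c \<in> carrier R" "k \<in> K i ?j"
    "x ?j i r * x i ?j s * x ?j i t = x i ?j a * x ?j i b * k * x i ?j c"
    by (rule rank_oneE [OF R1 i n_not_Suc_n r u(1) m(1)])
  have kH: "k \<in> H" using K_H [of i ?j] i abc(4) by auto
  define v1 where "v1 = gconj (x ?j i r) (gconj (x i ?j s) v)"
  have v1: "v1 \<in> ?V"
    unfolding v1_def using conj_unipotent_radical [OF p(1) i p(2)] u r by blast
  define v2 where "v2 = gconj k (gconj (x i ?j c) v')"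
  have v2: "v2 \<in> ?W"
    unfolding v2_def using conj_unipotent_radical [OF n(1) i(2,1) n(2)] m(2) abc(3) kH H_rootset by blast
  obtain c' where c': "c' \<in> carrier R" "gconj (inverse g) (x i ?j c) = x i ?j c'"
    using H_scale [OF H_inverse [OF y(4)], of i ?j c] i abc(3) by auto
  then have gc: "x i ?j c * g = g * x i ?j c'"
    by (simp add: gconj_def mult.assoc grp_left_inverse flip: c'(2))
  have "x ?j i r * y = (x ?j i r * x i ?j s * v) * x ?j i t * v' * g * u'"
    unfolding y(1) u(3) m(3) by (simp add: mult.assoc)
  also have "x ?j i r * x i ?j s * v = v1 * (x ?j i r * x i ?j s)"
    unfolding v1_def by (simp add: gconj_def mult.assoc grp_left_inverse)
  also have "v1 * (x ?j i r * x i ?j s) * x ?j i t * v' * g * u'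
      = v1 * (x ?j i r * x i ?j s * x ?j i t) * v' * g * u'"
    by (simp add: mult.assoc)
  also have "\<dots> = v1 * x i ?j a * x ?j i b * (k * x i ?j c * v') * g * u'"
    unfolding abc(5) by (simp add: mult.assoc)
  also have "k * x i ?j c * v' = v2 * (k * x i ?j c)"
    unfolding v2_def by (simp add: gconj_def mult.assoc grp_left_inverse)
  also have "v1 * x i ?j a * x ?j i b * (v2 * (k * x i ?j c)) * g * u'
      = v1 * x i ?j a * (x ?j i b * v2) * k * (x i ?j c * g) * u'"
    by (simp add: mult.assoc)
  also have "\<dots> = (v1 * x i ?j a) * (x ?j i b * v2) * (k * g) * (x i ?j c' * u')"
    unfolding gc by (simp add: mult.assoc)
  also have "\<dots> \<in> cell"
  proof -
    have "v1 * x i ?j a \<in> U id"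
      using v1 rootset_mono [of "- {(i, Suc i)}" UNIV id] abc i by (intro rootset_mult rootset_x) auto
    moreover have "x ?j i b * v2 \<in> U ?n"
      using v2 rootset_mono [of "- {(Suc i, i)}" UNIV ?n] abc i n(2) by (intro rootset_mult rootset_x) auto
    moreover have "k * g \<in> H" using kH y(4) by (rule H_mult)
    moreover have "x i ?j c' * u' \<in> U id"
      using y(5) c' i by (intro rootset_mult rootset_x) auto
    ultimately show ?thesis unfolding cell_def by blast
  qed
  finally show ?thesis .
qed

lemma cell_upper:
  assumes "i \<in> D" "j \<in> D" "i < j" "r \<in> carrier R" "y \<in> cell"
  shows "x i j r * y \<in> cell"
proof -
  obtain u m g u' where y: "y = u * m * g * u'" "u \<in> U id" "m \<in> U (\<lambda>k. d - k)" "g \<in> H" "u' \<in> U id"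
    using assms(5) by (auto simp: cell_def)
  have "x i j r * y = (x i j r * u) * m * g * u'" unfolding y(1) by (simp add: mult.assoc)
  moreover have "x i j r * u \<in> U id" using assms y by (intro rootset_mult rootset_x) auto
  ultimately show ?thesis using y unfolding cell_def by blast
qed

text \<open>A root element with larger index difference is a commutator of an adjacent one and one
  of smaller difference, and for these the claim is known on the whole cell.\<close>

lemma cell_lower:
  assumes R1: rank_one and "j \<in> D" "j + m \<in> D" "0 < m" "r \<in> carrier R" "y \<in> cell"
  shows "x (j + m) j r * y \<in> cell"
  using assms(3-)
proof (induction m arbitrary: r y)
  case (Suc m)
  show ?case
  proof (cases "m = 0")
    case True
    then show ?thesis using cell_simple [OF R1, of j] Suc assms(2) by simp
  next
    case False
    let ?i = "j + Suc m" and ?k = "j + m"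
    have D: "?i \<in> D" "?k \<in> D" "Suc ?k \<in> D" using Suc.prems(1) assms(2) by (auto simp: atLeastAtMost_iff)
    have "x ?i j r = x ?i ?k r * x ?k j \<one> * inverse (x ?i ?k r) * inverse (x ?k j \<one>)"
      using D assms(2) Suc.prems False by (subst x_comm) auto
    also have "\<dots> = x ?i ?k r * x ?k j \<one> * x ?i ?k (\<ominus> r) * x ?k j (\<ominus> \<one>)"
      using D assms(2) Suc.prems False by (simp add: x_minus)
    finally have "x ?i j r * y = x (Suc ?k) ?k r * (x ?k j \<one> * (x (Suc ?k) ?k (\<ominus> r) * (x ?k j (\<ominus> \<one>) * y)))"
      by (simp add: mult.assoc)
    also have "\<dots> \<in> cell"
      using False D Suc.prems by (intro cell_simple [OF R1] Suc.IH) auto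
    finally show ?thesis .
  qed
qed simp

lemma E_cell:
  assumes R1: rank_one and "g \<in> E"
  shows "g \<in> cell"
proof -
  have x: "x i j r * y \<in> cell" if "i \<in> D" "j \<in> D" "i \<noteq> j" "r \<in> carrier R" "y \<in> cell" for i j r y
  proof (cases "i < j")
    case False
    then show ?thesis using cell_lower [OF R1, of j "i - j" r y] that by simp
  qed (use that cell_upper in blast)
  show ?thesis using assms(2)
  proof (induction rule: E_induct)
    case one
    have "1 \<in> H" by (simp add: H_def)
    then have "1 * 1 * 1 * 1 \<in> cell" unfolding cell_def using rootset_one by blast
    then show ?case by simp
  qed (use x in blast)
qed

section \<open>A normal form for the torus\<close>

lemma h_compose:
  assumes ij: "i \<in> D" "j \<in> D" "k \<in> D" "i \<noteq> j" "j \<noteq> k" "i \<noteq> k" and u: "u \<in> Units R"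
  shows "h k j u = h i j u * h k i u"
proof -
  note [simp] = ij ij(4-6) [symmetric] u
  \<comment> \<open>Conjugation with \<open>w i j (\<ominus> \<one>)\<close> renames
    \<open>i\<close> to \<open>j\<close>; rearranging the conjugate leaves \<open>h i j u\<close> as
    correction factor.\<close>
  have "h k j u = gconj (w i j (\<ominus> \<one>)) (h k i u)"
    by (simp add: h_def w_def [of k] gconj_mult conj_w_ki conj_w_ik l_minus r_minus)
  also have "\<dots> = w i j (\<ominus> \<one>) * gconj (h k i u) (w i j \<one>) * h k i u"
    by (simp add: gconj_def w_minus grp_simps)
  also have "gconj (h k i u) (w i j \<one>) = w i j (inv u)"
    by (simp add: w_def gconj_mult conj_h weight_def r_minus)
  also have "w i j (\<ominus> \<one>) * w i j (inv u) = gconj (w i j (\<ominus> \<one>)) (w i j (inv u)) * w i j (\<ominus> \<one>)"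
    by (rule mult_gconj)
  also have "gconj (w i j (\<ominus> \<one>)) (w i j (inv u)) = w i j u"
    by (simp add: conj_w_w' l_minus)
  also have "w i j u * w i j (\<ominus> \<one>) = h i j u" by (simp add: h_def)
  finally show ?thesis .
qed

text \<open>A normal form modulo symbols: one factor \<open>h 1 l\<close> for each listed index and
  a final element of \<open>Z\<close>. With distinct indices each parameter can be read off the
  diagonal of the matrix.\<close>

primrec torus :: "nat list \<Rightarrow> 'g set" where
  "torus [] = Z"
| "torus (l # ls) = {h 1 l u * n | u n. u \<in> Units R \<and> n \<in> torus ls}"

lemma torus_E: "set ls \<subseteq> D - {1} \<Longrightarrow> n \<in> torus ls \<Longrightarrow> n \<in> E"
  by (induction ls arbitrary: n) (auto simp: Z_E)

lemma torus_ConsI: "u \<in> Units R \<Longrightarrow> n \<in> torus ls \<Longrightarrow> h 1 l u * n \<in> torus (l # ls)"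
  by auto

lemma torus_Z:
  assumes "set ls \<subseteq> D - {1}" "z \<in> Z" "n \<in> torus ls"
  shows "z * n \<in> torus ls"
  using assms(1,3)
proof (induction ls arbitrary: n)
  case Nil
  then show ?case using assms(2) by (simp add: Z_mult)
next
  case (Cons l ls)
  then obtain u n' where n: "n = h 1 l u * n'" "u \<in> Units R" "n' \<in> torus ls" by auto
  have "z * h 1 l u = h 1 l u * z" using assms(2) n Cons.prems by (intro Z_commute h_E) auto
  then have "z * n = h 1 l u * (z * n')" unfolding n(1) by (metis mult.assoc)
  moreover have "z * n' \<in> torus ls" using Cons n by simp
  ultimately show ?case using torus_ConsI [of u _ ls l] n by simp
qed

text \<open>Moving \<open>h 1 l v\<close> into its place costs a symbol for every factor it passes,
  and merging it with the factor of the same index costs one more; \<open>torus_Z\<close> absorbs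
  the symbols.\<close>

lemma torus_h:
  assumes "set ls \<subseteq> D - {1}" "l \<in> set ls" "v \<in> Units R" "n \<in> torus ls"
  shows "h 1 l v * n \<in> torus ls"
  using assms(1,2,4)
proof (induction ls arbitrary: n)
  case (Cons k ls)
  then obtain u n' where n: "n = h 1 k u * n'" "u \<in> Units R" "n' \<in> torus ls" by auto
  have k: "k \<in> D" "1 \<noteq> k" and l: "l \<in> D" "1 \<noteq> l" using Cons.prems by auto
  show ?case
  proof (cases "l = k")
    case True
    have "h 1 k (u \<otimes> v) = sy u v * h 1 k v * h 1 k u"
      using k n assms(3) by (intro h_mult) auto
    then have "h 1 k v * h 1 k u = sy v u * h 1 k (u \<otimes> v)"
      using inverse_sy [of u v] n assms(3) by (metis inverse_cancel_left mult.assoc)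
    then have "h 1 l v * n = sy v u * (h 1 k (u \<otimes> v) * n')"
      by (simp add: n(1) True flip: mult.assoc)
    moreover have "h 1 k (u \<otimes> v) * n' \<in> torus (k # ls)"
      using n assms(3) by (intro torus_ConsI) simp_all
    ultimately show ?thesis
      using torus_Z [of "k # ls" "sy v u"] Cons.prems Z_sy n assms(3) by simp
  next
    case False
    have "sy v u = gcomm (h 1 l v) (h 1 k u)"
      using k l n assms(3) False by (intro sy_commutator) auto
    then have "h 1 l v * h 1 k u = sy v u * (h 1 k u * h 1 l v)"
      by (simp add: gcomm_def grp_simps)
    then have "h 1 l v * n = sy v u * (h 1 k u * (h 1 l v * n'))"
      by (simp add: n(1) flip: mult.assoc)
    moreover have "h 1 k u * (h 1 l v * n') \<in> torus (k # ls)"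
      using Cons n False by (intro torus_ConsI) simp_all
    ultimately show ?thesis
      using torus_Z [of "k # ls" "sy v u"] Cons.prems Z_sy n assms(3) by simp
  qed
qed simp

lemma H_torus:
  assumes "g \<in> H"
  shows "g \<in> torus [2..<Suc d]"
proof -
  define ls where "ls = [2..<Suc d]"
  let ?S = "{h 1 l u | l u. l \<in> D \<and> 1 \<noteq> l \<and> u \<in> Units R}"
  have ls: "set ls = D - {1}" by (auto simp: ls_def atLeastAtMost_iff)
  have base: "h 1 l u \<in> gspan ?S" if "l \<in> D" "1 \<noteq> l" "u \<in> Units R" for l u
    by (rule gspan_base) (use that in blast)
  have K1: "K 1 l \<subseteq> gspan ?S" if "l \<in> D" "1 \<noteq> l" for l
    unfolding K_def by (rule gspan_mono) (use that in blast)
  have "h i j u \<in> gspan ?S" if ij: "i \<in> D" "j \<in> D" "i \<noteq> j" and u: "u \<in> Units R" for i j u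
  proof -
    consider "i = 1" | "j = 1" | "i \<noteq> 1" "j \<noteq> 1" by blast
    then show ?thesis
    proof cases
      case 1
      then show ?thesis using base ij u by simp
    next
      case 2
      then have "h i j u \<in> K 1 i" using K_h [OF u, of i j] K_swap [of 1 i] ij by auto
      then show ?thesis using K1 [of i] ij 2 by auto
    next
      case 3
      then have "h i j u = h 1 j u * inverse (h 1 i u)"
        using h_compose [of i j 1 u] ij u by (simp add: grp_simps)
      then show ?thesis using base [of j u] base [of i u] ij u 3 by (simp add: gspan_mult gspan_inverse)
    qed
  qed
  then have g: "g \<in> gspan ?S" using assms gspan_subset [of "{h i j u |i j u. i \<in> D \<and> j \<in> D \<and> i \<noteq> j \<and> u \<in> Units R}" ?S]
    unfolding H_def by blast
  have one: "1 \<in> torus ls" if "set ls \<subseteq> D - {1}" for ls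
    using that
  proof (induction ls)
    case (Cons l ls)
    then show ?case using torus_ConsI [of \<one> 1 ls l] by (auto simp: h_one)
  qed (simp add: Z_one)
  show ?thesis using g unfolding ls_def [symmetric]
  proof (induction rule: gspan.induct)
    case gspan_one
    show ?case using one ls by simp
  next
    case (gspan_mult_left s g)
    then show ?case using torus_h [of ls] ls by auto
  next
    case (gspan_inverse_left s g)
    then obtain l u where s: "s = h 1 l u" "l \<in> D" "1 \<noteq> l" "u \<in> Units R" by blast
    have "h 1 l (u \<otimes> inv u) = sy u (inv u) * h 1 l (inv u) * h 1 l u"
      using s by (intro h_mult) auto
    then have "inverse s = sy u (inv u) * h 1 l (inv u)"
      using s by (metis h_one Units_r_inv D123(1) grp_inverse_unique grp_inverse_inverse grp_left_inverse grp_right_cancel)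
    then have "inverse s * g = sy u (inv u) * (h 1 l (inv u) * g)" by (simp add: mult.assoc)
    then show ?case
      using torus_Z [of ls "sy u (inv u)"] torus_h [of ls l "inv u" g] ls s gspan_inverse_left Z_sy by simp
  qed
qed

end

section \<open>The kernel\<close>

text \<open>Apart from the identity matrix and closure, only the row operation effected by left
  multiplication with a root element is postulated. The comparisons of matrices below build elements
  from the left, so matrix products do not appear.\<close>

locale steinberg_matrix = steinberg_rep R d x
  for R :: "('a, 'b) ring_scheme" (structure) and d :: nat and x :: "nat \<Rightarrow> nat \<Rightarrow> 'a \<Rightarrow> 'g :: grp" +
  fixes M :: "'g \<Rightarrow> nat \<times> nat \<Rightarrow> 'a"
  assumes M_one: "a \<in> D \<Longrightarrow> c \<in> D \<Longrightarrow> M 1 (a, c) = (if a = c then \<one> else \<zero>)"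
    and M_closed: "g \<in> E \<Longrightarrow> a \<in> D \<Longrightarrow> c \<in> D \<Longrightarrow> M g (a, c) \<in> carrier R"
    and M_x: "\<lbrakk>g \<in> E; i \<in> D; j \<in> D; i \<noteq> j; r \<in> carrier R; a \<in> D; c \<in> D\<rbrakk>
      \<Longrightarrow> M (x i j r * g) (a, c) = (if a = i then M g (a, c) \<oplus> r \<otimes> M g (j, c) else M g (a, c))"
begin

declare M_closed [simp]

definition same_matrix :: "'g \<Rightarrow> 'g \<Rightarrow> bool" where
  "same_matrix g k \<longleftrightarrow> (\<forall>a\<in>D. \<forall>c\<in>D. M g (a, c) = M k (a, c))"

lemma same_matrix_mult:
  assumes "same_matrix k k'" "k \<in> E" "k' \<in> E" "g \<in> E"
  shows "same_matrix (g * k) (g * k')"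
  using assms(4)
proof (induction rule: E_induct)
  case one
  then show ?case using assms(1) by simp
next
  case (mult i j r g)
  then show ?case using assms(2,3) by (auto simp: same_matrix_def M_x mult.assoc)
qed

lemma M_U:
  assumes "u \<in> U \<rho>" "a \<in> D" "c \<in> D" "\<rho> c \<le> \<rho> a"
  shows "M u (a, c) = (if a = c then \<one> else \<zero>)"
  using assms
proof (induction arbitrary: a rule: rootset_induct)
  case one
  then show ?case by (simp add: M_one)
next
  case (mult i j r g)
  have IH: "M g (a, c) = (if a = c then \<one> else \<zero>)"
    using mult.prems by (intro mult.IH)
  have g: "g \<in> E" using mult.hyps(7) by (rule rootset_E)
  show ?case
  proof (cases "a = i")
    case True
    have "M g (j, c) = (if j = c then \<one> else \<zero>)"
      using mult.prems mult.hyps True by (intro mult.IH) auto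
    moreover have "j \<noteq> c" using mult.prems(3) mult.hyps(4) True by auto
    ultimately have "M (x i j r * g) (a, c) = M g (a, c)"
      using M_x [OF g mult.hyps(1-3,6) mult.prems(1,2)] mult.hyps(6) mult.prems g True by simp
    then show ?thesis using IH by simp
  next
    case False
    then show ?thesis
      using M_x [OF g mult.hyps(1-3,6) mult.prems(1,2)] IH by simp
  qed
qed

lemma M_w:
  assumes ij: "i \<in> D" "j \<in> D" "i \<noteq> j" and u: "u \<in> Units R" and g: "g \<in> E" and ac: "a \<in> D" "c \<in> D"
  shows "M (w i j u * g) (a, c) = (if a = i then u \<otimes> M g (j, c)
    else if a = j then \<ominus> (inv u \<otimes> M g (i, c)) else M g (a, c))"
proof -
  note [simp] = ij ij(3) [symmetric] u g ac
  let ?p = "M g (i, c)" and ?q = "M g (j, c)"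
  have p: "?p \<in> carrier R" "?q \<in> carrier R" by simp_all
  have 1: "?q \<oplus> \<ominus> (inv u) \<otimes> (?p \<oplus> u \<otimes> ?q) = \<ominus> (inv u \<otimes> ?p)"
  proof -
    have "q \<oplus> \<ominus> y \<otimes> (p \<oplus> z \<otimes> q) = q \<ominus> (y \<otimes> z) \<otimes> q \<oplus> \<ominus> (y \<otimes> p)"
      if "p \<in> carrier R" "q \<in> carrier R" "y \<in> carrier R" "z \<in> carrier R" for p q y z
      using that by algebra
    from this [OF p, of "inv u" u] show ?thesis using p by (simp add: minus_eq r_neg)
  qed
  have 2: "?p \<oplus> u \<otimes> ?q \<oplus> u \<otimes> \<ominus> (inv u \<otimes> ?p) = u \<otimes> ?q"
    by (simp add: r_minus a_ac r_neg r_neg1 r_neg2)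
  have "M (w i j u * g) (a, c) = M (x i j u * (x j i (\<ominus> (inv u)) * (x i j u * g))) (a, c)"
    by (simp add: w_def mult.assoc)
  then show ?thesis by (auto simp: M_x 1 2)
qed

lemma M_h:
  assumes ij: "i \<in> D" "j \<in> D" "i \<noteq> j" and u: "u \<in> Units R" and g: "g \<in> E" and ac: "a \<in> D" "c \<in> D"
  shows "M (h i j u * g) (a, c) = weight i j u a \<otimes> M g (a, c)"
  using assms by (simp add: h_def mult.assoc M_w weight_def r_minus l_minus)

lemma M_inverse_h:
  assumes ij: "i \<in> D" "j \<in> D" "i \<noteq> j" and u: "u \<in> Units R" and g: "g \<in> E" and ac: "a \<in> D" "c \<in> D"
  shows "M (inverse (h i j u) * g) (a, c) = inv (weight i j u a) \<otimes> M g (a, c)"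
proof -
  have "M g (a, c) = M (h i j u * (inverse (h i j u) * g)) (a, c)" by simp
  also have "\<dots> = weight i j u a \<otimes> M (inverse (h i j u) * g) (a, c)"
    using assms by (intro M_h) simp_all
  finally show ?thesis using assms by simp
qed

lemma M_H:
  assumes "t \<in> H"
  shows "\<exists>\<mu>. (\<forall>a\<in>D. \<mu> a \<in> Units R) \<and> (\<forall>g\<in>E. \<forall>a\<in>D. \<forall>c\<in>D. M (t * g) (a, c) = \<mu> a \<otimes> M g (a, c))"
  using assms unfolding H_def
proof (induction rule: gspan.induct)
  case gspan_one
  show ?case by (intro exI [of _ "\<lambda>_. \<one>"]) simp
next
  case (gspan_mult_left s t)
  then obtain i j u \<mu> where s: "s = h i j u" "i \<in> D" "j \<in> D" "i \<noteq> j" "u \<in> Units R"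
    and \<mu>: "\<And>a. a \<in> D \<Longrightarrow> \<mu> a \<in> Units R"
      "\<And>g a c. g \<in> E \<Longrightarrow> a \<in> D \<Longrightarrow> c \<in> D \<Longrightarrow> M (t * g) (a, c) = \<mu> a \<otimes> M g (a, c)" by blast
  have "t \<in> E" using gspan_mult_left(2) H_E by (simp add: H_def)
  then show ?case using s \<mu>
    by (intro exI [of _ "\<lambda>a. weight i j u a \<otimes> \<mu> a"]) (simp add: mult.assoc M_h m_assoc)
next
  case (gspan_inverse_left s t)
  then obtain i j u \<mu> where s: "s = h i j u" "i \<in> D" "j \<in> D" "i \<noteq> j" "u \<in> Units R"
    and \<mu>: "\<And>a. a \<in> D \<Longrightarrow> \<mu> a \<in> Units R"
      "\<And>g a c. g \<in> E \<Longrightarrow> a \<in> D \<Longrightarrow> c \<in> D \<Longrightarrow> M (t * g) (a, c) = \<mu> a \<otimes> M g (a, c)" by blast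
  have "t \<in> E" using gspan_inverse_left(2) H_E by (simp add: H_def)
  then show ?case using s \<mu>
    by (intro exI [of _ "\<lambda>a. inv (weight i j u a) \<otimes> \<mu> a"]) (simp add: mult.assoc M_inverse_h m_assoc)
qed

lemma M_Z:
  assumes "z \<in> Z" "g \<in> E" "a \<in> D" "c \<in> D"
  shows "M (z * g) (a, c) = M g (a, c)"
proof -
  have sy: "M (sy u v * g) (a, c) = M g (a, c)" if "u \<in> Units R" "v \<in> Units R" "g \<in> E" for u v g
    using that assms(3,4)
    by (simp add: symb_def mult.assoc M_h M_inverse_h weight_mult m_ac unit_cancels)
  show ?thesis
    using assms(1) by (induction rule: Z_induct) (use sy Z_E assms(2) in \<open>auto simp: mult.assoc\<close>)
qed

text \<open>Among the factors, only \<open>h 1 l u\<close> affects the diagonal entry at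
  \<open>l\<close>, where it contributes the inverse of \<open>u\<close>. Entries equal to 1 at all
  listed indices therefore force every parameter to be 1 and leave an element of
  \<open>Z\<close>.\<close>

lemma torus_diagonal:
  assumes "distinct ls" "set ls \<subseteq> D - {1}" "n \<in> torus ls"
  shows "(\<forall>a\<in>D - insert 1 (set ls). M n (a, a) = \<one>)
    \<and> ((\<forall>a\<in>set ls. M n (a, a) = \<one>) \<longrightarrow> n \<in> Z)"
  using assms
proof (induction ls arbitrary: n)
  case Nil
  then show ?case using M_Z [of n 1] by (simp add: M_one)
next
  case (Cons l ls)
  then obtain u n' where n: "n = h 1 l u * n'" "u \<in> Units R" "n' \<in> torus ls" by auto
  have l: "l \<in> D" "1 \<noteq> l" "l \<notin> set ls" "set ls \<subseteq> D - {1}" using Cons.prems by auto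
  have E: "n' \<in> E" using torus_E n l by blast
  have M: "M n (a, a) = weight 1 l u a \<otimes> M n' (a, a)" if "a \<in> D" for a
    unfolding n(1) using l n E that by (intro M_h) auto
  have IH: "\<And>a. a \<in> D - insert 1 (set ls) \<Longrightarrow> M n' (a, a) = \<one>"
    "(\<forall>a\<in>set ls. M n' (a, a) = \<one>) \<Longrightarrow> n' \<in> Z"
    using Cons.IH [OF _ l(4) n(3)] Cons.prems by auto
  have Ml: "M n' (l, l) = \<one>" using IH(1) [of l] l by auto
  show ?case
  proof (intro conjI ballI impI)
    fix a assume "a \<in> D - insert 1 (set (l # ls))"
    then show "M n (a, a) = \<one>" using M [of a] IH(1) [of a] by (auto simp: weight_def)
  next
    assume one: "\<forall>a\<in>set (l # ls). M n (a, a) = \<one>"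
    have "inv u = \<one>" using one M [of l] Ml l n by (simp add: weight_def)
    then have "u = \<one>" using n(2) by (metis Units_inv_inv inv_one)
    then have nn': "n = n'" using n(1) l by simp
    then show "n \<in> Z" using IH(2) one by simp
  qed
qed

section \<open>Triviality of unipotent elements with identity matrix\<close>

lemma M_row:
  assumes i: "i \<in> D" and "g \<in> rootset \<rho> ({i} \<times> L)" and c: "c \<in> D"
  shows "(\<forall>a\<in>D. a \<noteq> i \<longrightarrow> M g (a, c) = (if a = c then \<one> else \<zero>))
    \<and> (c \<notin> L \<longrightarrow> c \<noteq> i \<longrightarrow> M g (i, c) = \<zero>)"
  using assms(2)
proof (induction rule: rootset_induct)
  case one
  then show ?case using i c by (simp add: M_one)
next
  case (mult k l r g)
  then have k: "k = i" "l \<in> L" and g: "g \<in> E" using rootset_E by auto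
  then show ?case using mult i c by (auto simp: M_x)
qed

text \<open>Root elements in row \<open>i\<close> commute, so the factors of column \<open>l\<close>
  can be collected in front; their total argument is the matrix entry at (i, l), which
  vanishes.\<close>

lemma row_trivial:
  assumes i: "i \<in> D" and "finite L" "L \<subseteq> {l\<in>D. \<rho> i < \<rho> l}" "g \<in> rootset \<rho> ({i} \<times> L)"
    "\<And>l. l \<in> L \<Longrightarrow> M g (i, l) = \<zero>"
  shows "g = 1"
  using assms(2-)
proof (induction L arbitrary: g rule: finite_induct)
  case empty
  from empty(2) show ?case by (induction rule: rootset_induct) auto
next
  case (insert l L)
  have l: "l \<in> D" "\<rho> i < \<rho> l" "i \<noteq> l" using insert.prems(1) by auto
  have "\<exists>r\<in>carrier R. \<exists>g'\<in>rootset \<rho> ({i} \<times> L). g = x i l r * g'"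
    using insert.prems(2)
  proof (induction rule: rootset_induct)
    case one
    show ?case using l i rootset_one x_zero [of i l] by (intro bexI [of _ \<zero>] bexI [of _ 1]) auto
  next
    case (mult k k' s g)
    then obtain r g' where g: "r \<in> carrier R" "g' \<in> rootset \<rho> ({i} \<times> L)" "g = x i l r * g'" by blast
    have k: "k = i" "k' \<in> insert l L" using mult by auto
    show ?case
    proof (cases "k' = l")
      case True
      then show ?thesis using g k mult l i
        by (intro bexI [of _ "s \<oplus> r"] bexI [of _ g']) (auto simp: x_add_left)
    next
      case False
      have "x i k' s * x i l r = x i l r * x i k' s"
        using mult k l g i by (intro x_commute) auto
      then have "x k k' s * g = x i l r * (x i k' s * g')"
        unfolding k(1) g(3) by (metis mult.assoc)
      moreover have "x i k' s * g' \<in> rootset \<rho> ({i} \<times> L)"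
        using mult k False g by (intro rootset_mult rootset_x) auto
      ultimately show ?thesis using g(1) by blast
    qed
  qed
  then obtain r g' where g: "r \<in> carrier R" "g' \<in> rootset \<rho> ({i} \<times> L)" "g = x i l r * g'" by blast
  have gE: "g' \<in> E" using g(2) by (rule rootset_E)
  have M': "M g (i, c) = M g' (i, c) \<oplus> r \<otimes> M g' (l, c)" if "c \<in> D" for c
    unfolding g(3) using gE i l g that by (simp add: M_x)
  have "M g (i, l) = r"
    using M' [of l] M_row [OF i g(2), of l] insert.hyps(2) l g(1) by simp
  then have "r = \<zero>" using insert.prems(3) [of l] by simp
  then have gg': "g = g'" using g(3) x_zero [of i l] i l by simp
  show ?case
    using insert.IH [of g'] insert.prems g(2) unfolding gg' by auto
qed

text \<open>Rows are stripped in increasing order of \<rho>. In u = w g, with \<open>g\<close> in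
  the first remaining row and \<open>w\<close> in later rows, \<open>w\<close> does not alter that
  row, so the row of \<open>u\<close> is that of \<open>g\<close>, and \<open>g\<close> is
  trivial.\<close>

lemma U_trivial:
  assumes \<rho>: "inj_on \<rho> D" and u: "u \<in> U \<rho>" and M: "same_matrix u 1"
  shows "u = 1"
proof -
  define N where "N = Suc (Max (\<rho> ` D))"
  have N: "\<rho> k < N" if "k \<in> D" for k
    using that by (auto simp: N_def less_Suc_eq_le)
  let ?P = "\<lambda>m. rootset \<rho> {(k, l). m \<le> \<rho> k}"
  have low: "M (w * g) (a, c) = M g (a, c)"
    if "w \<in> ?P (Suc m)" "g \<in> E" "a \<in> D" "c \<in> D" "\<rho> a \<le> m" for m w g a c
    using that(1)
  proof (induction rule: rootset_induct)
    case (mult k l r w)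
    have "w * g \<in> E" using rootset_E [OF mult(7)] that(2) by simp
    then show ?case using mult that by (auto simp: mult.assoc M_x)
  qed simp
  \<comment> \<open>Later rows normalize the subgroup of row \<open>i\<close>, so that the factors
    of that row can be collected on the right.\<close>
  have conj: "gconj w y \<in> rootset \<rho> ({i} \<times> {l\<in>D. \<rho> i < \<rho> l})"
    if "i \<in> D" "w \<in> ?P (Suc (\<rho> i))" "y \<in> rootset \<rho> ({i} \<times> {l\<in>D. \<rho> i < \<rho> l})" for i w y
    using that(2)
  proof (induction rule: rootset_induct)
    case one
    show ?case using that(3) by simp
  next
    case (mult k l s w)
    let ?X = "rootset \<rho> ({i} \<times> {l\<in>D. \<rho> i < \<rho> l})"
    have gen: "gconj (x k l s) (x i q t) \<in> ?X" if "q \<in> D" "\<rho> i < \<rho> q" "t \<in> carrier R" for q t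
    proof (cases "q = k")
      case True
      have "gconj (x k l s) (x i k t) = x i l (\<ominus> (t \<otimes> s)) * x i k t"
        using mult \<open>i \<in> D\<close> that by (intro conj_x_left) auto
      also have "\<dots> \<in> ?X" using mult \<open>i \<in> D\<close> that True by (intro rootset_mult rootset_x) auto
      finally show ?thesis using True by simp
    next
      case False
      then have "gconj (x k l s) (x i q t) = x i q t"
        using mult \<open>i \<in> D\<close> that by (intro conj_x_commute) auto
      then show ?thesis using \<open>i \<in> D\<close> that by (auto intro!: rootset_x)
    qed
    have "gconj (x k l s) (gconj w y) \<in> ?X"
      unfolding rootset_def
      by (rule gconj_gspan [OF _ mult(8) [unfolded rootset_def]]) (use gen in \<open>auto simp: rootset_def\<close>)
    then show ?case by (simp add: gconj_gconj)
  qed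
  \<comment> \<open>The number \<open>n\<close> bounds the levels not yet treated, and
    \<open>m\<close> is the least level that may still occur.\<close>
  have "u = 1" if "N \<le> m + n" "u \<in> ?P m" "same_matrix u 1" for m n u
    using that
  proof (induction n arbitrary: m u)
    case 0
    from 0(2) show ?case
    proof (induction rule: rootset_induct)
      case (mult k l r g)
      then show ?case using N [of k] 0(1) by simp
    qed simp
  next
    case (Suc n)
    have IH: "u = 1" if "u \<in> ?P (Suc m)" "same_matrix u 1" for u
      using Suc.IH [of "Suc m" u] Suc.prems(1) that by simp
    show ?case
    proof (cases "\<exists>i\<in>D. \<rho> i = m")
      case False
      have "u \<in> ?P (Suc m)"
        using Suc.prems(2)
      proof (induction rule: rootset_induct)
        case (mult k l r g)
        then have "Suc m \<le> \<rho> k" using False by fastforce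
        then show ?case using mult by (intro rootset_mult rootset_x) auto
      qed (rule rootset_one)
      then show ?thesis using IH Suc.prems(3) by blast
    next
      case True
      then obtain i where i: "i \<in> D" "\<rho> i = m" by blast
      let ?X = "rootset \<rho> ({i} \<times> {l\<in>D. \<rho> i < \<rho> l})"
      have "\<exists>w\<in>?P (Suc m). \<exists>g\<in>?X. u = w * g"
        using Suc.prems(2)
      proof (induction rule: rootset_induct)
        case one
        show ?case by (intro bexI [of _ 1]) (simp_all add: rootset_one)
      next
        case (mult k l r u)
        then obtain w g where wg: "w \<in> ?P (Suc m)" "g \<in> ?X" "u = w * g" by blast
        show ?case
        proof (cases "k = i")
          case True
          have "x k l r \<in> ?X" using mult True i by (intro rootset_x) auto
          then have "gconj (inverse w) (x k l r) \<in> ?X"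
            using conj [OF i(1), of "inverse w"] rootset_inverse [OF wg(1)] i(2) by simp
          then have "gconj (inverse w) (x k l r) * g \<in> ?X" using wg(2) by (rule rootset_mult)
          moreover have "x k l r * u = w * (gconj (inverse w) (x k l r) * g)"
            unfolding wg(3) by (simp add: gconj_def mult.assoc)
          ultimately show ?thesis using wg(1) by blast
        next
          case False
          then have "\<rho> k \<noteq> m" using \<rho> i mult(1) by (auto dest: inj_onD)
          then have "x k l r * w \<in> ?P (Suc m)" using mult wg(1) by (intro rootset_mult rootset_x) auto
          moreover have "x k l r * u = x k l r * w * g" unfolding wg(3) by (simp add: mult.assoc)
          ultimately show ?thesis using wg(2) by blast
        qed
      qed
      then obtain w g where wg: "w \<in> ?P (Suc m)" "g \<in> ?X" "u = w * g" by blast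
      have "g = 1"
      proof (rule row_trivial [OF i(1) _ subset_refl wg(2)])
        fix l assume l: "l \<in> {l\<in>D. \<rho> i < \<rho> l}"
        then have "M g (i, l) = M u (i, l)"
          unfolding wg(3) using low [OF wg(1) rootset_E [OF wg(2)], of i l] i by simp
        also have "\<dots> = \<zero>" using Suc.prems(3) l i by (auto simp: same_matrix_def M_one)
        finally show "M g (i, l) = \<zero>" .
      qed simp
      then show ?thesis using IH wg Suc.prems(3) by simp
    qed
  qed
  from this [of 0 N u] show ?thesis using u M by simp
qed

text \<open>The kernel condition is stated through left multiplication, which is what the axioms for
  \<open>M\<close> describe; it is applied to the upper unipotent factor \<open>u\<close>.\<close>

theorem kernel_Z:
  assumes R1: rank_one and z: "z \<in> E" and ker: "\<And>g. g \<in> E \<Longrightarrow> same_matrix (z * g) g"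
  shows "z \<in> Z"
proof -
  obtain u n t u' where z_eq: "z = u * n * t * u'" and mem: "u \<in> U id" "n \<in> U (\<lambda>k. d - k)" "t \<in> H" "u' \<in> U id"
    using E_cell [OF R1 z] by (auto simp: cell_def)
  have E: "u \<in> E" "n \<in> E" "t \<in> E" "u' \<in> E" using mem rootset_E H_E by blast+
  let ?v = "u' * u"
  have v: "?v \<in> U id" "?v \<in> E" using mem E by (simp_all add: rootset_mult)
  have n_inj: "inj_on (\<lambda>k. d - k) D" by (auto simp: inj_on_def atLeastAtMost_iff)
  \<comment> \<open>Conjugation brings the two upper factors together on the right.\<close>
  have conj: "inverse u * (z * u) = n * (t * ?v)" unfolding z_eq by (simp add: mult.assoc)
  have "same_matrix (inverse u * (z * u)) (inverse u * u)"
    using ker [OF E(1)] z E(1) by (intro same_matrix_mult) simp_all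
  then have "same_matrix (n * (t * ?v)) 1" unfolding conj by (simp add: grp_left_inverse)
  then have "same_matrix (inverse n * (n * (t * ?v))) (inverse n * 1)"
    using E v by (intro same_matrix_mult) simp_all
  then have eq: "same_matrix (t * ?v) (inverse n)" by simp
  obtain \<mu> where \<mu>: "\<And>a. a \<in> D \<Longrightarrow> \<mu> a \<in> Units R"
    "\<And>g a c. g \<in> E \<Longrightarrow> a \<in> D \<Longrightarrow> c \<in> D \<Longrightarrow> M (t * g) (a, c) = \<mu> a \<otimes> M g (a, c)"
    using M_H [OF mem(3)] by blast
  have n_M: "M (inverse n) (a, c) = (if a = c then \<one> else \<zero>)" if "a \<in> D" "c \<in> D" "a \<le> c" for a c
    using M_U [OF rootset_inverse [OF mem(2)]] that by simp
  have v_M: "M ?v (a, c) = (if a = c then \<one> else \<zero>)" if "a \<in> D" "c \<in> D" "c \<le> a" for a c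
    using M_U [OF v(1)] that by simp
  \<comment> \<open>A diagonal matrix times an upper unitriangular one equals a lower unitriangular
    one; comparing entries makes all three the identity.\<close>
  have eq': "\<mu> a \<otimes> M ?v (a, c) = M (inverse n) (a, c)" if "a \<in> D" "c \<in> D" for a c
    using eq \<mu>(2) [OF v(2)] that by (simp add: same_matrix_def)
  have \<mu>1: "\<mu> a = \<one>" if "a \<in> D" for a
    using eq' [of a a] n_M [of a a] v_M [of a a] \<mu>(1) that by simp
  have "M ?v (a, c) = (if a = c then \<one> else \<zero>)" if "a \<in> D" "c \<in> D" for a c
    using eq' [of a c] n_M [of a c] v_M [of a c] \<mu>1 [of a] v that by (cases "c \<le> a") simp_all
  then have vM: "same_matrix ?v 1" by (simp add: same_matrix_def M_one)
  then have v1: "?v = 1" using U_trivial [OF inj_on_id v(1)] by blast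
  have "M (inverse n) (a, c) = M 1 (a, c)" if "a \<in> D" "c \<in> D" for a c
    using eq' [of a c] \<mu>1 [of a] that unfolding v1 by (simp add: M_one)
  then have "inverse n = 1"
    using U_trivial [OF n_inj rootset_inverse [OF mem(2)]] by (simp add: same_matrix_def)
  then have n1: "n = 1" by (metis grp_inverse_inverse grp_inverse_one)
  have tM: "M t (a, a) = \<one>" if "a \<in> D" for a
    using \<mu>(2) [of 1 a a] \<mu>1 [of a] that by (simp add: M_one)
  have ls: "set [2..<Suc d] \<subseteq> D - {1}" by (auto simp: atLeastAtMost_iff)
  have "t \<in> Z"
    using torus_diagonal [OF distinct_upt ls H_torus [OF mem(3)]] tM ls by blast
  \<comment> \<open>The conjugate of \<open>z\<close> by the inverse of \<open>u\<close> is
    \<open>t\<close>; as \<open>t\<close> is central, it equals \<open>z\<close>.\<close>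
  moreover have "z = t"
  proof -
    have "z * u = u * t" using conj unfolding v1 n1 by (metis cancel_inverse_left mult_1_left mult_1_right)
    also have "\<dots> = t * u" using Z_commute [OF \<open>t \<in> Z\<close> E(1)] by simp
    finally show ?thesis by simp
  qed
  ultimately show ?thesis by simp
qed

end

section \<open>The Cayley embedding\<close>

text \<open>The class \<open>grp\<close> asks for a group structure on a whole type, but the
  Steinberg group is only a carrier inside a type of sets of words. The permutations of that type do
  form a total group.\<close>

typedef 'a bijection = "{f :: 'a \<Rightarrow> 'a. bij f}"
  by (rule exI [of _ id]) simp

setup_lifting type_definition_bijection

instantiation bijection :: (type) grp
begin

lift_definition one_bijection :: "'a bijection" is id by simp
lift_definition times_bijection :: "'a bijection \<Rightarrow> 'a bijection \<Rightarrow> 'a bijection" is comp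
  by (rule bij_comp)
lift_definition inverse_bijection :: "'a bijection \<Rightarrow> 'a bijection" is "\<lambda>f. inv_into UNIV f"
  by (rule bij_imp_bij_inv)
definition divide_bijection :: "'a bijection \<Rightarrow> 'a bijection \<Rightarrow> 'a bijection" where
  "divide_bijection f g = f * inverse g"

instance
proof
  fix f g k :: "'a bijection"
  show "f * g * k = f * (g * k)" "1 * f = f" "f * 1 = f"
    by (transfer; simp add: comp_assoc)+
  show "inverse f * f = 1"
    by transfer (simp add: bij_is_inj)
qed

end

context group
begin

definition cayley :: "'a \<Rightarrow> 'a bijection" where
  "cayley g = Abs_bijection (\<lambda>y. if y \<in> carrier G then g \<otimes> y else y)"

lemma cayley_bij:
  assumes g: "g \<in> carrier G"
  shows "bij (\<lambda>y. if y \<in> carrier G then g \<otimes> y else y)"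
proof (rule o_bij)
  let ?f = "\<lambda>g y. if y \<in> carrier G then g \<otimes> y else y"
  show "?f (inv g) \<circ> ?f g = id" "?f g \<circ> ?f (inv g) = id"
    using g by (auto simp: fun_eq_iff simp flip: m_assoc)
qed

lemma Rep_cayley: "g \<in> carrier G \<Longrightarrow> Rep_bijection (cayley g) = (\<lambda>y. if y \<in> carrier G then g \<otimes> y else y)"
  unfolding cayley_def using cayley_bij by (simp add: Abs_bijection_inverse)

lemma cayley_mult:
  assumes "g \<in> carrier G" "k \<in> carrier G"
  shows "cayley (g \<otimes> k) = cayley g * cayley k"
  using assms by (simp add: Rep_cayley times_bijection.rep_eq fun_eq_iff m_assoc flip: Rep_bijection_inject)

lemma cayley_one: "cayley \<one> = 1"
  by (simp add: Rep_cayley one_bijection.rep_eq fun_eq_iff flip: Rep_bijection_inject)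

lemma cayley_inv: "g \<in> carrier G \<Longrightarrow> cayley (inv g) = inverse (cayley g)"
  using cayley_mult [of g "inv g"] by (simp add: cayley_one grp_inverse_unique)

lemma cayley_inj: "inj_on cayley (carrier G)"
proof (rule inj_onI)
  fix g k assume gk: "g \<in> carrier G" "k \<in> carrier G" "cayley g = cayley k"
  then have "Rep_bijection (cayley g) \<one> = Rep_bijection (cayley k) \<one>" by simp
  then show "g = k" using gk(1,2) by (simp add: Rep_cayley)
qed

end

section \<open>Transfer to the Steinberg group\<close>

context cring
begin

context
  fixes d :: nat
  assumes d3: "3 \<le> d"
begin

interpretation St: group "Steinberg R d"
  by (rule group_Steinberg)

abbreviation st_class :: "'a st_generator word \<Rightarrow> 'a st_generator word set" where
  "st_class w \<equiv> pres_eq (st_generators R d) (st_relations R d) `` {w}"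

lemma st_class_carrier: "w \<in> words (st_generators R d) \<Longrightarrow> st_class w \<in> carrier (Steinberg R d)"
  unfolding Steinberg_def presented_carrier by blast

lemma st_class_append:
  "v \<in> words (st_generators R d) \<Longrightarrow> w \<in> words (st_generators R d) \<Longrightarrow> st_class (v @ w) = st_class v \<otimes>\<^bsub>Steinberg R d\<^esub> st_class w"
  unfolding Steinberg_def by (rule presented_mult [symmetric])

lemma st_class_Nil: "st_class [] = \<one>\<^bsub>Steinberg R d\<^esub>"
  unfolding Steinberg_def by (rule presented_one [symmetric])

lemma st_class_eqI: "(v, w) \<in> pres_eq (st_generators R d) (st_relations R d) \<Longrightarrow> st_class v = st_class w"
  by (rule equiv_class_eq [OF equiv_pres_eq])

lemma st_class_inv_word:
  assumes "w \<in> words (st_generators R d)"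
  shows "st_class (inv_word w) = inv\<^bsub>Steinberg R d\<^esub> (st_class w)"
  using st_class_eqI [OF inv_word_left [OF assms]] assms
  by (intro St.inv_equality [symmetric]) (simp_all add: st_class_append st_class_Nil st_class_carrier)

lemma st_class_relation:
  "(v, w) \<in> st_relations R d \<Longrightarrow> v \<in> words (st_generators R d) \<Longrightarrow> w \<in> words (st_generators R d) \<Longrightarrow> st_class v = st_class w"
  using pres_relation [of "[]" _ "[]" v w] by (intro st_class_eqI) simp

lemma st_class_comm_word:
  assumes "v \<in> words (st_generators R d)" "w \<in> words (st_generators R d)"
  shows "st_class (comm_word v w) = st_class v \<otimes>\<^bsub>Steinberg R d\<^esub> st_class w \<otimes>\<^bsub>Steinberg R d\<^esub> inv\<^bsub>Steinberg R d\<^esub> (st_class v)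
    \<otimes>\<^bsub>Steinberg R d\<^esub> inv\<^bsub>Steinberg R d\<^esub> (st_class w)"
  using assms by (simp add: comm_word_def st_class_append st_class_inv_word st_class_carrier St.m_assoc)

definition st_cayley :: "nat \<Rightarrow> nat \<Rightarrow> 'a \<Rightarrow> 'a st_generator word set bijection" where
  "st_cayley i j r = St.cayley (st_x R d i j r)"

lemma letter_word:
  "i \<in> {1..d} \<Longrightarrow> j \<in> {1..d} \<Longrightarrow> i \<noteq> j \<Longrightarrow> r \<in> carrier R \<Longrightarrow> st_letter i j r \<in> words (st_generators R d)"
  by (simp add: st_generators_def)

lemma st_x_carrier:
  "i \<in> {1..d} \<Longrightarrow> j \<in> {1..d} \<Longrightarrow> i \<noteq> j \<Longrightarrow> r \<in> carrier R \<Longrightarrow> st_x R d i j r \<in> carrier (Steinberg R d)"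
  unfolding st_x_def by (intro st_class_carrier letter_word)

lemma steinberg_rep_st_cayley: "steinberg_rep R d st_cayley"
proof
  fix i j u v assume ij: "i \<in> {1..d}" "j \<in> {1..d}" "i \<noteq> j" "u \<in> carrier R" "v \<in> carrier R"
  note W = letter_word [OF ij(1-3)]
  have "st_class (st_letter i j u @ st_letter i j v) = st_class (st_letter i j (u \<oplus> v))"
    by (rule st_class_relation [OF st_additive]) (use ij W in simp_all)
  then have "st_x R d i j u \<otimes>\<^bsub>Steinberg R d\<^esub> st_x R d i j v = st_x R d i j (u \<oplus> v)"
    unfolding st_x_def by (subst st_class_append [symmetric]) (use ij W in simp_all)
  then show "st_cayley i j u * st_cayley i j v = st_cayley i j (u \<oplus> v)"
    unfolding st_cayley_def using ij st_x_carrier by (subst St.cayley_mult [symmetric]) simp_all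
next
  fix i j k u v
  assume ijk: "i \<in> {1..d}" "j \<in> {1..d}" "k \<in> {1..d}" "i \<noteq> j" "j \<noteq> k" "i \<noteq> k" "u \<in> carrier R" "v \<in> carrier R"
  let ?v = "st_letter i j u" and ?w = "st_letter j k v"
  have W: "?v \<in> words (st_generators R d)" "?w \<in> words (st_generators R d)" "st_letter i k (u \<otimes> v) \<in> words (st_generators R d)"
    using ijk by (intro letter_word; simp)+
  have "st_class (comm_word ?v ?w) = st_class (st_letter i k (u \<otimes> v))"
    by (rule st_class_relation [OF st_commutator]) (use ijk W in \<open>simp_all add: comm_word_def\<close>)
  then have "st_x R d i j u \<otimes>\<^bsub>Steinberg R d\<^esub> st_x R d j k v \<otimes>\<^bsub>Steinberg R d\<^esub> inv\<^bsub>Steinberg R d\<^esub> (st_x R d i j u)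
      \<otimes>\<^bsub>Steinberg R d\<^esub> inv\<^bsub>Steinberg R d\<^esub> (st_x R d j k v) = st_x R d i k (u \<otimes> v)"
    unfolding st_x_def st_class_comm_word [OF W(1,2)] .
  from arg_cong [OF this, of St.cayley] show "st_cayley i j u * st_cayley j k v * inverse (st_cayley i j u) * inverse (st_cayley j k v) = st_cayley i k (u \<otimes> v)"
    unfolding st_cayley_def using ijk st_x_carrier [of i j u] st_x_carrier [of j k v]
    by (simp add: St.cayley_mult St.cayley_inv)
next
  fix i j k l u v
  assume ijkl: "i \<in> {1..d}" "j \<in> {1..d}" "k \<in> {1..d}" "l \<in> {1..d}" "i \<noteq> j" "k \<noteq> l" "j \<noteq> k" "i \<noteq> l" "u \<in> carrier R" "v \<in> carrier R"
  let ?v = "st_letter i j u" and ?w = "st_letter k l v"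
  have W: "?v \<in> words (st_generators R d)" "?w \<in> words (st_generators R d)"
    using ijkl by (intro letter_word; simp)+
  have "st_class (comm_word ?v ?w) = st_class []"
    by (rule st_class_relation [OF st_commuting]) (use ijkl W in \<open>simp_all add: comm_word_def\<close>)
  then have "st_x R d i j u \<otimes>\<^bsub>Steinberg R d\<^esub> st_x R d k l v \<otimes>\<^bsub>Steinberg R d\<^esub> inv\<^bsub>Steinberg R d\<^esub> (st_x R d i j u)
      \<otimes>\<^bsub>Steinberg R d\<^esub> inv\<^bsub>Steinberg R d\<^esub> (st_x R d k l v) = \<one>\<^bsub>Steinberg R d\<^esub>"
    unfolding st_x_def st_class_comm_word [OF W(1,2)] st_class_Nil .
  from arg_cong [OF this, of St.cayley]
  have "st_cayley i j u * st_cayley k l v * inverse (st_cayley i j u) * inverse (st_cayley k l v) = 1"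
    unfolding st_cayley_def using ijkl st_x_carrier [of i j u] st_x_carrier [of k l v]
    by (simp add: St.cayley_mult St.cayley_inv St.cayley_one)
  then show "st_cayley i j u * st_cayley k l v = st_cayley k l v * st_cayley i j u"
    by (simp add: mult_inverse_eq_iff)
qed (rule d3)

interpretation S: steinberg_rep R d st_cayley
  by (rule steinberg_rep_st_cayley)

lemma cayley_E:
  assumes "g \<in> carrier (Steinberg R d)"
  shows "St.cayley g \<in> S.E"
proof -
  have "St.cayley (st_class w) \<in> S.E" if "w \<in> words (st_generators R d)" for w
    using that
  proof (induction w)
    case Nil
    then show ?case by (simp add: st_class_Nil St.cayley_one)
  next
    case (Cons l w)
    obtain i j r b where l: "l = ((i, j, r), b)" by (metis prod.exhaust)
    have ij: "i \<in> {1..d}" "j \<in> {1..d}" "i \<noteq> j" "r \<in> carrier R" and w: "w \<in> words (st_generators R d)"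
      using Cons.prems by (simp_all add: l st_generators_def)
    have W: "st_letter i j r \<in> words (st_generators R d)" "[l] \<in> words (st_generators R d)"
      using letter_word [OF ij] Cons.prems by simp_all
    have "st_class [l] = (if b then st_x R d i j r else inv\<^bsub>Steinberg R d\<^esub> (st_x R d i j r))"
      using st_class_inv_word [OF W(1)] by (simp add: l st_x_def inv_word_def)
    then have "St.cayley (st_class [l]) \<in> S.E"
      using S.x_E [OF ij] st_x_carrier [OF ij] by (auto simp: st_cayley_def St.cayley_inv intro: S.E_inverse)
    moreover have "st_class (l # w) = st_class [l] \<otimes>\<^bsub>Steinberg R d\<^esub> st_class w"
      using st_class_append [OF W(2) w] by simp
    ultimately show ?case
      using Cons.IH [OF w] W w by (simp add: St.cayley_mult st_class_carrier)
  qed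
  then show ?thesis using assms unfolding Steinberg_def presented_carrier by blast
qed

context
  fixes i j :: nat
  assumes ij: "i \<in> {1..d}" "j \<in> {1..d}" "i \<noteq> j"
begin

lemma cayley_w:
  assumes u: "u \<in> Units R"
  shows "st_w R d i j u \<in> carrier (Steinberg R d)" "St.cayley (st_w R d i j u) = S.w i j u"
  using ij u st_x_carrier [of i j u] st_x_carrier [of j i "\<ominus> (inv u)"]
  by (simp_all add: st_w_def S.w_def st_cayley_def St.cayley_mult Units_closed)

lemma cayley_h:
  assumes u: "u \<in> Units R"
  shows "st_h R d i j u \<in> carrier (Steinberg R d)" "St.cayley (st_h R d i j u) = S.h i j u"
  using cayley_w [OF u] cayley_w [of "\<ominus> \<one>"] by (simp_all add: st_h_def S.h_def St.cayley_mult)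

lemma cayley_symbol:
  assumes u: "u \<in> Units R" and v: "v \<in> Units R"
  shows "st_symbol R d i j u v \<in> carrier (Steinberg R d)" "St.cayley (st_symbol R d i j u v) = S.sy u v"
proof -
  show "st_symbol R d i j u v \<in> carrier (Steinberg R d)"
    using cayley_h [OF u] cayley_h [OF v] cayley_h [of "u \<otimes> v"] u v by (simp add: st_symbol_def)
  have "St.cayley (st_symbol R d i j u v) = S.symb i j u v"
    using cayley_h [OF u] cayley_h [OF v] cayley_h [of "u \<otimes> v"] u v
    by (simp add: st_symbol_def S.symb_def St.cayley_mult St.cayley_inv)
  then show "St.cayley (st_symbol R d i j u v) = S.sy u v"
    using S.symb_sy [OF ij u v] by simp
qed

lemma cayley_symbols:
  assumes "set ps \<subseteq> Units R \<times> Units R"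
  shows "foldr (monoid.mult (Steinberg R d)) (map (\<lambda>(a, b). st_symbol R d i j a b) ps) \<one>\<^bsub>Steinberg R d\<^esub> \<in> carrier (Steinberg R d)
    \<and> St.cayley (foldr (monoid.mult (Steinberg R d)) (map (\<lambda>(a, b). st_symbol R d i j a b) ps) \<one>\<^bsub>Steinberg R d\<^esub>)
      = S.sprod ps"
  using assms
proof (induction ps)
  case Nil
  then show ?case by (simp add: St.cayley_one)
next
  case (Cons p ps)
  obtain u v where p: "p = (u, v)" by force
  then show ?case using Cons cayley_symbol [of u v] by (simp add: St.cayley_mult)
qed

end

text \<open>The map \<open>st_phi\<close> carried over along the embedding. The inverse image is
  meaningful only on embedded elements, which by \<open>E_cayley\<close> include all of
  \<open>S.E\<close>.\<close>

definition st_matrix :: "'a st_generator word set bijection \<Rightarrow> nat \<times> nat \<Rightarrow> 'a" where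
  "st_matrix g = st_phi R d (inv_into (carrier (Steinberg R d)) St.cayley g)"

lemma st_matrix_cayley: "g \<in> carrier (Steinberg R d) \<Longrightarrow> st_matrix (St.cayley g) = st_phi R d g"
  using St.cayley_inj by (simp add: st_matrix_def)

lemma st_phi_mult:
  "g \<in> carrier (Steinberg R d) \<Longrightarrow> k \<in> carrier (Steinberg R d)
    \<Longrightarrow> st_phi R d (g \<otimes>\<^bsub>Steinberg R d\<^esub> k) = mat_mult R d (st_phi R d g) (st_phi R d k)"
  using hom_mult [OF st_phi_hom, of g d k] by (simp add: SL_def)

lemma st_phi_sqmats: "g \<in> carrier (Steinberg R d) \<Longrightarrow> st_phi R d g \<in> sqmats R d"
  using hom_in_carrier [OF st_phi_hom, of g d] by (simp add: SL_def)

lemma E_cayley: "g \<in> S.E \<Longrightarrow> \<exists>k\<in>carrier (Steinberg R d). g = St.cayley k"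
proof (induction rule: S.E_induct)
  case one
  then show ?case using St.cayley_one by (intro bexI [of _ "\<one>\<^bsub>Steinberg R d\<^esub>"]) auto
next
  case (mult i j r g)
  then obtain k where "k \<in> carrier (Steinberg R d)" "g = St.cayley k" by blast
  then show ?case using st_x_carrier [OF mult(1-4)]
    by (intro bexI [of _ "st_x R d i j r \<otimes>\<^bsub>Steinberg R d\<^esub> k"]) (simp_all add: St.cayley_mult st_cayley_def)
qed

lemma steinberg_matrix_st_matrix: "steinberg_matrix R d st_cayley st_matrix"
proof
  show "st_matrix 1 (a, c) = (if a = c then \<one> else \<zero>)" if "a \<in> {1..d}" "c \<in> {1..d}" for a c
  proof -
    have "st_matrix 1 = word_mat R d []"
      using st_matrix_cayley [OF St.one_closed] st_phi_class [of "[]" d] by (simp add: St.cayley_one st_class_Nil)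
    then show ?thesis using that by (simp add: mat_one_def)
  qed
  show "st_matrix g (a, c) \<in> carrier R" if "g \<in> S.E" "a \<in> {1..d}" "c \<in> {1..d}" for g a c
    using E_cayley [OF that(1)] st_phi_sqmats sqmats_entry that(2,3) st_matrix_cayley by metis
  show "st_matrix (st_cayley i j r * g) (a, c) = (if a = i then st_matrix g (a, c) \<oplus> r \<otimes> st_matrix g (j, c) else st_matrix g (a, c))"
    if g: "g \<in> S.E" and ij: "i \<in> {1..d}" "j \<in> {1..d}" "i \<noteq> j" "r \<in> carrier R" and ac: "a \<in> {1..d}" "c \<in> {1..d}"
    for g i j r a c
  proof -
    obtain k where k: "k \<in> carrier (Steinberg R d)" "g = St.cayley k" using E_cayley [OF g] by blast
    note xc = st_x_carrier [OF ij]
    have "st_cayley i j r * g = St.cayley (st_x R d i j r \<otimes>\<^bsub>Steinberg R d\<^esub> k)"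
      unfolding k(2) st_cayley_def using xc k(1) by (simp add: St.cayley_mult)
    then have "st_matrix (st_cayley i j r * g) = mat_mult R d (elem_mat R d i j r) (st_matrix g)"
      using xc k by (simp add: st_matrix_cayley st_phi_mult st_phi_st_x [OF ij])
    then show ?thesis
      using elem_mat_mult_entry [OF _ ij(4,1,2) ac, of "st_matrix g"] st_phi_sqmats [OF k(1)] k by (simp add: st_matrix_cayley)
  qed
qed

interpretation MS: steinberg_matrix R d st_cayley st_matrix
  by (rule steinberg_matrix_st_matrix)

text \<open>The embedding is injective, so a product of symbols found among the permutations is
  already one in the Steinberg group.\<close>

lemma K2_symbols:
  assumes fin: "finite (carrier R)" and gens: "set gens \<subseteq> carrier R" "generate_ring R (set gens) = carrier R"
    and ij: "i \<in> {1..d}" "j \<in> {1..d}" "i \<noteq> j" and y: "y \<in> K2 R d"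
  shows "\<exists>ps. length ps = length gens + 2 \<and> set ps \<subseteq> Units R \<times> Units R \<and>
    y = foldr (monoid.mult (Steinberg R d)) (map (\<lambda>(a, b). st_symbol R d i j a b) ps) \<one>\<^bsub>Steinberg R d\<^esub>"
proof -
  have symbols_bounded: "S.symbols_bounded (length gens + 2)"
    by (rule symbols_bounded_finite [OF steinberg_rep_st_cayley fin gens])
  have yc: "y \<in> carrier (Steinberg R d)" and phi: "st_phi R d y = mat_one R d"
    using y by (auto simp: K2_def kernel_def SL_def)
  have "MS.same_matrix (St.cayley y * g) g" if gE: "g \<in> S.E" for g
  proof -
    obtain k where k: "k \<in> carrier (Steinberg R d)" "g = St.cayley k" using E_cayley [OF gE] by blast
    have "st_matrix (St.cayley y * g) = st_matrix g"
      unfolding k(2) using yc k(1)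
      by (simp add: st_matrix_cayley st_phi_mult phi mat_one_left st_phi_sqmats flip: St.cayley_mult)
    then show ?thesis by (simp add: MS.same_matrix_def)
  qed
  then have "St.cayley y \<in> S.Z"
    using MS.kernel_Z [OF _ cayley_E [OF yc]] symbols_bounded by (simp add: S.symbols_bounded_def)
  then obtain ps where ps: "length ps = length gens + 2" "set ps \<subseteq> Units R \<times> Units R"
    "St.cayley y = S.sprod ps"
    using symbols_bounded unfolding S.symbols_bounded_def by blast
  have "y = foldr (monoid.mult (Steinberg R d)) (map (\<lambda>(a, b). st_symbol R d i j a b) ps) \<one>\<^bsub>Steinberg R d\<^esub>"
    using cayley_symbols [OF ij ps(2)] ps(3) yc by (intro inj_onD [OF St.cayley_inj]) simp_all
  then show ?thesis using ps by blast
qed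

end

end

theorem theorem7:
  fixes R :: "('a, 'b) ring_scheme" (structure) and d k i j :: nat and gens :: "'a list"
  assumes "3 \<le> d"
    and "cring R" and "finite (carrier R)"
    and "length gens = k" and "set gens \<subseteq> carrier R"
    and "generate_ring R (set gens) = carrier R"
    and "i \<in> {1..d}" and "j \<in> {1..d}" and "i \<noteq> j"
  shows "\<forall>x\<in>K2 R d. \<exists>ps. length ps \<le> k + 2 \<and> set ps \<subseteq> Units R \<times> Units R \<and>
    x = foldr (monoid.mult (Steinberg R d)) (map (\<lambda>(a, b). st_symbol R d i j a b) ps) \<one>\<^bsub>Steinberg R d\<^esub>"
proof
  fix y assume "y \<in> K2 R d"
  from cring.K2_symbols [OF assms(2,1,3,5-9) this] show "\<exists>ps. length ps \<le> k + 2 \<and> set ps \<subseteq> Units R \<times> Units R \<and>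
    y = foldr (monoid.mult (Steinberg R d)) (map (\<lambda>(a, b). st_symbol R d i j a b) ps) \<one>\<^bsub>Steinberg R d\<^esub>"
    using assms(4) by (metis order_refl)
qed

end
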